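(* Let $\mu$ be a probability measure on $\mathbb{R}^d$ whose mean and covariance matrix $\mathrm{Cov}_\mu$ exist. Assume that $\mu$ is the moment measure of a strictly convex function $\varphi$ which is twice continuously differentiable. Then the field of symmetric positive-semidefinite matrices $$W(x)=\mathrm{Hess}\,\varphi\big((\nabla\varphi)^{-1}(x)\big)$$ is a solution to the optimization problem $$\min_{\substack{W':\mathbb{R}^d\to\mathcal{S}_+^d\\ \int \mathrm{tr}(W')\,\mathrm{d}\mu=\mathrm{tr}(\mathrm{Cov}_\mu)}} C(\mu,W'),$$ and $C(\mu,W)=1$.
   Context: $\mathcal{S}_+^d\subset\mathbb{R}^{d\times d}$ is the convex cone of symmetric positive-semidefinite matrices. For a probability measure $\mu$ on $\mathbb{R}^d$ and a (measurable) matrix field $W:\mathbb{R}^d\to\mathcal{S}_+^d$, the Poincaré constant $C(\mu,W)\in[0,\infty]$ is the smallest constant such that $$\mathrm{Var}_\mu(f)\le C(\mu,W)\int \nabla f(x)^\top W(x)\nabla f(x)\,\mathrm{d}\mu(x)$$ holds for every sufficiently smooth $f:\mathbb{R}^d\to\mathbb{R}$, understood here as every continuously differentiable $f$ with $\int f^2\,\mathrm{d}\mu<\infty$ and $\int \nabla f^\top W\nabla f\,\mathrm{d}\mu<\infty$; $\mathrm{Var}_\mu(f)=\int (f-\int f\,\mathrm{d}\mu)^2\,\mathrm{d}\mu$. $\mathrm{Cov}_\mu=\int (x-m)(x-m)^\top\,\mathrm{d}\mu(x)$ with $m=\int x\,\mathrm{d}\mu$. A probability measure $\mu$ is said to be the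 moment measure of a locally Lipschitz convex function $\varphi:\mathbb{R}^d\to\mathbb{R}\cup\{+\infty\}$ if $\mu$ is the pushforward of $e^{-\varphi(z)}\,\mathrm{d}z$ under $z\mapsto\nabla\varphi(z)$, i.e. $\int f(x)\,\mathrm{d}\mu(x)=\int f(\nabla\varphi(z))e^{-\varphi(z)}\,\mathrm{d}z$ for every $\mu$-integrable $f$. The map $\nabla\varphi$ is invertible onto its image, which has full $\mu$-measure; $W$ is thus defined $\mu$-almost everywhere. *)

theory Defs
  imports "HOL-Probability.Probability"
begin

section \<open>Gradient, Hessian and the cone of positive-semidefinite matrices\<close>

definition grad :: "(real ^ 'n \<Rightarrow> real) \<Rightarrow> real ^ 'n \<Rightarrow> real ^ 'n"
  where "grad f x = (THE D. GDERIV f x :> D)"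

definition Hess :: "(real ^ 'n \<Rightarrow> real) \<Rightarrow> real ^ 'n \<Rightarrow> real ^ 'n ^ 'n"
  where "Hess f x = jacobian (grad f) (at x)"

definition C1_on :: "(real ^ 'n) set \<Rightarrow> (real ^ 'n \<Rightarrow> real) \<Rightarrow> bool"
  where "C1_on S f \<longleftrightarrow> (\<forall>x\<in>S. f differentiable (at x)) \<and> continuous_on S (grad f)"

definition C2_on :: "(real ^ 'n) set \<Rightarrow> (real ^ 'n \<Rightarrow> real) \<Rightarrow> bool"
  where "C2_on S f \<longleftrightarrow>
    C1_on S f \<and> (\<forall>x\<in>S. grad f differentiable (at x)) \<and> continuous_on S (Hess f)"

definition psd_cone :: "(real ^ 'n ^ 'n) set"
  where "psd_cone = {A. transpose A = A \<and> (\<forall>v. 0 \<le> v \<bullet> (A *v v))}"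

lemma grad_eqI:
  assumes "GDERIV f x :> D"
  shows "grad f x = D"
  unfolding grad_def
proof (rule the_equality[where P = "\<lambda>D. GDERIV f x :> D", OF assms])
  fix D' assume "GDERIV f x :> D'"
  then have "(\<lambda>h. h \<bullet> D') = (\<lambda>h. h \<bullet> D)"
    using assms unfolding gderiv_def by (rule has_derivative_unique)
  then show "D' = D"
    by (metis inner_commute vector_eq_ldot)
qed


section \<open>Mean and covariance\<close>

definition mean :: "(real ^ 'n) measure \<Rightarrow> real ^ 'n"
  where "mean \<mu> = (LINT x|\<mu>. x)"

definition cov_integrand :: "(real ^ 'n) measure \<Rightarrow> real ^ 'n \<Rightarrow> real ^ 'n ^ 'n"
  where "cov_integrand \<mu> x = (\<chi> i j. (x - mean \<mu>) $ i * (x - mean \<mu>) $ j)"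

definition Cov :: "(real ^ 'n) measure \<Rightarrow> real ^ 'n ^ 'n"
  where "Cov \<mu> = (LINT x|\<mu>. cov_integrand \<mu> x)"

definition mean_cov_exist :: "(real ^ 'n) measure \<Rightarrow> bool"
  where "mean_cov_exist \<mu> \<longleftrightarrow>
    integrable \<mu> (\<lambda>x. x) \<and> integrable \<mu> (cov_integrand \<mu>)"


section \<open>The Poincare constant of a matrix field\<close>

definition Var :: "(real ^ 'n) measure \<Rightarrow> (real ^ 'n \<Rightarrow> real) \<Rightarrow> real"
  where "Var \<mu> f = (LINT x|\<mu>. (f x - (LINT y|\<mu>. f y))\<^sup>2)"

definition energy ::
  "(real ^ 'n) measure \<Rightarrow> (real ^ 'n \<Rightarrow> real ^ 'n ^ 'n) \<Rightarrow> (real ^ 'n \<Rightarrow> real) \<Rightarrow> ennreal"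
  where "energy \<mu> W f = (\<integral>\<^sup>+x. ennreal (grad f x \<bullet> (W x *v grad f x)) \<partial>\<mu>)"

definition test_functions ::
  "(real ^ 'n) measure \<Rightarrow> (real ^ 'n \<Rightarrow> real ^ 'n ^ 'n) \<Rightarrow> (real ^ 'n \<Rightarrow> real) set"
  where "test_functions \<mu> W =
    {f. C1_on UNIV f \<and> integrable \<mu> (\<lambda>x. (f x)\<^sup>2) \<and> energy \<mu> W f < \<infinity>}"

text \<open>The infimum of the empty set of constants is \<open>\<infinity>\<close>.  The product \<open>\<infinity> * 0 = 0\<close> is
  harmless: \<open>C = \<infinity>\<close> does not change the infimum.\<close>

definition poincare_const ::
  "(real ^ 'n) measure \<Rightarrow> (real ^ 'n \<Rightarrow> real ^ 'n ^ 'n) \<Rightarrow> ennreal"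
  where "poincare_const \<mu> W =
    Inf {C. \<forall>f\<in>test_functions \<mu> W. ennreal (Var \<mu> f) \<le> C * energy \<mu> W f}"

definition feasible_fields :: "(real ^ 'n) measure \<Rightarrow> (real ^ 'n \<Rightarrow> real ^ 'n ^ 'n) set"
  where "feasible_fields \<mu> =
    {W. W \<in> borel_measurable \<mu> \<and> (\<forall>x. W x \<in> psd_cone) \<and>
        has_bochner_integral \<mu> (\<lambda>x. trace (W x)) (trace (Cov \<mu>))}"


section \<open>Convex functions with values in the reals and plus infinity\<close>

definition edom :: "(real ^ 'n \<Rightarrow> ereal) \<Rightarrow> (real ^ 'n) set"
  where "edom \<phi> = {z. \<phi> z < \<infinity>}"

definition fin :: "(real ^ 'n \<Rightarrow> ereal) \<Rightarrow> real ^ 'n \<Rightarrow> real"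
  where "fin \<phi> z = real_of_ereal (\<phi> z)"

definition convex_fun :: "(real ^ 'n \<Rightarrow> ereal) \<Rightarrow> bool"
  where "convex_fun \<phi> \<longleftrightarrow> (\<forall>z. \<phi> z \<noteq> -\<infinity>) \<and>
    (\<forall>x y t. 0 < t \<and> t < 1 \<longrightarrow>
      \<phi> ((1 - t) *\<^sub>R x + t *\<^sub>R y) \<le> ereal (1 - t) * \<phi> x + ereal t * \<phi> y)"

definition strictly_convex_fun :: "(real ^ 'n \<Rightarrow> ereal) \<Rightarrow> bool"
  where "strictly_convex_fun \<phi> \<longleftrightarrow> (\<forall>z. \<phi> z \<noteq> -\<infinity>) \<and>
    (\<forall>x\<in>edom \<phi>. \<forall>y\<in>edom \<phi>. \<forall>t. x \<noteq> y \<and> 0 < t \<and> t < 1 \<longrightarrow>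
      \<phi> ((1 - t) *\<^sub>R x + t *\<^sub>R y) < ereal (1 - t) * \<phi> x + ereal t * \<phi> y)"

text \<open>A locally Lipschitz function with values in the reals and \<open>\<infinity>\<close> is continuous as an
  extended-valued function, and finite and Lipschitz on a ball around each point of its domain.
  Its domain is hence open, and it tends to \<open>\<infinity>\<close> at the boundary of its domain.  For a finite
  function this is the usual notion.\<close>

definition locally_lipschitz_fun :: "(real ^ 'n \<Rightarrow> ereal) \<Rightarrow> bool"
  where "locally_lipschitz_fun \<phi> \<longleftrightarrow> continuous_on UNIV \<phi> \<and>
    (\<forall>z\<in>edom \<phi>. \<exists>u>0. \<exists>L. ball z u \<subseteq> edom \<phi> \<and> L-lipschitz_on (ball z u) (fin \<phi>))"


section \<open>Moment measures\<close>

text \<open>The weight \<open>e\<^sup>-\<^sup>\<phi>\<close>, with value \<open>0\<close> where \<open>\<phi>\<close> is infinite.\<close>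

definition gibbs_weight :: "(real ^ 'n \<Rightarrow> ereal) \<Rightarrow> real ^ 'n \<Rightarrow> ennreal"
  where "gibbs_weight \<phi> z = (if z \<in> edom \<phi> then ennreal (exp (- fin \<phi> z)) else 0)"

definition is_moment_measure :: "(real ^ 'n) measure \<Rightarrow> (real ^ 'n \<Rightarrow> ereal) \<Rightarrow> bool"
  where "is_moment_measure \<mu> \<phi> \<longleftrightarrow> convex_fun \<phi> \<and> locally_lipschitz_fun \<phi> \<and>
    \<mu> = distr (density lborel (gibbs_weight \<phi>)) borel (grad (fin \<phi>))"

text \<open>The field is only determined on the image of the gradient, which has full measure; it is
  extended by \<open>0\<close>.\<close>

definition moment_field :: "(real ^ 'n \<Rightarrow> ereal) \<Rightarrow> real ^ 'n \<Rightarrow> real ^ 'n ^ 'n"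
  where "moment_field \<phi> x =
    (if x \<in> grad (fin \<phi>) ` edom \<phi>
     then Hess (fin \<phi>) (inv_into (edom \<phi>) (grad (fin \<phi>)) x) else 0)"

end

(* Write T = grad phi.  With g = f o T on the domain of phi, the inequality C(mu, W) <= 1 is the
   Brascamp-Lieb inequality for g and the density exp (- phi).  It is the second-order form, in the
   direction f, of the concavity of psi |-> log (integral of exp (- L psi)) at psi = L phi, where L
   is the Legendre transform; this concavity is the Prekopa-Leindler inequality.  The expansion is
   carried out on compact convex subsets of the domain, where it is uniform, and the subsets then
   exhaust the domain; no boundary condition is needed because the restricted density is still
   log-concave.  Conversely, summing the Poincare inequality over the coordinate functions gives
   tr Cov <= C(mu, W') tr Cov for every feasible W'.  Feasibility of W is an integration by parts. *)

theory Submission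
  imports Defs
begin

section \<open>The Prekopa-Leindler inequality\<close>

text \<open>\<open>Hess u\<close> may be singular, so the inverse Hessian of the usual Brascamp-Lieb
  inequality need not exist, and L phi need not be twice differentiable. Perturbing on the dual side
  avoids both: the second-order term of L (L phi + e f) involves only \<open>Hess u\<close> applied
  to grad f. No Legendre transform is formed. Its supremum over x becomes an inequality for every
  \<open>y\<close> in the compact set, with x = T y, and only the midpoint \<open>y\<close> of two
  points p and p' is ever used. Taken with e at p and with -e at p', the two inequalities have
  opposite slopes and opposite values of f (T y); both cancel in the sum, which is then exactly the
  hypothesis of Prekopa-Leindler with exp (- u) at the midpoint. A strict failure of the variance
  bound would make both perturbed integrals exceed the unperturbed one by a multiple of e^2, against
  Prekopa-Leindler. Another obstacle is that the domain may be a proper open set, with T unbounded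
  on it. Finite total mass and blow-up of phi at the boundary make the sublevel sets compact; they
  provide both the exhaustion and the cutoffs for the integrations by parts.\<close>

text \<open>With m = max K and l = min L, the sets (K + l)/2 and (m + L)/2 both lie in
  \<open>C\<close> and meet at most in the point (m + l)/2, which is a null set.\<close>

lemma brunn_minkowski_real_compact:
  fixes K L C :: "real set"
  assumes K: "compact K" "K \<noteq> {}" and L: "compact L" "L \<noteq> {}" and C: "C \<in> sets borel"
    and mid: "\<And>x y. x \<in> K \<Longrightarrow> y \<in> L \<Longrightarrow> (x + y) / 2 \<in> C"
  shows "emeasure lborel K + emeasure lborel L \<le> 2 * emeasure lborel C"
proof -
  obtain m where m: "m \<in> K" "\<And>x. x \<in> K \<Longrightarrow> x \<le> m" using compact_attains_sup[OF K] by blast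
  obtain l where l: "l \<in> L" "\<And>y. y \<in> L \<Longrightarrow> l \<le> y" using compact_attains_inf[OF L] by blast
  have KL[measurable]: "K \<in> sets borel" "L \<in> sets borel" "C \<in> sets borel"
    using K L C by (auto simp: borel_compact)
  have half: "emeasure lborel S = 2 * (\<integral>\<^sup>+x. indicator S (- a + 2 * x) \<partial>lborel)"
    if [measurable]: "S \<in> sets borel" for S :: "real set" and a
    using nn_integral_real_affine[of "indicator S" 2 "-a"] by simp
  have "emeasure lborel K + emeasure lborel L
      = 2 * ((\<integral>\<^sup>+x. indicator K (- l + 2 * x) \<partial>lborel) + (\<integral>\<^sup>+x. indicator L (- m + 2 * x) \<partial>lborel))"
    by (simp add: half[OF KL(1), of l] half[OF KL(2), of m] distrib_left)
  also have "(\<integral>\<^sup>+x. indicator K (- l + 2 * x) \<partial>lborel) + (\<integral>\<^sup>+x. indicator L (- m + 2 * x) \<partial>lborel)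
      = (\<integral>\<^sup>+x. indicator K (- l + 2 * x) + indicator L (- m + 2 * x) \<partial>lborel)"
    by (subst nn_integral_add) auto
  also have "\<dots> \<le> (\<integral>\<^sup>+x. indicator C x \<partial>lborel)"
  proof (rule nn_integral_mono_AE)
    have "AE x in lborel. x \<noteq> (m + l) / 2" by (rule AE_lborel_singleton)
    then show "AE x in lborel. indicator K (- l + 2 * x) + indicator L (- m + 2 * x)
        \<le> (indicator C x :: ennreal)"
    proof eventually_elim
      case (elim x)
      have 1: "x \<in> C" if "- l + 2 * x \<in> K" using mid[OF that l(1)] by simp
      have 2: "x \<in> C" if "- m + 2 * x \<in> L" using mid[OF m(1) that] by simp
      have 3: False if "- l + 2 * x \<in> K" "- m + 2 * x \<in> L"
        using m(2)[OF that(1)] l(2)[OF that(2)] elim by (simp add: field_simps)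
      show ?case using 1 2 3 by (auto simp: indicator_def)
    qed
  qed
  finally show ?thesis by (simp add: mult_left_mono)
qed

lemma brunn_minkowski_real_bounded:
  fixes A B C :: "real set"
  assumes A: "A \<in> sets borel" "A \<noteq> {}" "bounded A" and B: "B \<in> sets borel" "B \<noteq> {}" "bounded B"
    and C: "C \<in> sets borel"
    and mid: "\<And>x y. x \<in> A \<Longrightarrow> y \<in> B \<Longrightarrow> (x + y) / 2 \<in> C"
  shows "emeasure lborel A + emeasure lborel B \<le> 2 * emeasure lborel C"
proof (rule ennreal_le_epsilon)
  fix e :: real assume e: "0 < e"
  have inner: "\<exists>K. compact K \<and> K \<noteq> {} \<and> K \<subseteq> S \<and> emeasure lborel S \<le> emeasure lborel K + ennreal (e/2)"
    if S: "S \<in> sets borel" "S \<noteq> {}" "bounded S" for S :: "real set"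
  proof -
    obtain T where T: "closed T" "T \<subseteq> S" "emeasure lebesgue (S - T) < ennreal (e/2)"
      using sets_lebesgue_inner_closed[of S "e/2"] S(1) e by (metis half_gt_zero sets_completionI_sets sets_lborel)
    \<comment> \<open>\<open>T\<close> may be empty when \<open>S\<close> is null; adding one point
      of \<open>S\<close> keeps the compact set nonempty.\<close>
    obtain s where s: "s \<in> S" using S by auto
    have cT: "compact T" using T(1,2) bounded_subset[OF S(3)] compact_eq_bounded_closed by blast
    have *: "S - T \<in> sets borel" "T \<in> sets borel" using S T by auto
    have "emeasure lborel S = emeasure lborel (T \<union> (S - T))"
      using T by (simp add: Un_absorb1)
    also have "\<dots> \<le> emeasure lborel T + emeasure lborel (S - T)"
      using * by (intro emeasure_subadditive) auto
    also have "\<dots> \<le> emeasure lborel (insert s T) + ennreal (e/2)"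
    proof (rule add_mono)
      show "emeasure lborel T \<le> emeasure lborel (insert s T)" using * by (intro emeasure_mono) auto
      show "emeasure lborel (S - T) \<le> ennreal (e/2)" using T(3) * by (simp add: less_imp_le)
    qed
    finally show ?thesis using cT s T by (intro exI[of _ "insert s T"]) auto
  qed
  obtain K where K: "compact K" "K \<noteq> {}" "K \<subseteq> A" "emeasure lborel A \<le> emeasure lborel K + ennreal (e/2)"
    using inner[OF A] by blast
  obtain L where L: "compact L" "L \<noteq> {}" "L \<subseteq> B" "emeasure lborel B \<le> emeasure lborel L + ennreal (e/2)"
    using inner[OF B] by blast
  have ee: "ennreal (e/2) + ennreal (e/2) = ennreal e"
    using e by (simp flip: ennreal_plus)
  have "emeasure lborel A + emeasure lborel B
      \<le> (emeasure lborel K + ennreal (e/2)) + (emeasure lborel L + ennreal (e/2))"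
    using K L by (intro add_mono)
  also have "\<dots> = emeasure lborel K + emeasure lborel L + ennreal e"
    unfolding ee[symmetric] by (simp only: add.assoc add.left_commute add.commute)
  also have "\<dots> \<le> 2 * emeasure lborel C + ennreal e"
    using K(3) L(3)
    by (intro add_mono brunn_minkowski_real_compact[OF K(1,2) L(1,2) C] mid order_refl) (erule (1) subsetD)+
  finally show "emeasure lborel A + emeasure lborel B \<le> 2 * emeasure lborel C + ennreal e" .
qed

lemma brunn_minkowski_real:
  fixes A B C :: "real set"
  assumes A: "A \<in> sets borel" "A \<noteq> {}" and B: "B \<in> sets borel" "B \<noteq> {}"
    and C: "C \<in> sets borel"
    and mid: "\<And>x y. x \<in> A \<Longrightarrow> y \<in> B \<Longrightarrow> (x + y) / 2 \<in> C"
  shows "emeasure lborel A + emeasure lborel B \<le> 2 * emeasure lborel C"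
proof -
  obtain a b where ab: "a \<in> A" "b \<in> B" using A B by auto
  \<comment> \<open>The radius starts at the larger of |a| and |b| so that both truncated sets are
    nonempty for every \<open>n\<close>.\<close>
  define I where "I n = {- max \<bar>a\<bar> \<bar>b\<bar> - real n .. max \<bar>a\<bar> \<bar>b\<bar> + real n}" for n
  have incI: "incseq (\<lambda>n. S \<inter> I n)" for S by (auto simp: incseq_def I_def)
  have UI: "(\<Union>n. S \<inter> I n) = S" for S
  proof -
    have "\<exists>n. x \<in> I n" for x
    proof -
      obtain n where "\<bar>x\<bar> \<le> real n" using real_arch_simple by blast
      then show ?thesis by (intro exI[of _ n]) (auto simp: I_def)
    qed
    then show ?thesis by auto
  qed
  have sup: "emeasure lborel S = (SUP n. emeasure lborel (S \<inter> I n))" if "S \<in> sets borel" for S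
  proof -
    have "range (\<lambda>n. S \<inter> I n) \<subseteq> sets lborel" using that by (auto simp: I_def)
    from SUP_emeasure_incseq[OF this incI[of S]] show ?thesis by (simp only: UI)
  qed
  have inc: "incseq (\<lambda>n. emeasure lborel (S \<inter> I n))" if "S \<in> sets borel" for S
    using incI[of S] that by (auto simp: incseq_def I_def intro!: emeasure_mono)
  have "emeasure lborel A + emeasure lborel B
      = (SUP n. emeasure lborel (A \<inter> I n) + emeasure lborel (B \<inter> I n))"
    unfolding sup[OF A(1)] sup[OF B(1)] using inc A B by (intro ennreal_SUP_add[symmetric]) auto
  also have "\<dots> \<le> 2 * emeasure lborel C"
  proof (rule SUP_least)
    fix n
    have "a \<in> A \<inter> I n" "b \<in> B \<inter> I n" using ab by (auto simp: I_def)
    moreover have "I n \<in> sets borel" "bounded (I n)" by (auto simp: I_def)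
    ultimately show "emeasure lborel (A \<inter> I n) + emeasure lborel (B \<inter> I n) \<le> 2 * emeasure lborel C"
      using A B C mid by (intro brunn_minkowski_real_bounded) (auto intro: bounded_subset[of "I n"])
  qed
  finally show ?thesis .
qed

text \<open>The value \<open>f x\<close>, even if infinite, is the length of the set of t > 0 with t
  < f x; then the order of integration is exchanged.\<close>

lemma nn_integral_layer_cake:
  fixes f :: "real \<Rightarrow> ennreal"
  assumes [measurable]: "f \<in> borel_measurable borel"
  shows "(\<integral>\<^sup>+x. f x \<partial>lborel) = (\<integral>\<^sup>+t. indicator {0<..} t * emeasure lborel {x. ennreal t < f x} \<partial>lborel)"
proof -
  have *: "(\<integral>\<^sup>+t. indicator {t. 0 < t \<and> ennreal t < c} t \<partial>lborel) = c" for c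
  proof (cases c)
    case (real r)
    have "{t. 0 < t \<and> ennreal t < ennreal r} = {0<..<r}" 
      by (auto simp: ennreal_less_iff)
    then show ?thesis using real by simp
  next
    case top
    have "emeasure lborel ({0<..} :: real set) = top"
    proof -
      have "top = (SUP n. of_nat n :: ennreal)" by (rule ennreal_SUP_of_nat_eq_top[symmetric])
      also have "\<dots> \<le> emeasure lborel ({0<..} :: real set)"
      proof (rule SUP_least)
        fix n :: nat
        have "of_nat n = emeasure lborel {0<..<real n}" by (simp add: ennreal_of_nat_eq_real_of_nat)
        also have "\<dots> \<le> emeasure lborel ({0<..} :: real set)" by (intro emeasure_mono) auto
        finally show "of_nat n \<le> emeasure lborel ({0<..} :: real set)" .
      qed
      finally show ?thesis by (simp add: top.extremum_unique)
    qed
    moreover have "{t. 0 < t \<and> ennreal t < top} = {0::real<..}" by auto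
    ultimately show ?thesis using top by simp
  qed
  have "(\<integral>\<^sup>+x. f x \<partial>lborel)
      = (\<integral>\<^sup>+x. \<integral>\<^sup>+t. indicator {0<..} t * indicator {x. ennreal t < f x} x \<partial>lborel \<partial>lborel)"
  proof (intro nn_integral_cong)
    fix x
    have "f x = (\<integral>\<^sup>+t. indicator {t. 0 < t \<and> ennreal t < f x} t \<partial>lborel)" by (simp only: *)
    also have "\<dots> = (\<integral>\<^sup>+t. indicator {0<..} t * indicator {x. ennreal t < f x} x \<partial>lborel)"
      by (intro nn_integral_cong) (auto simp: indicator_def)
    finally show "f x = (\<integral>\<^sup>+t. indicator {0<..} t * indicator {x. ennreal t < f x} x \<partial>lborel)" .
  qed
  also have "\<dots> = (\<integral>\<^sup>+t. \<integral>\<^sup>+x. indicator {0<..} t * indicator {x. ennreal t < f x} x \<partial>lborel \<partial>lborel)"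
    by (intro lborel_pair.Fubini') measurable
  also have "\<dots> = (\<integral>\<^sup>+t. indicator {0<..} t * emeasure lborel {x. ennreal t < f x} \<partial>lborel)"
    by (intro nn_integral_cong) (subst nn_integral_cmult, auto)
  finally show ?thesis .
qed

text \<open>Rescaling the level by \<open>a\<close> lets functions with different suprema be
  compared over the same parameter interval (0, 1). For a function bounded by \<open>a\<close> no
  higher level contributes.\<close>

lemma nn_integral_layer_cake_ge:
  fixes f :: "real \<Rightarrow> ennreal"
  assumes [measurable]: "f \<in> borel_measurable borel" and a: "0 < a"
  shows "ennreal a * (\<integral>\<^sup>+t. indicator {0<..<1} t * emeasure lborel {x. ennreal (a * t) < f x} \<partial>lborel)
    \<le> (\<integral>\<^sup>+x. f x \<partial>lborel)"
    and "(\<And>x. f x \<le> ennreal a) \<Longrightarrow>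
    (\<integral>\<^sup>+x. f x \<partial>lborel) = ennreal a * (\<integral>\<^sup>+t. indicator {0<..<1} t * emeasure lborel {x. ennreal (a * t) < f x} \<partial>lborel)"
proof -
  have [measurable]: "(\<lambda>t. emeasure lborel {x. ennreal t < f x}) \<in> borel_measurable borel"
  proof -
    have "(\<lambda>t. \<integral>\<^sup>+x. indicator {x. ennreal t < f x} x \<partial>lborel) \<in> borel_measurable borel"
      by measurable
    then show ?thesis by simp
  qed
  have eq: "(\<integral>\<^sup>+x. f x \<partial>lborel)
      = ennreal a * (\<integral>\<^sup>+t. indicator {0<..} t * emeasure lborel {x. ennreal (a * t) < f x} \<partial>lborel)"
  proof -
    have "(\<integral>\<^sup>+x. f x \<partial>lborel)
        = ennreal a * (\<integral>\<^sup>+t. indicator {0<..} (0 + a * t) * emeasure lborel {x. ennreal (0 + a * t) < f x} \<partial>lborel)"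
      unfolding nn_integral_layer_cake[OF assms(1)]
      using a by (subst nn_integral_real_affine[of _ a 0]) auto
    also have "\<dots> = ennreal a * (\<integral>\<^sup>+t. indicator {0<..} t * emeasure lborel {x. ennreal (a * t) < f x} \<partial>lborel)"
      using a by (intro arg_cong2[of _ _ _ _ "(*)"] nn_integral_cong refl) (auto simp: indicator_def zero_less_mult_iff)
    finally show ?thesis .
  qed
  show "ennreal a * (\<integral>\<^sup>+t. indicator {0<..<1} t * emeasure lborel {x. ennreal (a * t) < f x} \<partial>lborel)
    \<le> (\<integral>\<^sup>+x. f x \<partial>lborel)"
    unfolding eq by (intro mult_left_mono nn_integral_mono) (auto simp: indicator_def)
  assume le: "\<And>x. f x \<le> ennreal a"
  have empty: "emeasure lborel {x. ennreal (a * t) < f x} = 0" if "1 \<le> t" for t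
  proof -
    have "a \<le> a * t" using that a by simp
    then have "f x \<le> ennreal (a * t)" for x using le[of x] by (rule order_trans[OF _ ennreal_leI, rotated])
    then have "{x. ennreal (a * t) < f x} = {}" by (auto simp: not_less)
    then show ?thesis by simp
  qed
  show "(\<integral>\<^sup>+x. f x \<partial>lborel) = ennreal a * (\<integral>\<^sup>+t. indicator {0<..<1} t * emeasure lborel {x. ennreal (a * t) < f x} \<partial>lborel)"
    unfolding eq
  proof (rule arg_cong2[of _ _ _ _ "(*)", OF refl nn_integral_cong])
    fix t :: real
    show "indicator {0<..} t * emeasure lborel {x. ennreal (a * t) < f x}
        = indicator {0<..<1} t * emeasure lborel {x. ennreal (a * t) < f x}"
    proof (cases "1 \<le> t")
      case True
      then show ?thesis by (simp only: empty mult_zero_right)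
    next
      case False
      then have "t \<in> {0<..} \<longleftrightarrow> t \<in> {0<..<1}" by auto
      then show ?thesis by (simp add: indicator_def)
    qed
  qed
qed

text \<open>\<open>a\<close> and \<open>b\<close> are the suprema of \<open>f\<close> and
  \<open>g\<close>, so for t in (0, 1) the superlevel sets at a t and b t are nonempty and
  Brunn-Minkowski applies to them. Integrating over t gives F + G <= 2 H.\<close>

lemma prekopa_leindler_real_normalized:
  fixes f g h :: "real \<Rightarrow> ennreal"
  assumes [measurable]: "f \<in> borel_measurable borel" "g \<in> borel_measurable borel" "h \<in> borel_measurable borel"
    and le: "\<And>x y. f x * g y \<le> (h ((x + y) / 2))\<^sup>2"
    and a: "0 < a" "\<And>x. f x \<le> ennreal a" "\<And>c. c < a \<Longrightarrow> \<exists>x. ennreal c < f x"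
    and b: "0 < b" "\<And>x. g x \<le> ennreal b" "\<And>c. c < b \<Longrightarrow> \<exists>x. ennreal c < g x"
  shows "(\<integral>\<^sup>+x. f x \<partial>lborel) * (\<integral>\<^sup>+x. g x \<partial>lborel) \<le> (\<integral>\<^sup>+x. h x \<partial>lborel)\<^sup>2"
proof -
  \<comment> \<open>Geometric mean of the two suprema: midpoints of the levels a t of
    \<open>f\<close> and b t of \<open>g\<close> fall into the level s t of
    \<open>h\<close>.\<close>
  define s where "s = sqrt (a * b)"
  have s: "0 < s" "s\<^sup>2 = a * b" using a b by (auto simp: s_def)
  have meas: "(\<lambda>t. emeasure lborel {x. ennreal (c * t) < u x}) \<in> borel_measurable borel"
    if [measurable]: "u \<in> borel_measurable borel" for u :: "real \<Rightarrow> ennreal" and c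
  proof -
    have "(\<lambda>t. \<integral>\<^sup>+x. indicator {x. ennreal (c * t) < u x} x \<partial>lborel) \<in> borel_measurable borel"
      by measurable
    then show ?thesis by simp
  qed
  note [measurable] = meas[OF assms(1)] meas[OF assms(2)] meas[OF assms(3)]
  define F where "F = (\<integral>\<^sup>+t. indicator {0<..<1} t * emeasure lborel {x. ennreal (a * t) < f x} \<partial>lborel)"
  define G where "G = (\<integral>\<^sup>+t. indicator {0<..<1} t * emeasure lborel {x. ennreal (b * t) < g x} \<partial>lborel)"
  define H where "H = (\<integral>\<^sup>+t. indicator {0<..<1} t * emeasure lborel {x. ennreal (s * t) < h x} \<partial>lborel)"
  have F: "(\<integral>\<^sup>+x. f x \<partial>lborel) = ennreal a * F" unfolding F_def
    by (rule nn_integral_layer_cake_ge(2)) (use a in auto)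
  have G: "(\<integral>\<^sup>+x. g x \<partial>lborel) = ennreal b * G" unfolding G_def
    by (rule nn_integral_layer_cake_ge(2)) (use b in auto)
  have H: "ennreal s * H \<le> (\<integral>\<^sup>+x. h x \<partial>lborel)" unfolding H_def
    by (rule nn_integral_layer_cake_ge(1)) (use s in auto)
  have "F + G = (\<integral>\<^sup>+t. indicator {0<..<1} t * (emeasure lborel {x. ennreal (a * t) < f x}
      + emeasure lborel {x. ennreal (b * t) < g x}) \<partial>lborel)"
    unfolding F_def G_def by (subst nn_integral_add[symmetric]) (auto simp: distrib_left)
  also have "\<dots> \<le> (\<integral>\<^sup>+t. 2 * (indicator {0<..<1} t * emeasure lborel {x. ennreal (s * t) < h x}) \<partial>lborel)"
  proof (rule nn_integral_mono)
    fix t :: real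
    have "emeasure lborel {x. ennreal (a * t) < f x} + emeasure lborel {x. ennreal (b * t) < g x}
        \<le> 2 * emeasure lborel {x. ennreal (s * t) < h x}" if t: "0 < t" "t < 1"
    proof (rule brunn_minkowski_real)
      show "{x. ennreal (a * t) < f x} \<noteq> {}" using a(3)[of "a * t"] a(1) t by simp
      show "{x. ennreal (b * t) < g x} \<noteq> {}" using b(3)[of "b * t"] b(1) t by simp
      fix x y assume "x \<in> {x. ennreal (a * t) < f x}" "y \<in> {x. ennreal (b * t) < g x}"
      then have xy: "ennreal (a * t) < f x" "ennreal (b * t) < g y" by auto
      have "(ennreal (s * t))\<^sup>2 = ennreal (a * t) * ennreal (b * t)"
        using a b s t by (simp add: ennreal_power power_mult_distrib flip: ennreal_mult)
          (simp add: power2_eq_square ac_simps)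
      also have "\<dots> < f x * g y"
      proof -
        have "ennreal (a * t) * ennreal (b * t) < f x * ennreal (b * t)"
          using xy a b t by (intro ennreal_mult_strict_right_mono) (auto simp: ennreal_zero_less_mult_iff)
        also have "\<dots> \<le> f x * g y" using xy by (intro mult_left_mono) auto
        finally show ?thesis .
      qed
      also have "\<dots> \<le> (h ((x + y) / 2))\<^sup>2" by (rule le)
      finally have "ennreal (s * t) < h ((x + y) / 2)" by (meson not_less power_mono zero_le)
      then show "(x + y) / 2 \<in> {x. ennreal (s * t) < h x}" by simp
    qed measurable
    then show "indicator {0<..<1} t * (emeasure lborel {x. ennreal (a * t) < f x}
      + emeasure lborel {x. ennreal (b * t) < g x})
      \<le> 2 * (indicator {0<..<1} t * emeasure lborel {x. ennreal (s * t) < h x})"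
      by (auto simp: indicator_def)
  qed
  also have "\<dots> = 2 * H" unfolding H_def by (subst nn_integral_cmult) auto
  finally have FGH: "F + G \<le> 2 * H" .
  \<comment> \<open>Arithmetic-geometric mean: F G <= ((F + G) / 2)^2.\<close>
  have "F * G \<le> H\<^sup>2"
  proof (cases "H = top")
    case False
    then obtain r where r: "0 \<le> r" "H = ennreal r" by (cases H) auto
    have "F + G \<le> ennreal (2 * r)" using FGH r by (simp add: ennreal_mult)
    then have "F + G < top" using ennreal_less_top order_le_less_trans by blast
    then have "F \<noteq> top" "G \<noteq> top" by (auto simp: less_top)
    then obtain p q where p: "0 \<le> p" "F = ennreal p" and q: "0 \<le> q" "G = ennreal q"
      by (cases F; cases G) auto
    have "p + q \<le> 2 * r" using \<open>F + G \<le> ennreal (2 * r)\<close> p q r by (simp flip: ennreal_plus)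
    then have "(p + q)\<^sup>2 \<le> (2 * r)\<^sup>2" using p q by (intro power_mono) auto
    moreover have "4 * (p * q) \<le> (p + q)\<^sup>2" using zero_le_power2[of "p - q"] by (simp add: power2_eq_square algebra_simps)
    ultimately have "p * q \<le> r\<^sup>2" by (simp add: power2_eq_square)
    then show ?thesis using p q r by (simp add: ennreal_power flip: ennreal_mult)
  qed (auto simp: power2_eq_square ennreal_top_mult)
  have "ennreal a * F * (ennreal b * G) = (ennreal s)\<^sup>2 * (F * G)"
    using a b s by (simp add: ennreal_power ennreal_mult ac_simps)
  also have "\<dots> \<le> (ennreal s)\<^sup>2 * H\<^sup>2" using \<open>F * G \<le> H\<^sup>2\<close> by (intro mult_left_mono) auto
  also have "\<dots> = (ennreal s * H)\<^sup>2" by (simp add: power_mult_distrib)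
  also have "\<dots> \<le> (\<integral>\<^sup>+x. h x \<partial>lborel)\<^sup>2" using H by (intro power_mono) auto
  finally show ?thesis unfolding F G .
qed

text \<open>Truncating \<open>f\<close> and \<open>g\<close> at n makes their suprema finite and
  preserves the hypothesis. Functions that vanish identically have no positive supremum and are
  treated apart. The truncation levels of the two factors must vary independently for the two
  suprema to be pulled out of the product; their maximum reduces this to a common level.\<close>

lemma prekopa_leindler_real:
  fixes f g h :: "real \<Rightarrow> ennreal"
  assumes [measurable]: "f \<in> borel_measurable borel" "g \<in> borel_measurable borel" "h \<in> borel_measurable borel"
    and le: "\<And>x y. f x * g y \<le> (h ((x + y) / 2))\<^sup>2"
  shows "(\<integral>\<^sup>+x. f x \<partial>lborel) * (\<integral>\<^sup>+x. g x \<partial>lborel) \<le> (\<integral>\<^sup>+x. h x \<partial>lborel)\<^sup>2"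
proof -
  have sup: "(\<exists>a>0. (\<forall>x. u x \<le> ennreal a) \<and> (\<forall>c<a. \<exists>x. ennreal c < u x)) \<or> (\<forall>x. u x = 0)"
    if bd: "\<And>x. u x \<le> of_nat n" for u :: "real \<Rightarrow> ennreal" and n
  proof (cases "(SUP x. u x) = 0")
    case False
    have "(SUP x. u x) \<le> of_nat n" using bd by (intro SUP_least)
    then obtain a where a: "0 \<le> a" "(SUP x. u x) = ennreal a"
      by (cases "SUP x. u x") (auto simp: top_unique)
    with False have "0 < a" by (cases "a = 0") auto
    moreover have "u x \<le> ennreal a" for x unfolding a(2)[symmetric] by (rule SUP_upper) simp
    moreover have "\<exists>x. ennreal c < u x" if "c < a" for c
    proof -
      have "ennreal c < (SUP x. u x)" using that \<open>0 < a\<close> a by (simp add: ennreal_lessI)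
      then show ?thesis by (auto simp: less_SUP_iff)
    qed
    ultimately show ?thesis by blast
  next
    case True
    then show ?thesis by (auto simp: bot_ennreal[symmetric] SUP_eq_iff SUP_bot_conv)
  qed
  have bnd: "(\<integral>\<^sup>+x. min (f x) (of_nat n) \<partial>lborel) * (\<integral>\<^sup>+x. min (g x) (of_nat n) \<partial>lborel)
      \<le> (\<integral>\<^sup>+x. h x \<partial>lborel)\<^sup>2" for n :: nat
  proof -
    let ?f = "\<lambda>x. min (f x) (of_nat n)" and ?g = "\<lambda>x. min (g x) (of_nat n)"
    consider "\<forall>x. ?f x = 0" | "\<forall>x. ?g x = 0"
      | "\<exists>a>0. (\<forall>x. ?f x \<le> ennreal a) \<and> (\<forall>c<a. \<exists>x. ennreal c < ?f x)"
        "\<exists>b>0. (\<forall>x. ?g x \<le> ennreal b) \<and> (\<forall>c<b. \<exists>x. ennreal c < ?g x)"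
      using sup[of ?f n] sup[of ?g n] by fastforce
    then show ?thesis
    proof cases
      case 3
      then obtain a b where "0 < a" "\<forall>x. ?f x \<le> ennreal a" "\<forall>c<a. \<exists>x. ennreal c < ?f x"
        "0 < b" "\<forall>x. ?g x \<le> ennreal b" "\<forall>c<b. \<exists>x. ennreal c < ?g x" by blast
      moreover have "?f x * ?g y \<le> (h ((x + y) / 2))\<^sup>2" for x y
        by (rule order_trans[OF mult_mono le]) auto
      ultimately show ?thesis
        by (intro prekopa_leindler_real_normalized[of ?f ?g h a b]) auto
    qed simp_all
  qed
  have inc: "incseq (\<lambda>n x. min (u x) (of_nat n))" for u :: "real \<Rightarrow> ennreal"
    unfolding incseq_def le_fun_def by (intro allI impI min.mono order_refl of_nat_mono)
  have lim: "(\<integral>\<^sup>+x. u x \<partial>lborel) = (SUP n. \<integral>\<^sup>+x. min (u x) (of_nat n) \<partial>lborel)"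
    if [measurable]: "u \<in> borel_measurable borel" for u :: "real \<Rightarrow> ennreal"
  proof -
    have "(SUP n. min (u x) (of_nat n)) = u x" for x
    proof -
      have "(SUP n. min (u x) (of_nat n)) = min (u x) (SUP n. of_nat n)"
        by (simp add: inf_min[symmetric] inf_SUP)
      then show ?thesis by (simp add: ennreal_SUP_of_nat_eq_top)
    qed
    then show ?thesis by (subst nn_integral_monotone_convergence_SUP[symmetric, OF inc]) auto
  qed
  have "(\<integral>\<^sup>+x. min (f x) (of_nat m) \<partial>lborel) * (\<integral>\<^sup>+x. min (g x) (of_nat n) \<partial>lborel)
      \<le> (\<integral>\<^sup>+x. h x \<partial>lborel)\<^sup>2" for m n :: nat
    by (rule order_trans[OF mult_mono bnd[of "max m n"]])
      (intro nn_integral_mono min.mono order_refl of_nat_mono max.cobounded1 max.cobounded2 zero_le)+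
  then show ?thesis unfolding lim[OF assms(1)] lim[OF assms(2)]
    unfolding SUP_mult_left_ennreal SUP_mult_right_ennreal by (intro SUP_least)
qed

section \<open>From the line to Euclidean space\<close>

text \<open>Induction on the coordinates: for fixed values s and t of the new coordinate the
  induction hypothesis applies to the slices, and its conclusion says that the marginals satisfy the
  one-dimensional hypothesis. Points are required to be extensional because only those belong to the
  product space.\<close>

lemma prekopa_leindler_PiM:
  fixes f g h :: "('i \<Rightarrow> real) \<Rightarrow> ennreal"
  assumes "finite I"
    and "f \<in> borel_measurable (Pi\<^sub>M I (\<lambda>_. lborel))" "g \<in> borel_measurable (Pi\<^sub>M I (\<lambda>_. lborel))"
      "h \<in> borel_measurable (Pi\<^sub>M I (\<lambda>_. lborel))"
    and "\<And>x y. x \<in> extensional I \<Longrightarrow> y \<in> extensional I \<Longrightarrow> f x * g y \<le> (h (\<lambda>i\<in>I. (x i + y i) / 2))\<^sup>2"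
  shows "(\<integral>\<^sup>+x. f x \<partial>Pi\<^sub>M I (\<lambda>_. lborel)) * (\<integral>\<^sup>+x. g x \<partial>Pi\<^sub>M I (\<lambda>_. lborel))
    \<le> (\<integral>\<^sup>+x. h x \<partial>Pi\<^sub>M I (\<lambda>_. lborel))\<^sup>2"
  using assms
proof (induction I arbitrary: f g h rule: finite_induct)
  case empty
  then show ?case
    using empty(4)[of "\<lambda>_. undefined" "\<lambda>_. undefined"]
    by (simp add: PiM_empty nn_integral_count_space_finite restrict_def)
next
  case (insert i I)
  interpret product_sigma_finite "\<lambda>_::'i. lborel :: real measure" by standard
  interpret finite_product_sigma_finite "\<lambda>_::'i. lborel :: real measure" I by standard (rule insert.hyps)
  note [measurable] = insert.prems(1-3) and [simp] = insert.hyps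
  have split: "(\<integral>\<^sup>+x. u x \<partial>Pi\<^sub>M (insert i I) (\<lambda>_. lborel))
      = (\<integral>\<^sup>+t. (\<integral>\<^sup>+x. u (x(i := t)) \<partial>Pi\<^sub>M I (\<lambda>_. lborel)) \<partial>lborel)"
    if "u \<in> borel_measurable (Pi\<^sub>M (insert i I) (\<lambda>_. lborel))" for u :: "('i \<Rightarrow> real) \<Rightarrow> ennreal"
    using that by (intro product_nn_integral_insert_rev) auto
  show ?case unfolding split[OF insert.prems(1)] split[OF insert.prems(2)] split[OF insert.prems(3)]
  proof (rule prekopa_leindler_real)
    fix s t :: real
    show "(\<integral>\<^sup>+x. f (x(i := s)) \<partial>Pi\<^sub>M I (\<lambda>_. lborel)) * (\<integral>\<^sup>+x. g (x(i := t)) \<partial>Pi\<^sub>M I (\<lambda>_. lborel))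
      \<le> (\<integral>\<^sup>+x. h (x(i := (s + t) / 2)) \<partial>Pi\<^sub>M I (\<lambda>_. lborel))\<^sup>2"
    proof (rule insert.IH)
      fix x y :: "'i \<Rightarrow> real" assume xy: "x \<in> extensional I" "y \<in> extensional I"
      have "(\<lambda>j\<in>insert i I. ((x(i := s)) j + (y(i := t)) j) / 2)
          = (\<lambda>j\<in>I. (x j + y j) / 2)(i := (s + t) / 2)"
        by (auto simp: fun_eq_iff restrict_def)
      then show "f (x(i := s)) * g (y(i := t)) \<le> (h ((\<lambda>j\<in>I. (x j + y j) / 2)(i := (s + t) / 2)))\<^sup>2"
        using insert.prems(4)[of "x(i := s)" "y(i := t)"] xy by (simp only: extensional_insert extensional_insert_cancel)
    qed measurable
  qed (intro borel_measurable_nn_integral; measurable)+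
qed

text \<open>The midpoint form suffices for the expansion, whose two perturbations e and -e are
  symmetric about 0.\<close>

theorem prekopa_leindler:
  fixes f g h :: "'a::euclidean_space \<Rightarrow> ennreal"
  assumes [measurable]: "f \<in> borel_measurable borel" "g \<in> borel_measurable borel" "h \<in> borel_measurable borel"
    and le: "\<And>x y. f x * g y \<le> (h ((1/2) *\<^sub>R (x + y)))\<^sup>2"
  shows "(\<integral>\<^sup>+x. f x \<partial>lborel) * (\<integral>\<^sup>+x. g x \<partial>lborel) \<le> (\<integral>\<^sup>+x. h x \<partial>lborel)\<^sup>2"
proof -
  let ?s = "\<lambda>x::'a \<Rightarrow> real. \<Sum>b\<in>Basis. x b *\<^sub>R b"
  have eq: "(\<integral>\<^sup>+x. u x \<partial>lborel) = (\<integral>\<^sup>+x. u (?s x) \<partial>Pi\<^sub>M Basis (\<lambda>_. lborel))"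
    if [measurable]: "u \<in> borel_measurable borel" for u :: "'a \<Rightarrow> ennreal"
    by (subst lborel_eq) (simp add: nn_integral_distr)
  show ?thesis unfolding eq[OF assms(1)] eq[OF assms(2)] eq[OF assms(3)]
  proof (rule prekopa_leindler_PiM)
    fix x y :: "'a \<Rightarrow> real"
    have "?s (\<lambda>b\<in>Basis. (x b + y b) / 2) = (1/2) *\<^sub>R (?s x + ?s y)"
      by (simp add: scaleR_sum_right sum.distrib[symmetric] add_divide_distrib scaleR_add_left scaleR_add_right)
    then show "f (?s x) * g (?s y) \<le> (h (?s (\<lambda>b\<in>Basis. (x b + y b) / 2)))\<^sup>2"
      using le[of "?s x" "?s y"] by simp
  qed auto
qed

section \<open>Gradients and Hessians\<close>

lemma gderiv_grad:
  fixes f :: "real ^ 'n \<Rightarrow> real"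
  assumes "f differentiable (at x)"
  shows "GDERIV f x :> grad f x"
proof -
  obtain f' where f': "(f has_derivative f') (at x)" using assms by (auto simp: differentiable_def)
  interpret bounded_linear f' using f' by (rule has_derivative_bounded_linear)
  define D where "D = (\<Sum>b\<in>Basis. f' b *\<^sub>R b)"
  have "f' h = h \<bullet> D" for h
  proof -
    have "f' h = f' (\<Sum>b\<in>Basis. (h \<bullet> b) *\<^sub>R b)" by (simp add: euclidean_representation)
    also have "\<dots> = h \<bullet> D"
      by (simp add: D_def sum scaleR inner_sum_right mult.commute)
    finally show ?thesis .
  qed
  then have "f' = (\<lambda>h. h \<bullet> D)" by (rule ext)
  with f' have "GDERIV f x :> D" by (simp add: gderiv_def)
  with grad_eqI[OF this] show ?thesis by simp
qed

lemma C1_on_imp_continuous_on: "C1_on S f \<Longrightarrow> continuous_on S f"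
  by (auto simp: C1_on_def intro!: continuous_at_imp_continuous_on differentiable_imp_continuous_within)

lemma DERIV_grad_line:
  fixes f :: "real ^ 'n \<Rightarrow> real"
  assumes "f differentiable (at (z + s *\<^sub>R v))"
  shows "((\<lambda>s. f (z + s *\<^sub>R v)) has_real_derivative v \<bullet> grad f (z + s *\<^sub>R v)) (at s)"
proof -
  have 1: "((\<lambda>s. z + s *\<^sub>R v) has_derivative (\<lambda>t. t *\<^sub>R v)) (at s)"
    by (auto intro!: derivative_eq_intros)
  have "(f has_derivative (\<lambda>h. h \<bullet> grad f (z + s *\<^sub>R v))) (at (z + s *\<^sub>R v))"
    using gderiv_grad[OF assms] by (simp add: gderiv_def)
  from diff_chain_at[OF 1 this] show ?thesis
    by (simp add: has_field_derivative_def o_def mult_commute_abs)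
qed

lemma DERIV_Hess_line:
  fixes f :: "real ^ 'n \<Rightarrow> real"
  assumes "grad f differentiable (at (z + s *\<^sub>R v))"
  shows "((\<lambda>s. w \<bullet> grad f (z + s *\<^sub>R v)) has_real_derivative w \<bullet> (Hess f (z + s *\<^sub>R v) *v v)) (at s)"
proof -
  have 1: "((\<lambda>s. z + s *\<^sub>R v) has_derivative (\<lambda>t. t *\<^sub>R v)) (at s)"
    by (auto intro!: derivative_eq_intros)
  have "(grad f has_derivative (\<lambda>h. Hess f (z + s *\<^sub>R v) *v h)) (at (z + s *\<^sub>R v))"
    using assms unfolding Hess_def jacobian_works .
  from diff_chain_at[OF 1 this]
  have "((\<lambda>s. grad f (z + s *\<^sub>R v)) has_derivative (\<lambda>t. Hess f (z + s *\<^sub>R v) *v (t *\<^sub>R v))) (at s)"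
    by (simp add: o_def)
  from has_derivative_inner_right[OF this, of w] show ?thesis
    by (simp add: has_field_derivative_def matrix_vector_mult_scaleR mult_commute_abs)
qed

lemma Taylor_Hess:
  fixes f :: "real ^ 'n \<Rightarrow> real"
  assumes f: "C2_on S f" and seg: "closed_segment z (z + v) \<subseteq> S"
  shows "\<exists>s. 0 < s \<and> s < 1 \<and> f (z + v) = f z + v \<bullet> grad f z + (v \<bullet> (Hess f (z + s *\<^sub>R v) *v v)) / 2"
proof -
  have S: "z + t *\<^sub>R v \<in> S" if "0 \<le> t" "t \<le> 1" for t
    using seg that by (auto simp: closed_segment_image_interval algebra_simps image_subset_iff)
  define D where "D m = (if m = 0 then (\<lambda>s. f (z + s *\<^sub>R v)) else if m = 1 then (\<lambda>s. v \<bullet> grad f (z + s *\<^sub>R v))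
    else (\<lambda>s. v \<bullet> (Hess f (z + s *\<^sub>R v) *v v)))" for m :: nat
  have "\<exists>t>0. t < 1 \<and> f (z + 1 *\<^sub>R v) = (\<Sum>m<2. D m 0 / fact m * 1 ^ m) + D 2 t / fact 2 * 1 ^ 2"
  proof (rule Maclaurin)
    show "\<forall>m t. m < 2 \<and> 0 \<le> t \<and> t \<le> 1 \<longrightarrow> (D m has_real_derivative D (Suc m) t) (at t)"
    proof (intro allI impI, elim conjE)
      fix m t assume m: "m < (2::nat)" and t: "0 \<le> t" "t \<le> (1::real)"
      have "f differentiable at (z + t *\<^sub>R v)" "grad f differentiable at (z + t *\<^sub>R v)"
        using f S[OF t] by (auto simp: C2_on_def C1_on_def)
      with m show "(D m has_real_derivative D (Suc m) t) (at t)"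
        by (auto simp: D_def less_2_cases_iff intro: DERIV_grad_line DERIV_Hess_line)
    qed
  qed (auto simp: D_def)
  then show ?thesis by (auto simp: D_def numeral_2_eq_2)
qed

text \<open>The mean value theorem is applied along \<open>v\<close>, then along \<open>w\<close>.
  The second difference on the left is symmetric in \<open>v\<close> and \<open>w\<close>, and this
  yields the symmetry of the Hessian.\<close>

lemma Hess_mvt_square:
  fixes f :: "real ^ 'n \<Rightarrow> real"
  assumes f: "C2_on S f" and t: "0 < t"
    and S: "\<And>a b. 0 \<le> a \<Longrightarrow> a \<le> t \<Longrightarrow> 0 \<le> b \<Longrightarrow> b \<le> t \<Longrightarrow> z + a *\<^sub>R v + b *\<^sub>R w \<in> S"
  shows "\<exists>a b. 0 \<le> a \<and> a \<le> t \<and> 0 \<le> b \<and> b \<le> t \<and>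
    f (z + t *\<^sub>R v + t *\<^sub>R w) + f z - (f (z + t *\<^sub>R v) + f (z + t *\<^sub>R w))
      = t * t * (v \<bullet> (Hess f (z + a *\<^sub>R v + b *\<^sub>R w) *v w))"
proof -
  have d: "f differentiable at (z + a *\<^sub>R v + b *\<^sub>R w)" "grad f differentiable at (z + a *\<^sub>R v + b *\<^sub>R w)"
    if "0 \<le> a" "a \<le> t" "0 \<le> b" "b \<le> t" for a b
    using f S[OF that] by (auto simp: C2_on_def C1_on_def)
  let ?P = "\<lambda>a. f (z + t *\<^sub>R w + a *\<^sub>R v) - f (z + a *\<^sub>R v)"
  have "\<exists>a. 0 < a \<and> a < t \<and> ?P t - ?P 0 = (t - 0) * (v \<bullet> grad f (z + t *\<^sub>R w + a *\<^sub>R v) - v \<bullet> grad f (z + a *\<^sub>R v))"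
  proof (rule MVT2[OF t])
    fix a assume a: "0 \<le> a" "a \<le> t"
    have 1: "f differentiable at (z + t *\<^sub>R w + a *\<^sub>R v)" using d(1)[of a t] a t by (simp add: ac_simps)
    have 2: "f differentiable at (z + a *\<^sub>R v)" using d(1)[of a 0] a t by simp
    show "(?P has_real_derivative (v \<bullet> grad f (z + t *\<^sub>R w + a *\<^sub>R v) - v \<bullet> grad f (z + a *\<^sub>R v))) (at a)"
      by (intro DERIV_diff DERIV_grad_line 1 2)
  qed
  then obtain a where a: "0 < a" "a < t"
    "?P t - ?P 0 = t * (v \<bullet> grad f (z + t *\<^sub>R w + a *\<^sub>R v) - v \<bullet> grad f (z + a *\<^sub>R v))" by auto
  let ?Q = "\<lambda>b. v \<bullet> grad f (z + a *\<^sub>R v + b *\<^sub>R w)"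
  have "\<exists>b. 0 < b \<and> b < t \<and> ?Q t - ?Q 0 = (t - 0) * (v \<bullet> (Hess f (z + a *\<^sub>R v + b *\<^sub>R w) *v w))"
    by (rule MVT2[OF t]) (use a d(2) in \<open>auto intro!: DERIV_Hess_line\<close>)
  then obtain b where b: "0 < b" "b < t" "?Q t - ?Q 0 = t * (v \<bullet> (Hess f (z + a *\<^sub>R v + b *\<^sub>R w) *v w))"
    by auto
  have "?P t - ?P 0 = t * (t * (v \<bullet> (Hess f (z + a *\<^sub>R v + b *\<^sub>R w) *v w)))"
    unfolding a(3) b(3)[symmetric] by (simp add: ac_simps)
  then show ?thesis using a b by (intro exI[of _ a] exI[of _ b]) (auto simp: ac_simps)
qed

lemma bounded_bilinear_matrix_vector_mult:
  "bounded_bilinear ((*v) :: real ^ 'n ^ 'm \<Rightarrow> real ^ 'n \<Rightarrow> real ^ 'm)"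
  unfolding bilinear_conv_bounded_bilinear[symmetric] bilinear_def linear_iff
  by (auto simp: matrix_vector_mult_add_rdistrib matrix_vector_right_distrib
      scaleR_matrix_vector_assoc matrix_vector_mult_scaleR)

lemma transpose_eq_if_inner_eq:
  fixes A :: "real ^ 'n ^ 'n"
  assumes "\<And>v w. v \<bullet> (A *v w) = w \<bullet> (A *v v)"
  shows "transpose A = A"
proof -
  have "A $ i $ j = A $ j $ i" for i j
    using assms[of "axis i 1" "axis j 1"] by (simp add: matrix_vector_mult_basis inner_axis' column_def)
  then show ?thesis by (simp add: transpose_def vec_eq_iff)
qed

text \<open>The second difference divided by t^2 tends to the Hessian form in (v, w) and, by its
  symmetry, also to the one in (w, v).\<close>

lemma transpose_Hess:
  fixes f :: "real ^ 'n \<Rightarrow> real"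
  assumes f: "C2_on S f" and S: "open S" "z \<in> S"
  shows "transpose (Hess f z) = Hess f z"
proof (rule transpose_eq_if_inner_eq)
  fix v w :: "real ^ 'n"
  have cont: "isCont (Hess f) z"
    using f S by (auto simp: C2_on_def continuous_on_eq_continuous_at)
  have lim: "((\<lambda>t. (f (z + t *\<^sub>R v + t *\<^sub>R w) + f z - (f (z + t *\<^sub>R v) + f (z + t *\<^sub>R w))) / (t * t))
    \<longlongrightarrow> v \<bullet> (Hess f z *v w)) (at_right 0)" for v w
  proof (rule tendstoI)
    fix e :: real assume "0 < e"
    have "isCont (\<lambda>y. v \<bullet> (Hess f y *v w)) z"
      by (intro continuous_intros bounded_bilinear.continuous[OF bounded_bilinear_matrix_vector_mult] cont)
    then obtain d where d: "0 < d" "\<And>y. dist y z < d \<Longrightarrow> dist (v \<bullet> (Hess f y *v w)) (v \<bullet> (Hess f z *v w)) < e"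
      using \<open>0 < e\<close> unfolding continuous_at_eps_delta by blast
    obtain d' where d': "0 < d'" "ball z d' \<subseteq> S" using S open_contains_ball by blast
    \<comment> \<open>Small enough for the parallelogram with sides m v and m w at \<open>z\<close>
      to stay within both radii; the summand 1 keeps the denominator positive when v = w =
      0.\<close>
    define m where "m = min d d' / (norm v + norm w + 1)"
    have m: "0 < m" using d d' by (simp add: m_def add_nonneg_pos)
    have near: "dist (z + a *\<^sub>R v + b *\<^sub>R w) z < min d d'" if "0 \<le> a" "a < m" "0 \<le> b" "b < m" for a b
    proof -
      have "dist (z + a *\<^sub>R v + b *\<^sub>R w) z \<le> a * norm v + b * norm w"
        using that norm_triangle_ineq[of "a *\<^sub>R v" "b *\<^sub>R w"] by (simp add: dist_norm)
      also have "\<dots> \<le> m * norm v + m * norm w" using that by (intro add_mono mult_right_mono) auto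
      also have "\<dots> < m * (norm v + norm w + 1)" using m by (simp add: algebra_simps)
      also have "\<dots> = min d d'" by (simp add: m_def add_nonneg_pos less_imp_neq[symmetric])
      finally show ?thesis .
    qed
    have "dist ((f (z + t *\<^sub>R v + t *\<^sub>R w) + f z - (f (z + t *\<^sub>R v) + f (z + t *\<^sub>R w))) / (t * t)) (v \<bullet> (Hess f z *v w)) < e"
      if t: "0 < t" "t < m" for t
    proof -
      have "z + a *\<^sub>R v + b *\<^sub>R w \<in> S" if "0 \<le> a" "a \<le> t" "0 \<le> b" "b \<le> t" for a b
        using near[of a b] that t d' by (auto simp: dist_commute)
      from Hess_mvt_square[OF f t(1) this] obtain a b where ab: "0 \<le> a" "a \<le> t" "0 \<le> b" "b \<le> t"
        and eq: "f (z + t *\<^sub>R v + t *\<^sub>R w) + f z - (f (z + t *\<^sub>R v) + f (z + t *\<^sub>R w))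
          = t * t * (v \<bullet> (Hess f (z + a *\<^sub>R v + b *\<^sub>R w) *v w))"
        by blast
      show ?thesis unfolding eq using near[of a b] ab t d(2) by simp
    qed
    then show "\<forall>\<^sub>F t in at_right 0. dist ((f (z + t *\<^sub>R v + t *\<^sub>R w) + f z - (f (z + t *\<^sub>R v) + f (z + t *\<^sub>R w))) / (t * t))
        (v \<bullet> (Hess f z *v w)) < e"
      using m unfolding eventually_at_right_field by blast
  qed
  have "((\<lambda>t. (f (z + t *\<^sub>R v + t *\<^sub>R w) + f z - (f (z + t *\<^sub>R v) + f (z + t *\<^sub>R w))) / (t * t))
    \<longlongrightarrow> w \<bullet> (Hess f z *v v)) (at_right 0)"
    using lim[of w v] by (simp add: ac_simps)
  from tendsto_unique[OF _ lim this] show "v \<bullet> (Hess f z *v w) = w \<bullet> (Hess f z *v v)" by simp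
qed

text \<open>If \<open>K\<close> had a point x very far from z, shrinking the ball about z towards x
  would produce arbitrarily many disjoint balls of radius r/2 inside \<open>K\<close>, all of the
  same positive volume.\<close>

lemma bounded_convex_if_finite_measure:
  fixes K :: "'a::euclidean_space set"
  assumes K: "convex K" "K \<in> sets borel" "emeasure lborel K < \<infinity>" and r: "0 < r" "ball z r \<subseteq> K"
  shows "bounded K"
proof (rule ccontr)
  assume unb: "\<not> bounded K"
  define V where "V = measure lborel (ball (0::'a) (r/2))"
  have V: "0 < V" using r unfolding V_def by (simp add: content_ball_pos)
  have emV: "emeasure lborel (ball c (r/2)) = ennreal V" for c :: 'a
  proof -
    have "measure lborel (ball c (r/2)) = V" unfolding V_def using r by (simp add: content_ball)
    moreover have "emeasure lborel (ball c (r/2)) \<noteq> top"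
      using emeasure_lborel_ball_finite[of c "r/2"] by auto
    ultimately show ?thesis by (simp add: emeasure_eq_ennreal_measure)
  qed
  obtain k where k: "0 \<le> k" "emeasure lborel K = ennreal k" using K(3) by (cases "emeasure lborel K") auto
  \<comment> \<open>\<open>N\<close> disjoint balls of volume \<open>V\<close> have total volume
    above \<open>k\<close>. The point \<open>x\<close> is taken so far away that \<open>N\<close>
    centres in the first half of the segment from \<open>z\<close> to \<open>x\<close> are more than
    \<open>r\<close> apart.\<close>
  obtain N :: nat where N: "k / V < real N" using reals_Archimedean2 by blast
  then have N0: "0 < N" using k V by (cases N) (auto simp: divide_less_0_iff not_less[symmetric])
  obtain x where x: "x \<in> K" "2 * real N * r + norm z < norm x"
  proof -
    have "\<not> (\<forall>x\<in>K. norm x \<le> 2 * real N * r + norm z)" using unb unfolding bounded_iff by blast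
    then show ?thesis using that by (auto simp: not_le)
  qed
  have nx: "2 * real N * r < norm (x - z)" using x(2) norm_triangle_ineq2[of x z] by linarith
  define p where "p j = z + (real j / (2 * real N)) *\<^sub>R (x - z)" for j
  have sub: "ball (p j) (r/2) \<subseteq> K" if j: "j < N" for j
  proof
    fix y assume y: "y \<in> ball (p j) (r/2)"
    define t where "t = real j / (2 * real N)"
    have t: "0 \<le> t" "t \<le> 1/2" using j N0 by (auto simp: t_def field_simps)
    \<comment> \<open>Preimage of \<open>y\<close> under the homothety with centre \<open>x\<close>
      and ratio 1 - t, which moves \<open>z\<close> to \<open>p j\<close>. The ratio is at least
      1/2, so a distance below r/2 comes from one below r.\<close>
    define q where "q = z + (1 / (1 - t)) *\<^sub>R (y - p j)"
    have "norm (y - p j) < r / 2" using y by (simp add: dist_norm norm_minus_commute)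
    also have "\<dots> \<le> (1 - t) * r" using mult_right_mono[of "1/2" "1 - t" r] t r by simp
    finally have "norm (y - p j) / (1 - t) < r" using t by (simp add: pos_divide_less_eq mult.commute)
    moreover have "norm (q - z) = norm (y - p j) / (1 - t)" using t by (simp add: q_def)
    ultimately have "norm (q - z) < r" by simp
    then have "q \<in> K" using r by (auto simp: dist_norm norm_minus_commute)
    moreover have "y = (1 - t) *\<^sub>R q + t *\<^sub>R x"
    proof -
      have "(1 - t) *\<^sub>R q = (1 - t) *\<^sub>R z + (y - p j)" using t by (simp add: q_def scaleR_add_right)
      moreover have "p j = z + t *\<^sub>R (x - z)" by (simp add: p_def t_def)
      ultimately show ?thesis by (simp add: algebra_simps)
    qed
    ultimately show "y \<in> K" using K(1) x(1) t by (simp add: convexD)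
  qed
  have disj: "disjoint_family_on (\<lambda>j. ball (p j) (r/2)) {..<N}"
    unfolding disjoint_family_on_def
  proof (intro ballI impI, rule ccontr)
    fix i j assume ij: "i \<in> {..<N}" "j \<in> {..<N}" "i \<noteq> j" and "ball (p i) (r/2) \<inter> ball (p j) (r/2) \<noteq> {}"
    then obtain y where "dist (p i) y < r/2" "dist (p j) y < r/2" by auto
    then have "dist (p i) (p j) < r" using dist_triangle_half_l by blast
    moreover have "dist (p i) (p j) = \<bar>real i - real j\<bar> / (2 * real N) * norm (x - z)"
    proof -
      have "p i - p j = ((real i - real j) / (2 * real N)) *\<^sub>R (x - z)"
        by (simp add: p_def diff_divide_distrib scaleR_left_diff_distrib)
      then show ?thesis by (simp add: dist_norm)
    qed
    moreover have "1 / (2 * real N) * norm (x - z) > r" using nx N0 by (simp add: field_simps)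
    moreover have "1 / (2 * real N) * norm (x - z) \<le> \<bar>real i - real j\<bar> / (2 * real N) * norm (x - z)"
    proof -
      have "1 \<le> \<bar>real i - real j\<bar>" using ij(3) by linarith
      then show ?thesis by (intro mult_right_mono divide_right_mono) auto
    qed
    ultimately show False by linarith
  qed
  have "ennreal (real N * V) = (\<Sum>j<N. emeasure lborel (ball (p j) (r/2)))"
    using V by (simp add: emV ennreal_of_nat_eq_real_of_nat ennreal_mult)
  also have "\<dots> = emeasure lborel (\<Union>j<N. ball (p j) (r/2))"
    using disj by (intro sum_emeasure) auto
  also have "\<dots> \<le> emeasure lborel K" using sub K by (intro emeasure_mono) auto
  finally have "real N * V \<le> k" using k by simp
  then show False using N V by (simp add: field_simps)
qed

section \<open>Second-order expansion of the perturbed Legendre transform\<close>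

text \<open>\<open>closed_sublevel\<close> asks for closedness in the whole space: it says that
  \<open>u\<close> tends to infinity at the boundary of \<open>S\<close>. Strictness at midpoints is
  what makes the gradient injective.\<close>

locale gibbs =
  fixes S :: "(real ^ 'n) set" and u :: "real ^ 'n \<Rightarrow> real"
  assumes open_dom: "open S" and convex_u: "convex_on S u" and C2_u: "C2_on S u"
    and closed_sublevel: "\<And>c. closed {z\<in>S. u z \<le> c}"
    and total: "(\<integral>\<^sup>+z. ennreal (indicator S z * exp (- u z)) \<partial>lborel) = 1"
    and strict: "\<And>x y. x \<in> S \<Longrightarrow> y \<in> S \<Longrightarrow> x \<noteq> y \<Longrightarrow> u ((1/2) *\<^sub>R (x + y)) < (u x + u y) / 2"
begin

lemma convex_dom: "convex S"
  using convex_u by (rule convex_on_imp_convex)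

lemma differentiable_u: "z \<in> S \<Longrightarrow> u differentiable (at z)"
  and differentiable_grad: "z \<in> S \<Longrightarrow> grad u differentiable (at z)"
  and continuous_on_grad: "continuous_on S (grad u)"
  and continuous_on_Hess: "continuous_on S (Hess u)"
  using C2_u by (auto simp: C2_on_def C1_on_def)

lemma continuous_on_u: "continuous_on S u"
  using C2_u by (intro C1_on_imp_continuous_on) (simp add: C2_on_def)

lemma gradient_inequality:
  assumes "y \<in> S" "w \<in> S"
  shows "u y + grad u y \<bullet> (w - y) \<le> u w"
proof (rule ccontr)
  assume neg: "\<not> ?thesis"
  \<comment> \<open>Convexity keeps \<open>?h\<close> at or below \<open>u y\<close> on [0, 1],
    whereas failure of the claim makes its slope at 0 positive.\<close>
  let ?h = "\<lambda>s. u (y + s *\<^sub>R (w - y)) - s * (u w - u y)"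
  have "(?h has_real_derivative (w - y) \<bullet> grad u (y + 0 *\<^sub>R (w - y)) - 1 * (u w - u y)) (at 0)"
    using assms differentiable_u
    by (intro DERIV_diff DERIV_grad_line DERIV_cmult_right DERIV_ident) auto
  then have "\<exists>d>0. \<forall>s>0. s < d \<longrightarrow> ?h 0 < ?h (0 + s)"
    by (rule DERIV_pos_inc_right) (use neg in \<open>simp add: inner_commute\<close>)
  then obtain d where d: "0 < d" "\<And>s. 0 < s \<Longrightarrow> s < d \<Longrightarrow> u y < ?h s" by auto
  define s where "s = min (d/2) 1"
  have s: "0 < s" "s < d" "s \<le> 1" using d by (auto simp: s_def)
  have "u y < ?h s" using d s by blast
  moreover have "u ((1 - s) *\<^sub>R y + s *\<^sub>R w) \<le> (1 - s) * u y + s * u w"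
    using convex_onD[OF convex_u] s assms by auto
  moreover have "(1 - s) *\<^sub>R y + s *\<^sub>R w = y + s *\<^sub>R (w - y)" by (simp add: algebra_simps)
  ultimately show False by (simp add: algebra_simps)
qed

lemma grad_monotone:
  assumes "y \<in> S" "w \<in> S"
  shows "0 \<le> (w - y) \<bullet> (grad u w - grad u y)"
  using gradient_inequality[OF assms] gradient_inequality[OF assms(2,1)]
  by (simp add: inner_commute inner_diff_left inner_diff_right)

text \<open>If the gradients at x and y agree, the two tangent inequalities tested at the midpoint
  add up to u x + u y <= 2 u m.\<close>

lemma inj_on_grad: "inj_on (grad u) S"
proof (rule inj_onI, rule ccontr)
  fix x y assume xy: "x \<in> S" "y \<in> S" "grad u x = grad u y" "x \<noteq> y"
  define m where "m = (1/2) *\<^sub>R (x + y)"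
  have "m \<in> S" using convexD[OF convex_dom xy(1,2), of "1/2" "1/2"] by (simp add: m_def scaleR_add_right)
  have "m - x = (1/2) *\<^sub>R (y - x)" "m - y = - (1/2) *\<^sub>R (y - x)"
    by (auto simp: m_def vec_eq_iff field_simps)
  then have "u x + grad u x \<bullet> (1/2) *\<^sub>R (y - x) \<le> u m" "u y - grad u x \<bullet> (1/2) *\<^sub>R (y - x) \<le> u m"
    using gradient_inequality[OF xy(1) \<open>m \<in> S\<close>] gradient_inequality[OF xy(2) \<open>m \<in> S\<close>] xy(3) by auto
  then have "u x + u y \<le> 2 * u m" by linarith
  with strict[OF xy(1,2,4)] show False by (simp add: m_def)
qed

lemma Hess_nonneg:
  assumes "z \<in> S"
  shows "0 \<le> v \<bullet> (Hess u z *v v)"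
proof (rule ccontr)
  assume neg: "\<not> ?thesis"
  obtain d' where d': "0 < d'" "ball z d' \<subseteq> S" using open_dom assms open_contains_ball by blast
  let ?h = "\<lambda>s. v \<bullet> grad u (z + s *\<^sub>R v)"
  have "(?h has_real_derivative v \<bullet> (Hess u (z + 0 *\<^sub>R v) *v v)) (at 0)"
    using assms differentiable_grad by (intro DERIV_Hess_line) auto
  then have "\<exists>d>0. \<forall>s>0. s < d \<longrightarrow> ?h (0 + s) < ?h 0"
    by (rule DERIV_neg_dec_right) (use neg in simp)
  then obtain d where d: "0 < d" "\<And>s. 0 < s \<Longrightarrow> s < d \<Longrightarrow> ?h s < v \<bullet> grad u z" by auto
  define s where "s = min (d/2) (d' / (norm v + 1))"
  have s: "0 < s" "s < d" using d d' by (auto simp: s_def add_nonneg_pos)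
  have "s * norm v < s * (norm v + 1)" using s by simp
  also have "s * (norm v + 1) \<le> d' / (norm v + 1) * (norm v + 1)"
    by (intro mult_right_mono) (auto simp: s_def)
  also have "\<dots> = d'" by (simp add: add_nonneg_pos less_imp_neq[symmetric])
  finally have "z + s *\<^sub>R v \<in> S" using d' s by (auto simp: dist_norm)
  then have "0 \<le> (s *\<^sub>R v) \<bullet> (grad u (z + s *\<^sub>R v) - grad u z)"
    using grad_monotone[OF assms, of "z + s *\<^sub>R v"] by simp
  then have "v \<bullet> grad u z \<le> ?h s" using s by (simp add: inner_diff_right zero_le_mult_iff)
  with d(2)[OF s] show False by simp
qed

lemma Hess_psd: "z \<in> S \<Longrightarrow> Hess u z \<in> psd_cone"
  unfolding psd_cone_def using Hess_nonneg transpose_Hess[OF C2_u open_dom] by auto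

text \<open>For g = f o grad u one has, formally, grad g = Hess u (grad f o grad u). Thus
  \<open>form\<close> is the Brascamp-Lieb integrand, grad g paired with the inverse Hessian applied
  to grad g, with the inverse cancelled; it makes sense where the Hessian is singular. It is also
  the energy integrand of the moment field, pulled back by the gradient.\<close>

definition form :: "(real ^ 'n \<Rightarrow> real) \<Rightarrow> real ^ 'n \<Rightarrow> real"
  where "form f z = grad f (grad u z) \<bullet> (Hess u z *v grad f (grad u z))"

lemma form_nonneg: "z \<in> S \<Longrightarrow> 0 \<le> form f z"
  unfolding form_def by (rule Hess_nonneg)

lemma continuous_on_form:
  assumes "C1_on UNIV f"
  shows "continuous_on S (form f)"
proof -
  have "continuous_on S (\<lambda>z. grad f (grad u z))"
    by (rule continuous_on_compose2[of UNIV "grad f", OF _ continuous_on_grad])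
      (use assms in \<open>auto simp: C1_on_def\<close>)
  then show ?thesis unfolding form_def
    by (intro continuous_on_inner bounded_bilinear.continuous_on[OF bounded_bilinear_matrix_vector_mult]
        continuous_on_Hess)
qed

text \<open>\<open>K'\<close> contains every short segment starting in \<open>K\<close>; uniform
  continuity of the Hessian is available on \<open>K'\<close> because it is compact.\<close>

lemma thickening:
  assumes K: "compact K" "K \<subseteq> S"
  obtains d K' where "0 < d" "compact K'" "K' \<subseteq> S" "\<And>z v. z \<in> K \<Longrightarrow> norm v \<le> d \<Longrightarrow> z + v \<in> K'"
proof -
  obtain d where d: "0 < d" "(\<Union>x\<in>K. ball x d) \<subseteq> S"
    using compact_subset_open_imp_ball_epsilon_subset[OF K(1) open_dom K(2)] by blast
  let ?K' = "{x + y | x y. x \<in> K \<and> y \<in> cball 0 (d/2)}"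
  have cK': "compact ?K'" using compact_sums[OF K(1) compact_cball] .
  show thesis
  proof (rule that[of "d/2" ?K', OF _ cK'])
    show "?K' \<subseteq> S"
    proof
      fix x assume "x \<in> ?K'"
      then obtain a b where ab: "x = a + b" "a \<in> K" "norm b \<le> d/2" by auto
      then have "x \<in> ball a d" using d by (simp add: dist_norm)
      then show "x \<in> S" using d ab by blast
    qed
  qed (use d in auto)
qed

text \<open>The Taylor remainder is governed by the oscillation of \<open>Hess u\<close> between z
  and an intermediate point, which is uniformly small on the compact thickening of
  \<open>K\<close>.\<close>

lemma quadratic_expansion:
  assumes K: "compact K" "K \<subseteq> S" and e: "0 < e"
  shows "\<exists>d>0. \<forall>z\<in>K. \<forall>v. norm v \<le> d \<longrightarrow> z + v \<in> S \<and>
    u (z + v) \<le> u z + v \<bullet> grad u z + (v \<bullet> (Hess u z *v v)) / 2 + e * (norm v)\<^sup>2"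
proof -
  obtain d0 K' where d0: "0 < d0" "compact K'" "K' \<subseteq> S" "\<And>z v. z \<in> K \<Longrightarrow> norm v \<le> d0 \<Longrightarrow> z + v \<in> K'"
    using thickening[OF K] by metis
  obtain B where B: "0 < B" "\<And>(A :: real ^ 'n ^ 'n) v. norm (A *v v) \<le> norm A * norm v * B"
    using bounded_bilinear.pos_bounded[OF bounded_bilinear_matrix_vector_mult] by blast
  have uc: "uniformly_continuous_on K' (Hess u)"
    using d0 continuous_on_Hess by (intro compact_uniformly_continuous) (auto intro: continuous_on_subset)
  have "0 < e / B" using e B by simp
  from uc[unfolded uniformly_continuous_on_def, rule_format, OF this]
  obtain d1 where d1: "0 < d1"
    "\<And>x y. x \<in> K' \<Longrightarrow> y \<in> K' \<Longrightarrow> dist y x < d1 \<Longrightarrow> dist (Hess u y) (Hess u x) < e / B"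
    by blast
  define d where "d = min d0 (d1/2)"
  have d: "0 < d" "d \<le> d0" "d < d1" using d0 d1 by (auto simp: d_def)
  have "z + v \<in> S \<and> u (z + v) \<le> u z + v \<bullet> grad u z + (v \<bullet> (Hess u z *v v)) / 2 + e * (norm v)\<^sup>2"
    if z: "z \<in> K" and v: "norm v \<le> d" for z v
  proof
    have inK': "z + s *\<^sub>R v \<in> K'" if "0 \<le> s" "s \<le> 1" for s
      using d0(4)[OF z, of "s *\<^sub>R v"] that v d mult_left_le_one_le[of "norm v" s] by simp
    show "z + v \<in> S" using inK'[of 1] d0 by auto
    have "closed_segment z (z + v) \<subseteq> S"
      using inK' d0(3) by (auto simp: closed_segment_image_interval algebra_simps)
    from Taylor_Hess[OF C2_u this] obtain s where s: "0 < s" "s < 1"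
      and eq: "u (z + v) = u z + v \<bullet> grad u z + (v \<bullet> (Hess u (z + s *\<^sub>R v) *v v)) / 2" by blast
    have "dist (z + s *\<^sub>R v) z \<le> norm v" using s by (simp add: dist_norm mult_left_le_one_le)
    then have "norm (Hess u (z + s *\<^sub>R v) - Hess u z) < e / B"
      using d1(2)[of z "z + s *\<^sub>R v"] inK'[of 0] inK'[of s] s v d by (simp add: dist_norm)
    then have small: "norm (Hess u (z + s *\<^sub>R v) - Hess u z) * B \<le> e"
      using B by (simp add: field_simps less_imp_le)
    have "v \<bullet> (Hess u (z + s *\<^sub>R v) *v v) - v \<bullet> (Hess u z *v v)
        = v \<bullet> ((Hess u (z + s *\<^sub>R v) - Hess u z) *v v)"
      by (simp add: matrix_vector_mult_diff_rdistrib inner_diff_right)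
    also have "\<dots> \<le> norm v * (norm (Hess u (z + s *\<^sub>R v) - Hess u z) * norm v * B)"
      by (rule order_trans[OF norm_cauchy_schwarz mult_left_mono[OF B(2)]]) simp
    also have "\<dots> = (norm (Hess u (z + s *\<^sub>R v) - Hess u z) * B) * (norm v)\<^sup>2"
      by (simp add: power2_eq_square)
    also have "\<dots> \<le> e * (norm v)\<^sup>2" using small by (intro mult_right_mono) auto
    finally show "u (z + v) \<le> u z + v \<bullet> grad u z + (v \<bullet> (Hess u z *v v)) / 2 + e * (norm v)\<^sup>2"
      unfolding eq using mult_nonneg_nonneg[OF less_imp_le[OF e] zero_le_power2[of "norm v"]] by linarith
  qed
  then show ?thesis using d by blast
qed

text \<open>A cruder bound with the Hessian absorbed into a constant. It controls displacements in
  arbitrary directions when the two gradients in \<open>perturbed_conjugate_le\<close> are far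
  apart.\<close>

lemma quadratic_bound:
  assumes K: "compact K" "K \<subseteq> S"
  obtains L d where "1 \<le> L" "0 < d" "\<And>z (v :: real ^ 'n). z \<in> K \<Longrightarrow> norm v \<le> d \<Longrightarrow> z + v \<in> S \<and>
    u (z + v) \<le> u z + v \<bullet> grad u z + L * (norm v)\<^sup>2"
proof -
  obtain d where d: "0 < d" "\<forall>z\<in>K. \<forall>v. norm v \<le> d \<longrightarrow> z + v \<in> S \<and>
    u (z + v) \<le> u z + v \<bullet> grad u z + (v \<bullet> (Hess u z *v v)) / 2 + 1 * (norm v)\<^sup>2"
    using quadratic_expansion[OF K zero_less_one] by blast
  obtain B where B: "0 < B" "\<And>(A :: real ^ 'n ^ 'n) v. norm (A *v v) \<le> norm A * norm v * B"
    using bounded_bilinear.pos_bounded[OF bounded_bilinear_matrix_vector_mult] by blast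
  have "bounded (Hess u ` K)"
    using K continuous_on_Hess by (intro compact_imp_bounded compact_continuous_image) (auto intro: continuous_on_subset)
  then obtain M where M: "0 < M" "\<And>z. z \<in> K \<Longrightarrow> norm (Hess u z) \<le> M"
    unfolding bounded_pos by auto
  show thesis
  proof (rule that[of "M * B + 1" d])
    fix z v :: "real ^ 'n" assume zv: "z \<in> K" "norm v \<le> d"
    have "v \<bullet> (Hess u z *v v) \<le> norm v * (norm (Hess u z) * norm v * B)"
      by (rule order_trans[OF norm_cauchy_schwarz mult_left_mono[OF B(2)]]) simp
    also have "\<dots> \<le> norm v * (M * norm v * B)"
      using M B zv by (intro mult_left_mono mult_right_mono) auto
    also have "\<dots> = (M * B) * (norm v)\<^sup>2" by (simp add: power2_eq_square)
    finally have "(v \<bullet> (Hess u z *v v)) / 2 \<le> (M * B) * (norm v)\<^sup>2"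
      using M B by (smt (verit) field_sum_of_halves mult_nonneg_nonneg zero_le_power2)
    then show "z + v \<in> S \<and> u (z + v) \<le> u z + v \<bullet> grad u z + (M * B + 1) * (norm v)\<^sup>2"
      using d(2) zv by (fastforce simp: distrib_right)
  qed (use d M B in auto)
qed

text \<open>An upper bound, up to second order in \<open>e\<close>, for the Legendre transform of the perturbation
  \<open>u\<^sup>* + e f\<close> of the Legendre transform of \<open>u\<close>; the points \<open>grad u y\<close> parametrise its domain.\<close>

lemma perturbed_conjugate_le:
  assumes f: "C1_on UNIV f" and K: "compact K" "K \<subseteq> S" and eta: "0 < \<eta>"
  shows "\<exists>e0>0. \<forall>e y p. \<bar>e\<bar> < e0 \<longrightarrow> y \<in> K \<longrightarrow> p \<in> K \<longrightarrow>
    u y + grad u y \<bullet> (p - y) - e * f (grad u y) \<le> u p - e * f (grad u p) + e\<^sup>2 * (form f p / 2 + \<eta>)"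
proof -
  have "bounded (grad u ` K)"
    using K continuous_on_grad by (intro compact_imp_bounded compact_continuous_image) (auto intro: continuous_on_subset)
  then obtain R where R: "\<And>z. z \<in> K \<Longrightarrow> grad u z \<in> cball 0 R"
    unfolding bounded_iff by auto
  have fd: "f differentiable (at x)" for x using f by (auto simp: C1_on_def)
  have gc: "continuous_on (cball 0 R) (grad f)" using f by (auto simp: C1_on_def intro: continuous_on_subset)
  then have "bounded (grad f ` cball 0 R)" by (intro compact_imp_bounded compact_continuous_image) auto
  then obtain L0 where L0: "\<And>x. x \<in> cball 0 R \<Longrightarrow> norm (grad f x) \<le> L0" unfolding bounded_iff by blast
  define L where "L = max L0 1"
  have L: "1 \<le> L" "\<And>x. x \<in> cball 0 R \<Longrightarrow> norm (grad f x) \<le> L" using L0 by (force simp: L_def)+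
  obtain Q d where Q: "1 \<le> Q" "0 < d" "\<And>z v. z \<in> K \<Longrightarrow> norm v \<le> d \<Longrightarrow> z + v \<in> S \<and>
    u (z + v) \<le> u z + v \<bullet> grad u z + Q * (norm v)\<^sup>2"
    using quadratic_bound[OF K] by metis
  \<comment> \<open>Each error gets half of e^2 \<open>\<eta>\<close>: the Taylor error is at most
    e1 (L |e|)^2, and the linearisation error of \<open>f\<close> is at most |e| e2 (4 Q L
    |e|).\<close>
  define e1 where "e1 = \<eta> / (2 * L\<^sup>2)"
  define e2 where "e2 = \<eta> / (8 * Q * L)"
  have e12: "0 < e1" "0 < e2" using eta L Q by (auto simp: e1_def e2_def)
  obtain d1 where d1: "0 < d1" "\<And>z v. z \<in> K \<Longrightarrow> norm v \<le> d1 \<Longrightarrow> z + v \<in> S \<and>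
    u (z + v) \<le> u z + v \<bullet> grad u z + (v \<bullet> (Hess u z *v v)) / 2 + e1 * (norm v)\<^sup>2"
    using quadratic_expansion[OF K e12(1)] by blast
  have uc: "uniformly_continuous_on (cball 0 R) (grad f)" using gc by (intro compact_uniformly_continuous) auto
  from uc[unfolded uniformly_continuous_on_def, rule_format, OF e12(2)]
  obtain d2 where d2: "0 < d2"
    "\<And>x y. x \<in> cball 0 R \<Longrightarrow> y \<in> cball 0 R \<Longrightarrow> dist y x < d2 \<Longrightarrow> dist (grad f y) (grad f x) < e2"
    by blast
  have mvt: "\<exists>\<xi>\<in>closed_segment b a. f a - f b = (a - b) \<bullet> grad f \<xi>" for a b
  proof -
    have "\<exists>s. 0 < s \<and> s < 1 \<and> f (b + 1 *\<^sub>R (a - b)) - f (b + 0 *\<^sub>R (a - b)) = (1 - 0) * ((a - b) \<bullet> grad f (b + s *\<^sub>R (a - b)))"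
      by (rule MVT2) (auto intro!: DERIV_grad_line fd)
    then obtain s where "0 < s" "s < 1" "f a - f b = (a - b) \<bullet> grad f (b + s *\<^sub>R (a - b))" by auto
    then show ?thesis
      by (intro bexI[of _ "b + s *\<^sub>R (a - b)"]) (auto simp: closed_segment_def algebra_simps intro!: exI[of _ s])
  qed
  have seg: "closed_segment b a \<subseteq> cball 0 R" if "a \<in> cball 0 R" "b \<in> cball 0 R" for a b :: "real ^ 'n"
    using that by (intro closed_segment_subset) auto
  have lip: "\<bar>f a - f b\<bar> \<le> L * norm (a - b)" if ab: "a \<in> cball 0 R" "b \<in> cball 0 R" for a b
  proof -
    obtain \<xi> where \<xi>: "\<xi> \<in> closed_segment b a" "f a - f b = (a - b) \<bullet> grad f \<xi>" using mvt by blast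
    have "\<bar>f a - f b\<bar> \<le> norm (a - b) * norm (grad f \<xi>)" unfolding \<xi> by (rule Cauchy_Schwarz_ineq2)
    also have "\<dots> \<le> norm (a - b) * L" using L(2) seg[OF ab] \<xi>(1) by (intro mult_left_mono) auto
    finally show ?thesis by (simp add: mult.commute)
  qed
  have lin: "\<bar>f a - f b - (a - b) \<bullet> grad f b\<bar> \<le> e2 * norm (a - b)"
    if ab: "a \<in> cball 0 R" "b \<in> cball 0 R" "norm (a - b) < d2" for a b
  proof -
    obtain \<xi> where \<xi>: "\<xi> \<in> closed_segment b a" "f a - f b = (a - b) \<bullet> grad f \<xi>" using mvt by blast
    have "norm (\<xi> - b) \<le> norm (a - b)" using segment_bound(1)[OF \<xi>(1)] by (simp add: norm_minus_commute)
    then have "norm (grad f \<xi> - grad f b) < e2"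
      using d2(2)[of b \<xi>] ab seg[OF ab(1,2)] \<xi>(1) by (auto simp: dist_norm)
    have "\<bar>f a - f b - (a - b) \<bullet> grad f b\<bar> = \<bar>(a - b) \<bullet> (grad f \<xi> - grad f b)\<bar>"
      unfolding \<xi> by (simp add: inner_diff_right)
    also have "\<dots> \<le> norm (a - b) * norm (grad f \<xi> - grad f b)" by (rule Cauchy_Schwarz_ineq2)
    also have "\<dots> \<le> norm (a - b) * e2" using \<open>norm (grad f \<xi> - grad f b) < e2\<close> by (intro mult_left_mono) auto
    finally show ?thesis by (simp add: mult.commute)
  qed
  \<comment> \<open>The three entries keep the far displacement (length 2 L |e|) within
    \<open>d\<close>, the near displacement (length at most L |e|) within \<open>d1\<close>, and
    gradients at distance below 4 Q L |e| within the modulus \<open>d2\<close>.\<close>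
  define e0 where "e0 = Min {d / (2 * L), d1 / L, d2 / (4 * Q * L)}"
  have e0: "0 < e0" using Q(2) d1(1) d2(1) L(1) Q(1) by (simp add: e0_def)
  have "u y + grad u y \<bullet> (p - y) - e * f (grad u y) \<le> u p - e * f (grad u p) + e\<^sup>2 * (form f p / 2 + \<eta>)"
    if e: "\<bar>e\<bar> < e0" and y: "y \<in> K" and p: "p \<in> K" for e y p
  proof -
    define x x0 where "x = grad u y" and "x0 = grad u p"
    have x: "x \<in> cball 0 R" "x0 \<in> cball 0 R" using R y p by (auto simp: x_def x0_def)
    have yS: "y \<in> S" "p \<in> S" using K y p by auto
    have small: "2 * L * \<bar>e\<bar> \<le> d" "L * \<bar>e\<bar> \<le> d1" "4 * Q * L * \<bar>e\<bar> < d2"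
      using e L(1) Q(1) by (auto simp: e0_def field_simps)
    \<comment> \<open>The tangent of \<open>u\<close> at y is tested at p + v instead of p; the
      displacement \<open>v\<close> is free and is chosen separately in the two cases.\<close>
    have *: "u y + x \<bullet> (p - y) \<le> u (p + v) - x \<bullet> v" if "p + v \<in> S" for v
      using gradient_inequality[OF yS(1) that] by (simp add: x_def inner_diff_right inner_add_right)
    show ?thesis
    proof (cases "4 * Q * L * \<bar>e\<bar> \<le> norm (x - x0)")
      case True
      show ?thesis
      proof (cases "x = x0")
        case True
        moreover have "0 \<le> e\<^sup>2 * (form f p / 2 + \<eta>)"
          using form_nonneg[OF yS(2), of f] eta by simp
        ultimately show ?thesis using gradient_inequality[OF yS]
          by (simp add: x_def[symmetric] x0_def[symmetric])
      next
        case False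
        \<comment> \<open>Far case: moving towards x - x0 gains 2 L |e| |x - x0|. Half of it pays
          for the variation of e f, the other half for Q |v|^2 = 4 Q L^2 e^2, because 4 Q L |e| <=
          |x - x0|.\<close>
        define v where "v = (2 * L * \<bar>e\<bar> / norm (x - x0)) *\<^sub>R (x - x0)"
        have v: "norm v = 2 * L * \<bar>e\<bar>" using False L by (simp add: v_def abs_mult)
        have "(x - x0) \<bullet> v = 2 * L * \<bar>e\<bar> * norm (x - x0)"
          using False by (simp add: v_def power2_norm_eq_inner[symmetric] power2_eq_square)
        moreover have "u (p + v) \<le> u p + v \<bullet> x0 + Q * (norm v)\<^sup>2" "p + v \<in> S"
          using Q(3)[OF p, of v] small v by (auto simp: x0_def)
        ultimately have "u y + x \<bullet> (p - y) \<le> u p - 2 * L * \<bar>e\<bar> * norm (x - x0) + Q * (norm v)\<^sup>2"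
          using *[of v] by (simp add: inner_diff_left inner_diff_right inner_commute)
        moreover have "- e * f x \<le> - e * f x0 + \<bar>e\<bar> * (L * norm (x - x0))"
        proof -
          have "- e * (f x - f x0) \<le> \<bar>e\<bar> * \<bar>f x - f x0\<bar>"
            by (metis abs_ge_self abs_minus_cancel abs_mult)
          also have "\<dots> \<le> \<bar>e\<bar> * (L * norm (x - x0))" using lip[OF x] by (intro mult_left_mono) auto
          finally show ?thesis by (simp add: algebra_simps)
        qed
        moreover have "Q * (norm v)\<^sup>2 \<le> L * \<bar>e\<bar> * norm (x - x0)"
          using mult_left_mono[OF True, of "L * \<bar>e\<bar>"] L(1) by (simp add: v power2_eq_square algebra_simps)
        moreover have "0 \<le> e\<^sup>2 * (form f p / 2 + \<eta>)"
          using form_nonneg[OF yS(2), of f] eta by simp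
        ultimately show ?thesis by (simp add: x_def[symmetric] x0_def[symmetric] algebra_simps)
      qed
    next
      case False
      \<comment> \<open>Near case: linearising f at \<open>x0\<close> turns the perturbation of the
        conjugate into a shift of the argument of \<open>u\<close> by this \<open>v\<close>. The
        quadratic term of \<open>u\<close> at p along \<open>v\<close> is then e^2 times half of
        \<open>form f p\<close>.\<close>
      define v where "v = - e *\<^sub>R grad f x0"
      have v: "norm v \<le> L * \<bar>e\<bar>" using mult_right_mono[OF L(2)[OF x(2)], of "\<bar>e\<bar>"] by (simp add: v_def mult.commute)
      have "v \<bullet> (Hess u p *v v) = e\<^sup>2 * form f p"
        by (simp add: v_def form_def x0_def matrix_vector_mult_scaleR power2_eq_square
            linear_neg[OF matrix_vector_mul_linear] flip: scaleR_minus_left)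
      moreover have "p + v \<in> S" "u (p + v) \<le> u p + v \<bullet> x0 + (v \<bullet> (Hess u p *v v)) / 2 + e1 * (norm v)\<^sup>2"
        using d1(2)[OF p, of v] v small by (auto simp: x0_def)
      moreover have "e1 * (norm v)\<^sup>2 \<le> e\<^sup>2 * (\<eta> / 2)"
      proof -
        have "(norm v)\<^sup>2 \<le> (L * \<bar>e\<bar>)\<^sup>2" using v by (intro power_mono) auto
        then have "e1 * (norm v)\<^sup>2 \<le> e1 * (L * \<bar>e\<bar>)\<^sup>2" using e12 by (intro mult_left_mono) auto
        also have "\<dots> = e\<^sup>2 * (\<eta> / 2)" using L by (simp add: e1_def power_mult_distrib)
        finally show ?thesis .
      qed
      moreover have "(x0 - x) \<bullet> v = e * ((x - x0) \<bullet> grad f x0)"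
        by (simp add: v_def inner_diff_left algebra_simps)
      ultimately have "u y + x \<bullet> (p - y) \<le> u p + e * ((x - x0) \<bullet> grad f x0) + e\<^sup>2 * form f p / 2 + e\<^sup>2 * (\<eta> / 2)"
        using *[of v] by (simp add: inner_diff_left inner_diff_right inner_commute)
      moreover have "e * ((x - x0) \<bullet> grad f x0) - e * (f x - f x0) \<le> e\<^sup>2 * (\<eta> / 2)"
      proof -
        have n: "norm (x - x0) < 4 * Q * L * \<bar>e\<bar>" using False by simp
        have "- e * (f x - f x0 - (x - x0) \<bullet> grad f x0) \<le> \<bar>e\<bar> * \<bar>f x - f x0 - (x - x0) \<bullet> grad f x0\<bar>"
          by (metis abs_ge_self abs_minus_cancel abs_mult)
        also have "\<dots> \<le> \<bar>e\<bar> * (e2 * norm (x - x0))"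
          using lin[OF x] n small by (intro mult_left_mono) auto
        also have "\<dots> \<le> \<bar>e\<bar> * (e2 * (4 * Q * L * \<bar>e\<bar>))"
          using n e12 by (intro mult_left_mono) auto
        also have "\<dots> = e\<^sup>2 * (\<eta> / 2)"
          using L Q by (simp add: e2_def power2_eq_square abs_mult_self_eq flip: abs_mult)
        finally show ?thesis by (simp add: algebra_simps)
      qed
      ultimately show ?thesis by (simp add: x_def[symmetric] x0_def[symmetric] algebra_simps)
    qed
  qed
  then show ?thesis using e0 by blast
qed

end

section \<open>The Brascamp-Lieb inequality\<close>

text \<open>The Lagrange remainder is at most 3/6 |s|^3, as exp 1 <= 3; the absolute value covers
  negative \<open>s\<close>.\<close>

lemma exp_lower_cubic:
  fixes s :: real
  assumes "\<bar>s\<bar> \<le> 1"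
  shows "1 + s + s\<^sup>2 / 2 - \<bar>s\<bar> ^ 3 \<le> exp s"
proof -
  have "\<exists>t. \<bar>t\<bar> \<le> \<bar>s\<bar> \<and> exp s = (\<Sum>m<3. s ^ m / fact m) + exp t / fact 3 * s ^ 3"
    by (rule Maclaurin_exp_le)
  then obtain t where t: "\<bar>t\<bar> \<le> \<bar>s\<bar>" "exp s = (\<Sum>m<3. s ^ m / fact m) + exp t / fact 3 * s ^ 3" by blast
  have "exp t \<le> exp 1" using t(1) assms by auto
  also have "exp (1::real) \<le> 3" by (rule exp_le)
  finally have "\<bar>exp t / fact 3 * s ^ 3\<bar> \<le> 1 * \<bar>s\<bar> ^ 3"
    unfolding abs_mult power_abs by (intro mult_right_mono) (auto simp: fact_numeral)
  then show ?thesis unfolding t(2) by (simp add: eval_nat_numeral fact_numeral)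
qed

section \<open>Brascamp-Lieb on compact convex subsets of the domain\<close>

context gibbs
begin

definition N :: "(real ^ 'n) measure"
  where "N = density lborel (\<lambda>z. ennreal (indicator S z * exp (- u z)))"

lemma borel_S [measurable]: "S \<in> sets borel"
  using open_dom by simp

lemma measurable_indicator_mult:
  fixes F :: "real ^ 'n \<Rightarrow> real"
  assumes "continuous_on S F" "A \<in> sets borel" "A \<subseteq> S"
  shows "(\<lambda>z. indicator A z * F z) \<in> borel_measurable borel"
  using borel_measurable_continuous_on_indicator[OF assms(2) continuous_on_subset[OF assms(1,3)]] by simp

lemma measurable_weight [measurable]: "(\<lambda>z. indicator S z * exp (- u z)) \<in> borel_measurable borel"
  by (intro measurable_indicator_mult continuous_intros continuous_on_u) auto

lemma sets_N [measurable_cong, simp]: "sets N = sets borel" and space_N [simp]: "space N = UNIV"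
  by (auto simp: N_def)

lemma prob_space_N: "prob_space N"
  by standard (use total in \<open>simp add: N_def emeasure_density\<close>)

sublocale N: prob_space N by (rule prob_space_N)

lemma AE_N_S: "AE z in N. z \<in> S"
proof -
  have "(\<lambda>z. ennreal (indicator S z * exp (- u z))) \<in> borel_measurable lborel" by measurable
  from AE_density[OF this] show ?thesis
    unfolding N_def by (auto simp: indicator_def)
qed

lemma nn_integral_N:
  assumes [measurable]: "F \<in> borel_measurable borel"
  shows "(\<integral>\<^sup>+z. F z \<partial>N) = (\<integral>\<^sup>+z. ennreal (indicator S z * exp (- u z)) * F z \<partial>lborel)"
  unfolding N_def by (rule nn_integral_density) auto

lemma bounded_abs_on_compact:
  fixes F :: "real ^ 'n \<Rightarrow> real"
  assumes K: "compact K" "K \<subseteq> S" and F: "continuous_on S F"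
  obtains B where "0 < B" "\<And>z. z \<in> K \<Longrightarrow> \<bar>F z\<bar> \<le> B"
proof -
  have "bounded (F ` K)"
    using K F by (intro compact_imp_bounded compact_continuous_image) (auto intro: continuous_on_subset)
  then show ?thesis unfolding bounded_pos using that by auto
qed

lemma integrable_compact:
  fixes F :: "real ^ 'n \<Rightarrow> real"
  assumes K: "compact K" "K \<subseteq> S" and F: "continuous_on S F"
  shows "integrable N (\<lambda>z. indicator K z * F z)"
proof -
  obtain B where B: "0 < B" "\<And>z. z \<in> K \<Longrightarrow> \<bar>F z\<bar> \<le> B"
    using bounded_abs_on_compact[OF K F] by blast
  show ?thesis
  proof (rule N.integrable_const_bound[where B = "B"])
    show "AE z in N. norm (indicator K z * F z) \<le> B"
      using B by (intro AE_I2) (auto simp: indicator_def)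
    show "(\<lambda>z. indicator K z * F z) \<in> borel_measurable N"
      using measurable_indicator_mult[OF F borel_compact[OF K(1)] K(2)] by simp
  qed
qed

text \<open>The density is cut off by the indicator of \<open>K\<close>. Convexity of
  \<open>K\<close> puts the midpoint of two points of \<open>K\<close> in \<open>K\<close> again, so
  the cut-off density can serve as the third function.\<close>

lemma prekopa_leindler_N:
  assumes K: "compact K" "K \<subseteq> S" "convex K" and AB: "continuous_on S A" "continuous_on S B"
    and le: "\<And>p q. p \<in> K \<Longrightarrow> q \<in> K \<Longrightarrow>
      A p + B q \<le> u p + u q - 2 * u ((1/2) *\<^sub>R (p + q))"
  shows "(LINT z|N. indicator K z * exp (A z)) * (LINT z|N. indicator K z * exp (B z)) \<le> (measure N K)\<^sup>2"
proof -
  have [measurable]: "K \<in> sets borel" using K by (simp add: borel_compact)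
  let ?E = "\<lambda>A z. ennreal (indicator K z * exp (A z - u z))"
  have meas: "?E F \<in> borel_measurable borel" if "continuous_on S F" for F
    using K that continuous_on_u
    by (intro measurable_compose[OF measurable_indicator_mult measurable_ennreal]) (auto intro!: continuous_intros)
  have eq: "(\<integral>\<^sup>+z. ?E F z \<partial>lborel) = ennreal (LINT z|N. indicator K z * exp (F z))"
    if F: "continuous_on S F" for F
  proof -
    have cF: "continuous_on S (\<lambda>z. exp (F z))" using F by (intro continuous_intros)
    have "(\<integral>\<^sup>+z. ?E F z \<partial>lborel) = (\<integral>\<^sup>+z. ennreal (indicator K z * exp (F z)) \<partial>N)"
      using measurable_indicator_mult[OF cF _ K(2)] K
      by (subst nn_integral_N) (auto intro!: nn_integral_cong simp: indicator_def exp_diff exp_minus field_simps simp flip: ennreal_mult)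
    also have "\<dots> = ennreal (LINT z|N. indicator K z * exp (F z))"
      by (intro nn_integral_eq_integral integrable_compact K cF) auto
    finally show ?thesis .
  qed
  have "(\<integral>\<^sup>+z. ?E A z \<partial>lborel) * (\<integral>\<^sup>+z. ?E B z \<partial>lborel) \<le> (\<integral>\<^sup>+z. ?E (\<lambda>_. 0) z \<partial>lborel)\<^sup>2"
  proof (rule prekopa_leindler)
    fix p q :: "real ^ 'n"
    let ?m = "(1/2) *\<^sub>R (p + q)"
    show "?E A p * ?E B q \<le> (?E (\<lambda>_. 0) ?m)\<^sup>2"
    proof (cases "p \<in> K \<and> q \<in> K")
      case True
      then have "?m \<in> K" using convexD[OF K(3), of p q "1/2" "1/2"] by (simp add: scaleR_add_right)
      have "exp (A p - u p) * exp (B q - u q) = exp ((A p + B q) - (u p + u q))" by (simp flip: exp_add)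
      also have "\<dots> \<le> exp (- (2 * u ?m))" using le[OF conjunct1[OF True] conjunct2[OF True]] by (simp del: scaleR_add_right)
      also have "\<dots> = (exp (- u ?m))\<^sup>2" by (simp add: power2_eq_square flip: exp_add)
      finally have "exp (A p - u p) * exp (B q - u q) \<le> (exp (- u ?m))\<^sup>2" .
      then show ?thesis using True \<open>?m \<in> K\<close>
        by (simp add: ennreal_power flip: ennreal_mult)
    qed auto
  qed (intro meas AB continuous_on_const)+
  also have "(\<integral>\<^sup>+z. ?E (\<lambda>_. 0) z \<partial>lborel) = ennreal (measure N K)"
    unfolding eq[OF continuous_on_const] by simp
  finally show ?thesis
    unfolding eq[OF AB(1)] eq[OF AB(2)]
    by (simp add: ennreal_power integral_nonneg_AE flip: ennreal_mult)
qed

text \<open>\<open>prekopa_leindler_N\<close> is applied to the exponents e g - e^2 q and - e g -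
  e^2 q. The integrals of their exponentials have no linear term, by centring, and their e^2
  coefficient \<open>D\<close> would be positive if the bound failed.\<close>

lemma brascamp_lieb_compact_centered:
  assumes f: "C1_on UNIV f" and K: "compact K" "K \<subseteq> S" "convex K"
    and mean: "(LINT z|N. indicator K z * f (grad u z)) = 0"
  shows "(LINT z|N. indicator K z * (f (grad u z))\<^sup>2) \<le> (LINT z|N. indicator K z * form f z)"
proof -
  define g where "g z = f (grad u z)" for z
  have fc: "continuous_on UNIV f"
    using f by (rule C1_on_imp_continuous_on)
  have gc: "continuous_on S g"
    unfolding g_def using continuous_on_compose2[OF fc continuous_on_grad] by simp
  note rc = continuous_on_form[OF f]
  have le: "(LINT z|N. indicator K z * (g z)\<^sup>2) \<le> (LINT z|N. indicator K z * form f z) + 2 * \<eta>"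
    if eta: "0 < \<eta>" for \<eta>
  proof (rule ccontr)
    assume neg: "\<not> ?thesis"
    define q where "q z = form f z / 2 + \<eta>" for z
    have qc: "continuous_on S q" unfolding q_def by (intro continuous_intros rc) auto
    \<comment> \<open>Coefficient of e^2 in the integral of exp (e g - e^2 q) over \<open>K\<close>.
      Failure of the bound by more than 2 \<open>\<eta>\<close> gives D > \<open>\<eta>\<close> -
      \<open>measure N K * \<eta>\<close> >= 0.\<close>
    define D where "D = (LINT z|N. indicator K z * ((g z)\<^sup>2 / 2 - q z))"
    have int: "integrable N (\<lambda>z. indicator K z * F z)" if "continuous_on S F" for F :: "real ^ 'n \<Rightarrow> real"
      using integrable_compact[OF K(1,2) that] .
    have "D = (LINT z|N. (indicator K z * (g z)\<^sup>2) / 2 - (indicator K z * form f z) / 2 - indicator K z * \<eta>)"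
      unfolding D_def q_def by (intro Bochner_Integration.integral_cong) (auto simp: algebra_simps)
    also have "\<dots> = (LINT z|N. indicator K z * (g z)\<^sup>2) / 2 - (LINT z|N. indicator K z * form f z) / 2 - measure N K * \<eta>"
      using int[of "\<lambda>z. (g z)\<^sup>2"] int[OF rc] int[of "\<lambda>_. \<eta>"] gc K
      by (simp add: continuous_intros borel_compact)
    finally have "D = (LINT z|N. indicator K z * (g z)\<^sup>2) / 2 - (LINT z|N. indicator K z * form f z) / 2 - measure N K * \<eta>" .
    moreover have "measure N K * \<eta> \<le> \<eta>" using eta N.prob_le_1[of K] by simp
    ultimately have D: "0 < D" using neg by simp
    obtain B1 where B1: "0 < B1" "\<And>z. z \<in> K \<Longrightarrow> \<bar>g z\<bar> \<le> B1" using bounded_abs_on_compact[OF K(1,2) gc] by blast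
    obtain B2 where B2: "0 < B2" "\<And>z. z \<in> K \<Longrightarrow> \<bar>q z\<bar> \<le> B2" using bounded_abs_on_compact[OF K(1,2) qc] by blast
    define M where "M = max 1 (max B1 B2)"
    have M: "1 \<le> M" "\<And>z. z \<in> K \<Longrightarrow> \<bar>g z\<bar> \<le> M" "\<And>z. z \<in> K \<Longrightarrow> \<bar>q z\<bar> \<le> M"
      using B1(2) B2(2) by (force simp: M_def)+
    obtain e0 where e0: "0 < e0" "\<And>e y p. \<bar>e\<bar> < e0 \<Longrightarrow> y \<in> K \<Longrightarrow> p \<in> K \<Longrightarrow>
        u y + grad u y \<bullet> (p - y) - e * f (grad u y) \<le> u p - e * f (grad u p) + e\<^sup>2 * (form f p / 2 + \<eta>)"
      using perturbed_conjugate_le[OF f K(1,2) eta] by blast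
    \<comment> \<open>The first entry keeps e below \<open>e0\<close>; the second keeps the
      exponent, of size at most 2 M e, within [-1, 1]; the third makes the cubic error 9 M^3 e^3 at
      most half of e^2 D.\<close>
    define e where "e = Min {e0 / 2, 1 / (2 * M), D / (18 * M ^ 3)}"
    have M3: "0 < M ^ 3" using M by simp
    have e: "0 < e" "e < e0" "2 * M * e \<le> 1" "18 * M ^ 3 * e \<le> D"
    proof -
      show "0 < e" using e0 M D by (simp add: e_def)
      show "e < e0" using e0(1) by (auto simp: e_def min_def)
      have "e \<le> 1 / (2 * M)" "e \<le> D / (18 * M ^ 3)" by (auto simp: e_def)
      then show "2 * M * e \<le> 1" "18 * M ^ 3 * e \<le> D" using M M3 by (auto simp: field_simps)
    qed
    have low: "measure N K + e\<^sup>2 * D / 2 \<le> (LINT z|N. indicator K z * exp (s * g z - s\<^sup>2 * q z))"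
      if s: "\<bar>s\<bar> = e" for s
    proof -
      have s2: "s\<^sup>2 = e\<^sup>2" using s by (metis power2_abs)
      \<comment> \<open>The constant 9 is 8 + 1: 8 from |a|^3 <= (2 M e)^3, and 1 from the mixed
        term of a^2 / 2. The square of s^2 q is dropped, being nonnegative.\<close>
      have pt: "1 + s * g z + e\<^sup>2 * ((g z)\<^sup>2 / 2 - q z) - 9 * M ^ 3 * e ^ 3 \<le> exp (s * g z - s\<^sup>2 * q z)"
        if z: "z \<in> K" for z
      proof -
        define a where "a = s * g z - s\<^sup>2 * q z"
        have e1: "e \<le> 1" using mult_right_mono[OF M(1) less_imp_le[OF e(1)]] e(1,3) by linarith
        have "\<bar>a\<bar> \<le> \<bar>s * g z\<bar> + \<bar>s\<^sup>2 * q z\<bar>" unfolding a_def by linarith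
        also have "\<dots> = e * \<bar>g z\<bar> + e\<^sup>2 * \<bar>q z\<bar>" using s s2 by (simp add: abs_mult)
        also have "\<dots> \<le> e * M + e\<^sup>2 * M" using M(2,3)[OF z] e by (intro add_mono mult_left_mono) auto
        also have "e\<^sup>2 * M \<le> e * M" using e1 e M by (simp add: power2_eq_square mult_right_le_one_le)
        finally have a: "\<bar>a\<bar> \<le> 2 * M * e" by simp
        have "\<bar>a\<bar> ^ 3 \<le> (2 * M * e) ^ 3" using a by (intro power_mono) auto
        then have a3: "\<bar>a\<bar> ^ 3 \<le> 8 * M ^ 3 * e ^ 3" by (simp add: power_mult_distrib)
        have sq: "a\<^sup>2 = e\<^sup>2 * (g z)\<^sup>2 - 2 * ((s * e\<^sup>2) * (g z * q z)) + (s\<^sup>2 * q z)\<^sup>2"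
          unfolding a_def power2_diff s2[symmetric] by (simp add: power_mult_distrib algebra_simps power2_eq_square)
        have cross: "(s * e\<^sup>2) * (g z * q z) \<le> e ^ 3 * M ^ 3"
        proof -
          have "(s * e\<^sup>2) * (g z * q z) \<le> \<bar>(s * e\<^sup>2) * (g z * q z)\<bar>" by simp
          also have "\<dots> = e ^ 3 * (\<bar>g z\<bar> * \<bar>q z\<bar>)" using s e by (simp add: abs_mult power2_eq_square power3_eq_cube)
          also have "\<dots> \<le> e ^ 3 * (M * M)" using M(1) M(2,3)[OF z] e by (intro mult_left_mono mult_mono) auto
          also have "\<dots> \<le> e ^ 3 * M ^ 3" using M(1) e by (intro mult_left_mono) (auto simp: power3_eq_cube)
          finally show ?thesis .
        qed
        have aux: "X / 2 - W \<le> A / 2" if "A = X - 2 * Y + P" "Y \<le> W" "0 \<le> P" for X Y W A P :: real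
          using that by linarith
        have "e\<^sup>2 * (g z)\<^sup>2 / 2 - e ^ 3 * M ^ 3 \<le> a\<^sup>2 / 2"
          by (rule aux[OF sq cross zero_le_power2])
        moreover have "1 + a + a\<^sup>2 / 2 - \<bar>a\<bar> ^ 3 \<le> exp a" using a e by (intro exp_lower_cubic) linarith
        moreover have "s * g z - e\<^sup>2 * q z = a" by (simp add: a_def s2)
        ultimately show ?thesis using a3 unfolding a_def[symmetric] by (simp add: algebra_simps)
      qed
      have ec: "continuous_on S (\<lambda>z. exp (s * g z - s\<^sup>2 * q z))" by (intro continuous_intros gc qc)
      have "(LINT z|N. indicator K z * 1 + s * (indicator K z * g z) + e\<^sup>2 * (indicator K z * ((g z)\<^sup>2 / 2 - q z))
            - indicator K z * (9 * M ^ 3 * e ^ 3)) \<le> (LINT z|N. indicator K z * exp (s * g z - s\<^sup>2 * q z))"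
      proof (rule integral_mono_AE)
        show "AE z in N. indicator K z * 1 + s * (indicator K z * g z) + e\<^sup>2 * (indicator K z * ((g z)\<^sup>2 / 2 - q z))
            - indicator K z * (9 * M ^ 3 * e ^ 3) \<le> indicator K z * exp (s * g z - s\<^sup>2 * q z)"
          using pt by (intro AE_I2) (auto simp: indicator_def)
      qed (intro Bochner_Integration.integrable_add Bochner_Integration.integrable_diff integrable_mult_right
          int continuous_intros gc qc; simp)+
      also have "(LINT z|N. indicator K z * 1 + s * (indicator K z * g z) + e\<^sup>2 * (indicator K z * ((g z)\<^sup>2 / 2 - q z))
            - indicator K z * (9 * M ^ 3 * e ^ 3))
          = measure N K + s * (LINT z|N. indicator K z * g z) + e\<^sup>2 * D - measure N K * (9 * M ^ 3 * e ^ 3)"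
        using int[of "\<lambda>_. 1"] int[OF gc] int[of "\<lambda>z. (g z)\<^sup>2 / 2 - q z"] int[of "\<lambda>_. 9 * M ^ 3 * e ^ 3"] gc qc
        by (simp add: continuous_intros D_def borel_compact K)
      finally have "measure N K + e\<^sup>2 * D - measure N K * (9 * M ^ 3 * e ^ 3)
          \<le> (LINT z|N. indicator K z * exp (s * g z - s\<^sup>2 * q z))"
        using mean by (simp add: g_def)
      moreover have "measure N K * (9 * M ^ 3 * e ^ 3) \<le> e\<^sup>2 * D / 2"
      proof -
        have "measure N K * (9 * M ^ 3 * e ^ 3) \<le> 1 * (9 * M ^ 3 * e ^ 3)"
          using M e by (intro mult_right_mono) auto
        also have "\<dots> = e\<^sup>2 * (18 * M ^ 3 * e) / 2" by (simp add: power2_eq_square power3_eq_cube)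
        also have "\<dots> \<le> e\<^sup>2 * D / 2" using e(4) by (intro divide_right_mono mult_left_mono) auto
        finally show ?thesis .
      qed
      ultimately show ?thesis by linarith
    qed
    have "(LINT z|N. indicator K z * exp (e * g z - e\<^sup>2 * q z)) * (LINT z|N. indicator K z * exp ((-e) * g z - (-e)\<^sup>2 * q z))
        \<le> (measure N K)\<^sup>2"
    proof (rule prekopa_leindler_N[OF K])
      fix p p' assume pp: "p \<in> K" "p' \<in> K"
      let ?m = "(1/2) *\<^sub>R (p + p')"
      have m: "?m \<in> K" using convexD[OF K(3) pp, of "1/2" "1/2"] by (simp add: scaleR_add_right)
      \<comment> \<open>The displacements from the midpoint are opposite. Adding the two
        inequalities at \<open>y = ?m\<close>, with e at p and -e at p', cancels the slopes and the
        values of \<open>f\<close> at \<open>grad u ?m\<close>.\<close>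
      have "(p - ?m) = - (p' - ?m)" by (auto simp: vec_eq_iff field_simps)
      then have "grad u ?m \<bullet> (p - ?m) = - (grad u ?m \<bullet> (p' - ?m))" by (metis inner_minus_right)
      with e0(2)[of e, OF _ m pp(1)] e0(2)[of "-e", OF _ m pp(2)] e(1,2)
      show "(e * g p - e\<^sup>2 * q p) + (- e * g p' - (- e)\<^sup>2 * q p') \<le> u p + u p' - 2 * u ?m"
        by (simp add: g_def q_def)
    qed (intro continuous_intros gc qc)+
    moreover have "(measure N K + e\<^sup>2 * D / 2) * (measure N K + e\<^sup>2 * D / 2)
       \<le> (LINT z|N. indicator K z * exp (e * g z - e\<^sup>2 * q z)) * (LINT z|N. indicator K z * exp ((-e) * g z - (-e)\<^sup>2 * q z))"
    proof (rule mult_mono)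
      have p: "0 \<le> measure N K + e\<^sup>2 * D / 2" using e D by simp
      then show "0 \<le> measure N K + e\<^sup>2 * D / 2" .
      show 1: "measure N K + e\<^sup>2 * D / 2 \<le> (LINT z|N. indicator K z * exp (e * g z - e\<^sup>2 * q z))"
        by (rule low) (use e in simp)
      show "0 \<le> (LINT z|N. indicator K z * exp (e * g z - e\<^sup>2 * q z))" using p 1 by linarith
      show "measure N K + e\<^sup>2 * D / 2 \<le> (LINT z|N. indicator K z * exp ((-e) * g z - (-e)\<^sup>2 * q z))"
        by (rule low) (use e in simp)
    qed
    moreover have "measure N K * measure N K < (measure N K + e\<^sup>2 * D / 2) * (measure N K + e\<^sup>2 * D / 2)"
      using e D by (intro mult_strict_mono') auto
    ultimately show False by (simp add: power2_eq_square)
  qed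
  show ?thesis
  proof (rule field_le_epsilon)
    fix e :: real assume "0 < e"
    then show "(LINT z|N. indicator K z * (f (grad u z))\<^sup>2) \<le> (LINT z|N. indicator K z * form f z) + e"
      using le[of "e/2"] by (simp add: g_def)
  qed
qed

text \<open>The centred case is applied to f - c, where c is the average over \<open>K\<close>;
  constants do not change the gradient. The quotient appears because \<open>N\<close> restricted to
  \<open>K\<close> is not normalised.\<close>

lemma brascamp_lieb_compact:
  assumes f: "C1_on UNIV f" and K: "compact K" "K \<subseteq> S" "convex K" "0 < measure N K"
  shows "(LINT z|N. indicator K z * (f (grad u z))\<^sup>2) - (LINT z|N. indicator K z * f (grad u z))\<^sup>2 / measure N K
    \<le> (LINT z|N. indicator K z * form f z)"
proof -
  define g where "g z = f (grad u z)" for z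
  define c where "c = (LINT z|N. indicator K z * g z) / measure N K"
  have fc: "continuous_on UNIV f"
    using f by (rule C1_on_imp_continuous_on)
  have gc: "continuous_on S g"
    unfolding g_def using continuous_on_compose2[OF fc continuous_on_grad] by simp
  note int = integrable_compact[OF K(1,2)]
  have gr: "grad (\<lambda>x. f x - c) = grad f"
  proof
    fix x
    have "GDERIV f x :> grad f x" using f by (intro gderiv_grad) (auto simp: C1_on_def)
    then have "GDERIV (\<lambda>x. f x - c) x :> grad f x - 0" by (intro GDERIV_diff GDERIV_const)
    then show "grad (\<lambda>x. f x - c) x = grad f x" by (intro grad_eqI) simp
  qed
  have f': "C1_on UNIV (\<lambda>x. f x - c)" using f by (auto simp: C1_on_def gr)
  have m: "(LINT z|N. indicator K z * g z) = c * measure N K" using K by (simp add: c_def)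
  have i1: "(LINT z|N. indicator K z * (g z - c)) = 0"
  proof -
    have "(LINT z|N. indicator K z * (g z - c)) = (LINT z|N. indicator K z * g z - indicator K z * c)"
      by (simp add: algebra_simps)
    also have "\<dots> = 0" using int[OF gc] int[of "\<lambda>_. c"] m K by (simp add: borel_compact mult.commute)
    finally show ?thesis .
  qed
  have "(LINT z|N. indicator K z * (g z - c)\<^sup>2)
      = (LINT z|N. indicator K z * (g z)\<^sup>2 - 2 * c * (indicator K z * g z) + indicator K z * c\<^sup>2)"
    by (intro Bochner_Integration.integral_cong) (auto simp: power2_eq_square algebra_simps)
  also have "\<dots> = (LINT z|N. indicator K z * (g z)\<^sup>2) - 2 * c * (c * measure N K) + measure N K * c\<^sup>2"
    using int[OF gc] int[of "\<lambda>_. c\<^sup>2"] int[of "\<lambda>z. (g z)\<^sup>2"] gc m K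
    by (simp add: borel_compact continuous_intros)
  finally have "(LINT z|N. indicator K z * (g z - c)\<^sup>2) = (LINT z|N. indicator K z * (g z)\<^sup>2) - c\<^sup>2 * measure N K"
    by (simp add: power2_eq_square)
  moreover have "(LINT z|N. indicator K z * (g z - c)\<^sup>2) \<le> (LINT z|N. indicator K z * form f z)"
    using brascamp_lieb_compact_centered[OF f' K(1-3)] i1 by (simp add: g_def form_def gr)
  moreover have "c\<^sup>2 * measure N K = (LINT z|N. indicator K z * g z)\<^sup>2 / measure N K"
    using K by (simp add: c_def power2_eq_square)
  ultimately show ?thesis by (simp add: g_def)
qed

end

section \<open>Directional derivatives integrate to zero\<close>

text \<open>Squaring removes the kink of the positive part at 0; this is why the squared cutoff
  below is differentiable.\<close>

lemma DERIV_max_0_power2: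
  fixes x :: real
  shows "((\<lambda>x. (max 0 x)\<^sup>2) has_real_derivative 2 * max 0 x) (at x)"
proof (cases "x = 0")
  case False
  then consider "0 < x" | "x < 0" by linarith
  then show ?thesis
  proof cases
    case 1
    have "((\<lambda>x. x\<^sup>2) has_real_derivative 2 * x) (at x)" by (auto intro!: derivative_eq_intros)
    then have "((\<lambda>x. (max 0 x)\<^sup>2) has_real_derivative 2 * x) (at x)"
      by (rule has_field_derivative_transform_within_open[where S = "{0<..}"]) (use 1 in auto)
    then show ?thesis using 1 by simp
  next
    case 2
    have "((\<lambda>x. 0) has_real_derivative 0) (at x)" by simp
    then have "((\<lambda>x. (max 0 x)\<^sup>2) has_real_derivative 0) (at x)"
      by (rule has_field_derivative_transform_within_open[where S = "{..<0}"]) (use 2 in auto)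
    then show ?thesis using 2 by simp
  qed
next
  case True
  have "((\<lambda>h::real. (max 0 h)\<^sup>2 / h) \<longlongrightarrow> 0) (at 0)"
  proof (rule Lim_null_comparison)
    show "\<forall>\<^sub>F h in at 0. norm ((max 0 h)\<^sup>2 / h) \<le> \<bar>h\<bar>"
      by (intro always_eventually) (auto simp: max_def power2_eq_square)
    show "((\<lambda>h::real. \<bar>h\<bar>) \<longlongrightarrow> 0) (at 0)" by (auto intro!: tendsto_eq_intros)
  qed
  then show ?thesis using True by (simp add: DERIV_def)
qed

lemma integral_lborel_translate:
  fixes F :: "'a::euclidean_space \<Rightarrow> real"
  assumes "integrable lborel F"
  shows "integrable lborel (\<lambda>z. F (z + c))" "(LINT z|lborel. F (z + c)) = (LINT z|lborel. F z)"
proof -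
  have m: "F \<in> borel_measurable borel" using assms by simp
  have e: "distr lborel borel ((+) c) = (lborel :: 'a measure)" by (rule lborel_distr_plus)
  have "integrable (distr lborel borel ((+) c)) F" using assms e by simp
  then show "integrable lborel (\<lambda>z. F (z + c))" using m
    by (subst (asm) integrable_distr_eq) (auto simp: add.commute)
  have "(LINT z|lborel. F z) = (LINT z|distr lborel borel ((+) c). F z)" using e by simp
  also have "\<dots> = (LINT z|lborel. F (z + c))" using m by (subst integral_distr) (auto simp: add.commute)
  finally show "(LINT z|lborel. F (z + c)) = (LINT z|lborel. F z)" by simp
qed

text \<open>The difference quotients of \<open>F\<close> along \<open>v\<close> have integral 0 by
  translation invariance, and they converge to \<open>G\<close> with a bound on a fixed
  ball.\<close>

lemma integral_directional_derivative_eq_0: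
  fixes F G :: "'a::euclidean_space \<Rightarrow> real"
  assumes F: "integrable lborel F" and [measurable]: "G \<in> borel_measurable borel"
    and deriv: "\<And>z s. ((\<lambda>s. F (z + s *\<^sub>R v)) has_real_derivative G (z + s *\<^sub>R v)) (at s)"
    and B: "\<And>z. \<bar>G z\<bar> \<le> B"
    and R: "\<And>z. R < norm z \<Longrightarrow> F z = 0"
  shows "(LINT z|lborel. G z) = 0"
proof -
  have [measurable]: "F \<in> borel_measurable borel" using F by simp
  define D where "D n z = real (Suc n) * (F (z + (1 / real (Suc n)) *\<^sub>R v) - F z)" for n z
  have "(\<lambda>n. LINT z|lborel. D n z) \<longlonglongrightarrow> (LINT z|lborel. G z)"
  proof (rule integral_dominated_convergence)
    \<comment> \<open>Beyond radius R + |v| both z and z + h v, with h <= 1, lie outside radius R,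
      so the quotient vanishes.\<close>
    show "integrable lborel (\<lambda>z::'a. indicator (cball 0 (R + norm v)) z * B)"
      using emeasure_compact_finite[OF compact_cball[of "0::'a" "R + norm v"]]
      by (intro integrable_mult_left integrable_real_indicator) auto
    show "AE z in lborel. (\<lambda>n. D n z) \<longlonglongrightarrow> G z"
    proof (intro AE_I2)
      fix z
      have "((\<lambda>h. (F (z + h *\<^sub>R v) - F z) / h) \<longlongrightarrow> G z) (at 0)"
        using deriv[of z 0] by (simp add: DERIV_def)
      moreover have "filterlim (\<lambda>n. 1 / real (Suc n)) (at 0) sequentially"
        unfolding filterlim_at
        using LIMSEQ_inverse_real_of_nat by (auto simp: inverse_eq_divide intro!: always_eventually)
      ultimately have "(\<lambda>n. (F (z + (1 / real (Suc n)) *\<^sub>R v) - F z) / (1 / real (Suc n))) \<longlonglongrightarrow> G z"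
        by (rule filterlim_compose)
      then show "(\<lambda>n. D n z) \<longlonglongrightarrow> G z" by (simp add: D_def mult.commute)
    qed
    show "AE z in lborel. norm (D n z) \<le> indicator (cball 0 (R + norm v)) z * B" for n
    proof (intro AE_I2)
      fix z
      define h where "h = 1 / real (Suc n)"
      have h: "0 < h" "h \<le> 1" by (auto simp: h_def)
      show "norm (D n z) \<le> indicator (cball 0 (R + norm v)) z * B"
      proof (cases "z \<in> cball 0 (R + norm v)")
        case True
        have "\<exists>s. 0 < s \<and> s < h \<and> F (z + h *\<^sub>R v) - F (z + 0 *\<^sub>R v) = (h - 0) * G (z + s *\<^sub>R v)"
          by (rule MVT2[OF h(1)]) (rule deriv)
        then obtain s where "F (z + h *\<^sub>R v) - F z = h * G (z + s *\<^sub>R v)" by auto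
        then have "D n z = G (z + s *\<^sub>R v)" unfolding D_def h_def[symmetric] by (simp add: h_def)
        then show ?thesis using True B by simp
      next
        case False
        have "norm (h *\<^sub>R v) \<le> norm v" using h by (simp add: mult_left_le_one_le)
        moreover have "norm z \<le> norm (z + h *\<^sub>R v) + norm (h *\<^sub>R v)"
          using norm_triangle_ineq4[of "z + h *\<^sub>R v" "h *\<^sub>R v"] by simp
        moreover have "R + norm v < norm z" using False by simp
        ultimately have "R < norm z" "R < norm (z + h *\<^sub>R v)" using norm_ge_zero[of v] by linarith+
        then show ?thesis using R False by (simp add: D_def h_def)
      qed
    qed
  qed (auto simp: D_def)
  moreover have "(LINT z|lborel. D n z) = 0" for n
    unfolding D_def using integral_lborel_translate[OF F] F by simp
  ultimately show ?thesis by (simp add: LIMSEQ_const_iff)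
qed

section \<open>Exhaustion of the domain by compact sublevel sets\<close>

context gibbs
begin

definition sublevel :: "real \<Rightarrow> (real ^ 'n) set"
  where "sublevel c = {z\<in>S. u z \<le> c}"

lemma sublevel_subset: "sublevel c \<subseteq> S"
  by (auto simp: sublevel_def)

lemma sublevel_mono: "c \<le> c' \<Longrightarrow> sublevel c \<subseteq> sublevel c'"
  by (auto simp: sublevel_def)

lemma convex_sublevel: "convex (sublevel c)"
proof (rule convexI)
  fix x y :: "real ^ 'n" and a b :: real
  assume xy: "x \<in> sublevel c" "y \<in> sublevel c" and ab: "0 \<le> a" "0 \<le> b" "a + b = 1"
  have "a *\<^sub>R x + b *\<^sub>R y \<in> S" using convex_dom xy ab by (auto simp: sublevel_def convexD)
  moreover have "u (a *\<^sub>R x + b *\<^sub>R y) \<le> a * u x + b * u y"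
    using convex_u xy ab by (auto simp: convex_on_def sublevel_def)
  moreover have "a * u x + b * u y \<le> a * c + b * c"
    using xy ab by (intro add_mono mult_left_mono) (auto simp: sublevel_def)
  moreover have "a * c + b * c = c" using ab by (simp flip: distrib_right)
  ultimately show "a *\<^sub>R x + b *\<^sub>R y \<in> sublevel c" by (simp add: sublevel_def)
qed

lemma dom_nonempty: "S \<noteq> {}"
  using total by auto

text \<open>The weight is at least exp (- c) on the sublevel set, so finite total mass bounds its
  volume; a convex set of finite volume that contains a ball is bounded.\<close>

lemma compact_sublevel: "compact (sublevel c)"
proof -
  obtain z where z: "z \<in> S" using dom_nonempty by auto
  \<comment> \<open>\<open>sublevel c\<close> itself may have empty interior. Raising the level to
    at least \<open>u z + 1\<close> puts a ball about \<open>z\<close> inside.\<close>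
  define c' where "c' = max c (u z + 1)"
  have "isCont u z" using continuous_on_u z open_dom by (simp add: continuous_on_eq_continuous_at)
  then obtain d where d: "0 < d" "\<And>y. dist y z < d \<Longrightarrow> dist (u y) (u z) < 1"
    unfolding continuous_at_eps_delta by (meson zero_less_one)
  obtain d' where d': "0 < d'" "ball z d' \<subseteq> S" using z open_dom open_contains_ball by blast
  have "ball z (min d d') \<subseteq> sublevel c'"
  proof
    fix y assume y: "y \<in> ball z (min d d')"
    then have "dist (u y) (u z) < 1" by (intro d) (simp add: dist_commute)
    then have "u y \<le> c'" by (simp add: c'_def dist_real_def)
    moreover have "y \<in> S" using y d' by auto
    ultimately show "y \<in> sublevel c'" by (simp add: sublevel_def)
  qed
  moreover have cl: "closed (sublevel c')" for c' unfolding sublevel_def by (rule closed_sublevel)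
  moreover have "emeasure lborel (sublevel c') < \<infinity>"
  proof -
    have [measurable]: "sublevel c' \<in> sets borel" using cl by simp
    have "ennreal (exp (- c')) * emeasure lborel (sublevel c')
        = (\<integral>\<^sup>+z. ennreal (exp (- c')) * indicator (sublevel c') z \<partial>lborel)"
      by (simp add: nn_integral_cmult)
    also have "\<dots> \<le> (\<integral>\<^sup>+z. ennreal (indicator S z * exp (- u z)) \<partial>lborel)"
      by (intro nn_integral_mono) (auto simp: indicator_def sublevel_def)
    also have "\<dots> < \<infinity>" by (simp add: total)
    finally show ?thesis by (auto simp: ennreal_mult_less_top less_top)
  qed
  ultimately have "bounded (sublevel c')"
    using d d' by (intro bounded_convex_if_finite_measure[where r = "min d d'" and z = z] convex_sublevel) auto
  then have "bounded (sublevel c)"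
    by (rule bounded_subset) (rule sublevel_mono, simp add: c'_def)
  with cl show ?thesis by (simp add: compact_eq_bounded_closed)
qed

lemma borel_sublevel [measurable]: "sublevel c \<in> sets borel"
  using compact_sublevel by (rule borel_compact)

lemma eventually_mem_sublevel:
  assumes "z \<in> S"
  shows "\<forall>\<^sub>F n in sequentially. z \<in> sublevel (real n)"
proof -
  obtain m :: nat where "u z \<le> real m" using real_arch_simple by blast
  then have "\<forall>n\<ge>m. z \<in> sublevel (real n)" using assms by (auto simp: sublevel_def)
  then show ?thesis by (auto simp: eventually_sequentially)
qed

lemma integral_sublevel_tendsto:
  fixes F :: "real ^ 'n \<Rightarrow> real"
  assumes F: "continuous_on S F" and int: "integrable N (\<lambda>z. indicator S z * F z)"
  shows "(\<lambda>n. LINT z|N. indicator (sublevel (real n)) z * F z) \<longlonglongrightarrow> (LINT z|N. indicator S z * F z)"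
proof (rule integral_dominated_convergence)
  show "integrable N (\<lambda>z. \<bar>indicator S z * F z\<bar>)" using int by (rule integrable_abs)
  show "AE z in N. (\<lambda>n. indicator (sublevel (real n)) z * F z) \<longlonglongrightarrow> indicator S z * F z"
  proof (intro AE_I2)
    fix z
    have "(\<lambda>n. indicator (sublevel (real n)) z) \<longlonglongrightarrow> (indicator S z :: real)"
    proof (cases "z \<in> S")
      case True
      then show ?thesis
        using eventually_mem_sublevel[OF True] by (intro tendsto_eventually) (auto elim: eventually_mono)
    next
      case False
      then show ?thesis using sublevel_subset by (intro tendsto_eventually always_eventually) (auto simp: indicator_def)
    qed
    then show "(\<lambda>n. indicator (sublevel (real n)) z * F z) \<longlonglongrightarrow> indicator S z * F z" by (intro tendsto_intros)
  qed
  show "AE z in N. norm (indicator (sublevel (real n)) z * F z) \<le> \<bar>indicator S z * F z\<bar>" for n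
    using sublevel_subset by (intro AE_I2) (auto simp: indicator_def)
qed (use measurable_indicator_mult[OF F] sublevel_subset in auto)

text \<open>On the sublevel sets all integrals converge by domination, and the masses tend to 1,
  which removes the normalising quotient in the limit.\<close>

theorem brascamp_lieb:
  assumes f: "C1_on UNIV f"
    and int: "integrable N (\<lambda>z. indicator S z * (f (grad u z))\<^sup>2)" "integrable N (\<lambda>z. indicator S z * form f z)"
  shows "(LINT z|N. indicator S z * (f (grad u z))\<^sup>2) - (LINT z|N. indicator S z * f (grad u z))\<^sup>2
    \<le> (LINT z|N. indicator S z * form f z)"
proof -
  define g where "g z = f (grad u z)" for z
  have fc: "continuous_on UNIV f"
    using f by (rule C1_on_imp_continuous_on)
  have gc: "continuous_on S g"
    unfolding g_def using continuous_on_compose2[OF fc continuous_on_grad] by simp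
  have "integrable N (\<lambda>z. (indicator S z * g z)\<^sup>2)"
  proof -
    have "(indicator S z * g z)\<^sup>2 = indicator S z * (f (grad u z))\<^sup>2" for z by (simp add: indicator_def g_def)
    then show ?thesis using int(1) by simp
  qed
  then have int_g: "integrable N (\<lambda>z. indicator S z * g z)"
    by (rule N.square_integrable_imp_integrable[rotated]) (use measurable_indicator_mult[OF gc] in auto)
  define K where "K n = sublevel (real n)" for n
  have one: "(LINT z|N. indicator S z * 1) = (1::real)"
  proof -
    have "(LINT z|N. indicator S z * 1) = (LINT z|N. (1::real))"
      using AE_N_S by (intro integral_cong_AE) auto
    then show ?thesis using N.prob_space by simp
  qed
  have "(\<lambda>n. LINT z|N. indicator (K n) z * 1) \<longlonglongrightarrow> (1::real)"
    using integral_sublevel_tendsto[of "\<lambda>_. 1"] one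
    by (simp add: K_def integrable_real_indicator less_top[symmetric])
  then have K1: "(\<lambda>n. measure N (K n)) \<longlonglongrightarrow> 1" by (simp add: K_def)
  have "(\<lambda>n. (LINT z|N. indicator (K n) z * (g z)\<^sup>2) - (LINT z|N. indicator (K n) z * g z)\<^sup>2 / measure N (K n))
    \<longlonglongrightarrow> (LINT z|N. indicator S z * (g z)\<^sup>2) - (LINT z|N. indicator S z * g z)\<^sup>2 / 1"
    unfolding K_def
    by (intro tendsto_intros K1[unfolded K_def] integral_sublevel_tendsto int_g int(1)[folded g_def]) (auto intro: gc continuous_intros)
  moreover have "(\<lambda>n. LINT z|N. indicator (K n) z * form f z) \<longlonglongrightarrow> (LINT z|N. indicator S z * form f z)"
    unfolding K_def by (intro integral_sublevel_tendsto continuous_on_form f int(2))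
  moreover have "\<forall>\<^sub>F n in sequentially. (LINT z|N. indicator (K n) z * (g z)\<^sup>2) - (LINT z|N. indicator (K n) z * g z)\<^sup>2 / measure N (K n)
      \<le> (LINT z|N. indicator (K n) z * form f z)"
    using order_tendstoD(1)[OF K1 zero_less_one]
    by eventually_elim
      (simp add: K_def g_def brascamp_lieb_compact f compact_sublevel sublevel_subset convex_sublevel)
  ultimately have "(LINT z|N. indicator S z * (g z)\<^sup>2) - (LINT z|N. indicator S z * g z)\<^sup>2 / 1
      \<le> (LINT z|N. indicator S z * form f z)"
    by (intro tendsto_le[OF trivial_limit_sequentially]) auto
  then show ?thesis by (simp add: g_def)
qed

section \<open>Integration by parts against exp (- u)\<close>

lemma integral_directional_derivative_dom_eq_0:
  fixes a a' :: "real ^ 'n \<Rightarrow> real"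
  assumes cont: "continuous_on S a" "continuous_on S a'"
    and K: "compact K" "K \<subseteq> S" "\<And>z. z \<in> S \<Longrightarrow> z \<notin> K \<Longrightarrow> a z = 0" "\<And>z. z \<in> S \<Longrightarrow> z \<notin> K \<Longrightarrow> a' z = 0"
    and deriv: "\<And>z s. z + s *\<^sub>R v \<in> S \<Longrightarrow> ((\<lambda>s. a (z + s *\<^sub>R v)) has_real_derivative a' (z + s *\<^sub>R v)) (at s)"
  shows "(LINT z|lborel. indicator S z * a' z) = 0"
proof -
  have bound: "\<exists>B. \<forall>z. \<bar>indicator S z * F z\<bar> \<le> B"
    if c: "continuous_on S F" and F0: "\<And>z. z \<in> S \<Longrightarrow> z \<notin> K \<Longrightarrow> F z = 0" for F :: "real ^ 'n \<Rightarrow> real"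
  proof -
    obtain B where "0 < B" "\<And>z. z \<in> K \<Longrightarrow> \<bar>F z\<bar> \<le> B" using bounded_abs_on_compact[OF K(1,2) c] by blast
    then have "\<bar>indicator S z * F z\<bar> \<le> B" for z
      using F0[of z] by (cases "z \<in> S"; cases "z \<in> K") auto
    then show ?thesis by blast
  qed
  obtain R where R: "\<And>z. z \<in> K \<Longrightarrow> norm z \<le> R" using compact_imp_bounded[OF K(1)] by (auto simp: bounded_iff)
  obtain B where B: "\<And>z. \<bar>indicator S z * a' z\<bar> \<le> B" using bound[OF cont(2) K(4)] by blast
  obtain B' where B': "\<And>z. \<bar>indicator S z * a z\<bar> \<le> B'" using bound[OF cont(1) K(3)] by blast
  show ?thesis
  proof (rule integral_directional_derivative_eq_0)
    have vanish: "indicator S z * a z = 0" if "z \<notin> K" for z using K(3)[of z] that by (auto simp: indicator_def)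
    show "R < norm z \<Longrightarrow> indicator S z * a z = 0" for z using vanish[of z] R[of z] by auto
    show "integrable lborel (\<lambda>z. indicator S z * a z)"
    proof (rule Bochner_Integration.integrable_bound)
      show "integrable lborel (\<lambda>z. indicator K z * B')"
        using K(1) emeasure_compact_finite[OF K(1)]
        by (intro integrable_mult_left integrable_real_indicator) (auto simp: borel_compact)
      show "AE z in lborel. norm (indicator S z * a z) \<le> norm (indicator K z * B')"
      proof (intro AE_I2)
        fix z show "norm (indicator S z * a z) \<le> norm (indicator K z * B')"
          using vanish[of z] B'[of z] by (cases "z \<in> K") auto
      qed
    qed (use measurable_indicator_mult[OF cont(1)] in auto)
    show "((\<lambda>s. indicator S (z + s *\<^sub>R v) * a (z + s *\<^sub>R v)) has_real_derivative
        indicator S (z + s *\<^sub>R v) * a' (z + s *\<^sub>R v)) (at s)" for z s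
    proof (cases "z + s *\<^sub>R v \<in> S")
      case True
      have op: "open ((\<lambda>s. z + s *\<^sub>R v) -` S)" by (intro open_vimage open_dom continuous_intros)
      have "((\<lambda>s. indicator S (z + s *\<^sub>R v) * a (z + s *\<^sub>R v)) has_real_derivative a' (z + s *\<^sub>R v)) (at s)"
        by (rule has_field_derivative_transform_within_open[OF deriv[OF True] op]) (use True in auto)
      then show ?thesis using True by simp
    next
      case False
      \<comment> \<open>A point outside \<open>S\<close> lies in the open complement of
        \<open>K\<close>, where the extension by 0 vanishes identically; so the extension is
        differentiable across the boundary of \<open>S\<close>.\<close>
      have op: "open ((\<lambda>s. z + s *\<^sub>R v) -` (- K))"
        using compact_imp_closed[OF K(1)] by (intro open_vimage open_Compl continuous_intros)
      have "((\<lambda>s. indicator S (z + s *\<^sub>R v) * a (z + s *\<^sub>R v)) has_real_derivative 0) (at s)"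
        by (rule has_field_derivative_transform_within_open[OF DERIV_const[of 0] op])
          (use False K(2) vanish in auto)
      then show ?thesis using False by simp
    qed
    show "(\<lambda>z. indicator S z * a' z) \<in> borel_measurable borel"
      using measurable_indicator_mult[OF cont(2)] by auto
  qed (rule B)
qed

text \<open>The square of the cutoff is a \<open>C\<^sup>1\<close> function of \<open>u\<close> with compact support that increases
  to \<open>exp (- u)\<close>; it removes all boundary terms from the integrations by parts.\<close>

definition cutoff :: "nat \<Rightarrow> real ^ 'n \<Rightarrow> real"
  where "cutoff k z = max 0 (exp (- u z / 2) - exp (- real k / 2))"

lemma cutoff_nonneg: "0 \<le> cutoff k z"
  and cutoff_le: "cutoff k z \<le> exp (- u z / 2)"
  by (auto simp: cutoff_def)

lemma cutoff_mono: "k \<le> l \<Longrightarrow> cutoff k z \<le> cutoff l z"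
  unfolding cutoff_def by (intro max.mono order_refl diff_left_mono) simp

lemma cutoff_eq_0: "z \<in> S \<Longrightarrow> z \<notin> sublevel (real k) \<Longrightarrow> cutoff k z = 0"
  by (auto simp: cutoff_def sublevel_def)

lemma continuous_on_cutoff: "continuous_on S (cutoff k)"
  unfolding cutoff_def by (intro continuous_intros continuous_on_u)  auto

lemma cutoff_tendsto: "(\<lambda>k. cutoff k z) \<longlonglongrightarrow> exp (- u z / 2)"
proof -
  have "(\<lambda>k. exp (- real k / 2)) \<longlonglongrightarrow> 0"
    by (rule filterlim_compose[OF exp_at_bot]) real_asymp
  then have "(\<lambda>k. max 0 (exp (- u z / 2) - exp (- real k / 2))) \<longlonglongrightarrow> max 0 (exp (- u z / 2) - 0)"
    by (intro tendsto_intros)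
  then show ?thesis by (simp add: cutoff_def)
qed

lemma DERIV_cutoff_power2:
  assumes "z + s *\<^sub>R v \<in> S"
  shows "((\<lambda>s. (cutoff k (z + s *\<^sub>R v))\<^sup>2) has_real_derivative
    - (cutoff k (z + s *\<^sub>R v) * exp (- u (z + s *\<^sub>R v) / 2) * (v \<bullet> grad u (z + s *\<^sub>R v)))) (at s)"
proof -
  have "((\<lambda>s. exp (- u (z + s *\<^sub>R v) / 2) - exp (- real k / 2)) has_real_derivative
      exp (- u (z + s *\<^sub>R v) / 2) * (- (v \<bullet> grad u (z + s *\<^sub>R v)) / 2)) (at s)"
    by (rule derivative_eq_intros DERIV_grad_line differentiable_u assms refl | simp)+
  from DERIV_chain2[OF DERIV_max_0_power2 this] show ?thesis
    unfolding cutoff_def by (simp add: ac_simps)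
qed

lemma exp_half_mult: "exp (- u z / 2) * exp (- u z / 2) = exp (- u z)"
  by (simp flip: exp_add)

text \<open>exp (- u) v . grad u is minus the derivative of exp (- u) along \<open>v\<close>. With
  the squared cutoff in place of exp (- u), the derivative is still dominated by exp (- u) |v . grad
  u|, so the assumed integrability suffices for the limit.\<close>

lemma integral_grad_eq_0:
  assumes "integrable N (\<lambda>z. indicator S z * (v \<bullet> grad u z))"
  shows "(LINT z|N. indicator S z * (v \<bullet> grad u z)) = 0"
proof -
  let ?a = "\<lambda>k z. cutoff k z * exp (- u z / 2) * (v \<bullet> grad u z)"
  have cont: "continuous_on S (?a k)" for k
    by (intro continuous_intros continuous_on_cutoff continuous_on_u continuous_on_grad) auto
  have zero: "(LINT z|lborel. indicator S z * ?a k z) = 0" for k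
  proof -
    have "(LINT z|lborel. indicator S z * (- ?a k z)) = 0"
    proof (rule integral_directional_derivative_dom_eq_0)
      show "continuous_on S (\<lambda>z. (cutoff k z)\<^sup>2)" by (intro continuous_intros continuous_on_cutoff)
      show "continuous_on S (\<lambda>z. - ?a k z)" by (intro continuous_on_minus cont)
      show "((\<lambda>s. (cutoff k (z + s *\<^sub>R v))\<^sup>2) has_real_derivative - ?a k (z + s *\<^sub>R v)) (at s)"
        if "z + s *\<^sub>R v \<in> S" for z s using DERIV_cutoff_power2[OF that] .
    qed (use compact_sublevel[of "real k"] sublevel_subset[of "real k"] cutoff_eq_0[of _ k] in \<open>auto\<close>)
    then show ?thesis by simp
  qed
  have gm: "(\<lambda>z. indicator S z * (v \<bullet> grad u z)) \<in> borel_measurable borel"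
    by (intro measurable_indicator_mult continuous_intros continuous_on_grad) auto
  have intl: "integrable lborel (\<lambda>z. exp (- u z) * indicator S z * (v \<bullet> grad u z))"
    and eq: "(LINT z|N. indicator S z * (v \<bullet> grad u z)) = (LINT z|lborel. exp (- u z) * indicator S z * (v \<bullet> grad u z))"
  proof -
    have w: "(indicator S z * exp (- u z)) * (indicator S z * (v \<bullet> grad u z)) = exp (- u z) * indicator S z * (v \<bullet> grad u z)" for z
      by (simp add: indicator_def)
    show "integrable lborel (\<lambda>z. exp (- u z) * indicator S z * (v \<bullet> grad u z))"
      using assms unfolding N_def by (subst (asm) integrable_density) (use gm in \<open>auto simp only: w real_scaleR_def measurable_lborel1 measurable_lborel2 measurable_weight zero_le_mult_iff indicator_pos_le exp_ge_zero intro!: AE_I2\<close>)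
    show "(LINT z|N. indicator S z * (v \<bullet> grad u z)) = (LINT z|lborel. exp (- u z) * indicator S z * (v \<bullet> grad u z))"
      unfolding N_def by (subst integral_density) (use gm measurable_weight in \<open>auto simp: w[symmetric]\<close>)
  qed
  have "(\<lambda>k. LINT z|lborel. indicator S z * ?a k z) \<longlonglongrightarrow> (LINT z|lborel. exp (- u z) * indicator S z * (v \<bullet> grad u z))"
  proof (rule integral_dominated_convergence)
    show "integrable lborel (\<lambda>z. \<bar>exp (- u z) * indicator S z * (v \<bullet> grad u z)\<bar>)" using intl by (rule integrable_abs)
    show "(\<lambda>z. exp (- u z) * indicator S z * (v \<bullet> grad u z)) \<in> borel_measurable lborel" using intl by simp
    show "(\<lambda>z. indicator S z * ?a k z) \<in> borel_measurable lborel" for k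
      using measurable_indicator_mult[OF cont] by simp
    show "AE z in lborel. (\<lambda>k. indicator S z * ?a k z) \<longlonglongrightarrow> exp (- u z) * indicator S z * (v \<bullet> grad u z)"
    proof (intro AE_I2)
      fix z
      have "(\<lambda>k. indicator S z * ?a k z) \<longlonglongrightarrow> indicator S z * (exp (- u z / 2) * exp (- u z / 2) * (v \<bullet> grad u z))"
        by (intro tendsto_intros cutoff_tendsto)
      then show "(\<lambda>k. indicator S z * ?a k z) \<longlonglongrightarrow> exp (- u z) * indicator S z * (v \<bullet> grad u z)"
        unfolding exp_half_mult by (simp add: ac_simps)
    qed
    show "AE z in lborel. norm (indicator S z * ?a k z) \<le> \<bar>exp (- u z) * indicator S z * (v \<bullet> grad u z)\<bar>" for k
    proof (intro AE_I2)
      fix z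
      have "cutoff k z * exp (- u z / 2) \<le> exp (- u z)"
        using mult_right_mono[OF cutoff_le, of "exp (- u z / 2)" k z] by (simp only: exp_half_mult exp_ge_zero)
      then have "\<bar>?a k z\<bar> \<le> exp (- u z) * \<bar>v \<bullet> grad u z\<bar>"
        using cutoff_nonneg[of k z] by (simp add: abs_mult mult_right_mono)
      then show "norm (indicator S z * ?a k z) \<le> \<bar>exp (- u z) * indicator S z * (v \<bullet> grad u z)\<bar>"
        by (simp add: indicator_def abs_mult)
    qed
  qed
  then show ?thesis unfolding zero eq by (simp add: LIMSEQ_const_iff)
qed

text \<open>The derivative along \<open>v\<close> of (v . grad u) times the squared cutoff is
  \<open>?A\<close> - \<open>?B\<close> and integrates to 0. Both terms are nonnegative, so monotone
  convergence gives the identity in [0, infinity] without knowing that either side is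
  finite.\<close>

lemma nn_integral_Hess_eq:
  "(\<integral>\<^sup>+z. ennreal (indicator S z * (v \<bullet> (Hess u z *v v))) \<partial>N)
    = (\<integral>\<^sup>+z. ennreal (indicator S z * (v \<bullet> grad u z)\<^sup>2) \<partial>N)"
proof -
  let ?A = "\<lambda>k z. (v \<bullet> (Hess u z *v v)) * (cutoff k z)\<^sup>2"
  let ?B = "\<lambda>k z. (v \<bullet> grad u z)\<^sup>2 * (cutoff k z * exp (- u z / 2))"
  have contH: "continuous_on S (\<lambda>z. v \<bullet> (Hess u z *v v))"
    by (intro continuous_on_inner continuous_on_const
        bounded_bilinear.continuous_on[OF bounded_bilinear_matrix_vector_mult] continuous_on_Hess)
  have contG: "continuous_on S (\<lambda>z. (v \<bullet> grad u z)\<^sup>2)"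
    by (intro continuous_intros continuous_on_grad)
  have contA: "continuous_on S (?A k)" for k
    by (intro continuous_on_mult contH continuous_on_power continuous_on_cutoff)
  have contE: "continuous_on S (\<lambda>z. exp (- u z / 2))" by (intro continuous_intros continuous_on_u) auto
  have contB: "continuous_on S (?B k)" for k
    by (intro continuous_on_mult contG contE continuous_on_cutoff)
  have A0: "0 \<le> indicator S z * ?A k z" and B0: "0 \<le> indicator S z * ?B k z" for k z
    using Hess_nonneg[of z v] cutoff_nonneg[of k z] by (auto simp: indicator_def)
  have intl: "integrable lborel (\<lambda>z. indicator S z * F z)"
    if c: "continuous_on S F" and v: "\<And>z. z \<in> S \<Longrightarrow> z \<notin> sublevel (real k) \<Longrightarrow> F z = 0" for F :: "real ^ 'n \<Rightarrow> real" and k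
  proof -
    obtain B where "0 < B" "\<And>z. z \<in> sublevel (real k) \<Longrightarrow> \<bar>F z\<bar> \<le> B"
      using bounded_abs_on_compact[OF compact_sublevel sublevel_subset c] by blast
    show ?thesis
    proof (rule Bochner_Integration.integrable_bound)
      show "integrable lborel (\<lambda>z. indicator (sublevel (real k)) z * B)"
        using emeasure_compact_finite[OF compact_sublevel]
        by (intro integrable_mult_left integrable_real_indicator) auto
      show "AE z in lborel. norm (indicator S z * F z) \<le> norm (indicator (sublevel (real k)) z * B)"
      proof (intro AE_I2)
        fix z show "norm (indicator S z * F z) \<le> norm (indicator (sublevel (real k)) z * B)"
          using v[of z] \<open>0 < B\<close> \<open>\<And>z. z \<in> sublevel (real k) \<Longrightarrow> \<bar>F z\<bar> \<le> B\<close>[of z]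
          by (cases "z \<in> sublevel (real k)"; cases "z \<in> S") auto
      qed
    qed (use measurable_indicator_mult[OF c] in auto)
  qed
  have iA: "integrable lborel (\<lambda>z. indicator S z * ?A k z)" for k
    by (rule intl[OF contA, of k]) (simp add: cutoff_eq_0)
  have iB: "integrable lborel (\<lambda>z. indicator S z * ?B k z)" for k
    by (rule intl[OF contB, of k]) (simp add: cutoff_eq_0)
  have eqk: "(\<integral>\<^sup>+z. ennreal (indicator S z * ?A k z) \<partial>lborel) = (\<integral>\<^sup>+z. ennreal (indicator S z * ?B k z) \<partial>lborel)" for k
  proof -
    have "(LINT z|lborel. indicator S z * (?A k z - ?B k z)) = 0"
    proof (rule integral_directional_derivative_dom_eq_0)
      show "continuous_on S (\<lambda>z. (v \<bullet> grad u z) * (cutoff k z)\<^sup>2)"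
        by (intro continuous_intros continuous_on_cutoff continuous_on_grad)
      show "continuous_on S (\<lambda>z. ?A k z - ?B k z)" by (intro continuous_on_diff contA contB)
      show "((\<lambda>s. (v \<bullet> grad u (z + s *\<^sub>R v)) * (cutoff k (z + s *\<^sub>R v))\<^sup>2) has_real_derivative
          ?A k (z + s *\<^sub>R v) - ?B k (z + s *\<^sub>R v)) (at s)" if "z + s *\<^sub>R v \<in> S" for z s
        using DERIV_mult[OF DERIV_Hess_line[OF differentiable_grad[OF that], of v] DERIV_cutoff_power2[OF that, of k]]
        by (simp add: power2_eq_square algebra_simps)
    qed (use compact_sublevel[of "real k"] sublevel_subset[of "real k"] cutoff_eq_0[of _ k] in \<open>auto\<close>)
    then have "(LINT z|lborel. indicator S z * ?A k z) = (LINT z|lborel. indicator S z * ?B k z)"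
      using iA[of k] iB[of k] by (simp add: right_diff_distrib)
    then show ?thesis
      by (simp only: nn_integral_eq_integral[OF iA[of k] AE_I2[OF A0]] nn_integral_eq_integral[OF iB[of k] AE_I2[OF B0]])
  qed
  \<comment> \<open>The two sides carry different weights, the squared cutoff and the cutoff times
    exp (- u / 2), but both increase to exp (- u).\<close>
  have limit: "(SUP k. \<integral>\<^sup>+z. ennreal (indicator S z * (F z * c k z)) \<partial>lborel) = (\<integral>\<^sup>+z. ennreal (indicator S z * F z) \<partial>N)"
    if F: "continuous_on S F" "\<And>z. z \<in> S \<Longrightarrow> 0 \<le> F z" and c: "\<And>k. continuous_on S (c k)" "\<And>k z. 0 \<le> c k z"
      "\<And>k l z. k \<le> l \<Longrightarrow> c k z \<le> c l z" "\<And>z. (\<lambda>k. c k z) \<longlonglongrightarrow> exp (- u z)" for F :: "real ^ 'n \<Rightarrow> real" and c :: "nat \<Rightarrow> real ^ 'n \<Rightarrow> real"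
  proof -
    have cF: "continuous_on S (\<lambda>z. F z * c k z)" for k by (intro continuous_on_mult F c)
    have inc: "incseq (\<lambda>k z. ennreal (indicator S z * (F z * c k z)))"
      unfolding incseq_def le_fun_def using F(2) c(3)
      by (auto simp: indicator_def intro!: ennreal_leI mult_left_mono)
    have sup: "(SUP k. ennreal (indicator S z * (F z * c k z))) = ennreal (indicator S z * (F z * exp (- u z)))" for z
    proof (rule LIMSEQ_unique[OF LIMSEQ_SUP])
      show "incseq (\<lambda>k. ennreal (indicator S z * (F z * c k z)))"
        using inc by (auto simp: incseq_def le_fun_def)
      show "(\<lambda>k. ennreal (indicator S z * (F z * c k z))) \<longlonglongrightarrow> ennreal (indicator S z * (F z * exp (- u z)))"
        by (intro tendsto_ennrealI tendsto_intros c(4))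
    qed
    have "(SUP k. \<integral>\<^sup>+z. ennreal (indicator S z * (F z * c k z)) \<partial>lborel)
        = (\<integral>\<^sup>+z. (SUP k. ennreal (indicator S z * (F z * c k z))) \<partial>lborel)"
      using measurable_indicator_mult[OF cF]
      by (intro nn_integral_monotone_convergence_SUP[symmetric] inc) auto
    also have "\<dots> = (\<integral>\<^sup>+z. ennreal (indicator S z * F z) \<partial>N)"
      unfolding sup using measurable_indicator_mult[OF F(1)]
      by (subst nn_integral_N) (auto simp: indicator_def ennreal_mult' F(2) ac_simps intro!: nn_integral_cong)
    finally show ?thesis .
  qed
  have "(\<integral>\<^sup>+z. ennreal (indicator S z * (v \<bullet> (Hess u z *v v))) \<partial>N)
      = (SUP k. \<integral>\<^sup>+z. ennreal (indicator S z * ?A k z) \<partial>lborel)"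
  proof (rule limit[symmetric])
    show "(\<lambda>k. (cutoff k z)\<^sup>2) \<longlonglongrightarrow> exp (- u z)" for z
      using tendsto_power[OF cutoff_tendsto, of z 2] by (simp only: power2_eq_square exp_half_mult)
  qed (auto intro: contH Hess_nonneg continuous_on_power continuous_on_cutoff power_mono cutoff_nonneg cutoff_mono)
  also have "\<dots> = (SUP k. \<integral>\<^sup>+z. ennreal (indicator S z * ?B k z) \<partial>lborel)" unfolding eqk ..
  also have "\<dots> = (\<integral>\<^sup>+z. ennreal (indicator S z * (v \<bullet> grad u z)\<^sup>2) \<partial>N)"
  proof (rule limit)
    show "(\<lambda>k. cutoff k z * exp (- u z / 2)) \<longlonglongrightarrow> exp (- u z)" for z
      using tendsto_mult[OF cutoff_tendsto tendsto_const, of z "exp (- u z / 2)"] by (simp only: exp_half_mult)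
    show "continuous_on S (\<lambda>z. cutoff k z * exp (- u z / 2))" for k
      by (intro continuous_on_mult contE continuous_on_cutoff)
  qed (auto intro: contG mult_right_mono mult_nonneg_nonneg cutoff_nonneg cutoff_mono)
  finally show ?thesis .
qed

end

section \<open>Moment measures\<close>

lemma ereal_fin: "\<phi> z \<noteq> -\<infinity> \<Longrightarrow> z \<in> edom \<phi> \<Longrightarrow> \<phi> z = ereal (fin \<phi> z)"
  by (cases "\<phi> z") (auto simp: edom_def fin_def)

text \<open>The push-forward needs measurability on the whole space, also where
  \<open>fin \<phi>\<close> is merely a default value. The gradient is continuous on the domain,
  constant on its boundary and 0 outside its closure.\<close>

lemma borel_measurable_grad_fin:
  fixes \<phi> :: "real ^ 'n \<Rightarrow> ereal"
  assumes cont: "continuous_on UNIV \<phi>" and ninf: "\<And>z. \<phi> z \<noteq> -\<infinity>" and C2: "C2_on (edom \<phi>) (fin \<phi>)"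
  shows "grad (fin \<phi>) \<in> borel_measurable borel"
proof -
  let ?S = "edom \<phi>" and ?u = "fin \<phi>"
  \<comment> \<open>The value of a definite description that nothing satisfies: it is the same at
    every point where \<open>fin \<phi>\<close> has no gradient.\<close>
  define c where "c = (THE D::real ^ 'n. False)"
  have op: "open ?S" unfolding edom_def by (intro open_Collect_less cont continuous_on_const)
  have out: "?u z = 0" if "z \<notin> ?S" for z using that by (auto simp: fin_def edom_def)
  have eq: "grad ?u z = indicator ?S z *\<^sub>R grad ?u z + indicator (closure ?S - ?S) z *\<^sub>R c" for z
  proof -
    consider "z \<in> ?S" | "z \<in> closure ?S - ?S" | "z \<notin> closure ?S" using closure_subset by blast
    then show ?thesis
    proof cases
      case 2
      \<comment> \<open>At a boundary point \<open>fin\<close> has the default value 0.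
        Differentiability would force values below 1 nearby, while \<open>\<phi>\<close> exceeds 1
        there; no point of the domain could then be close.\<close>
      have "\<not> GDERIV ?u z :> D" for D
      proof
        assume "GDERIV ?u z :> D"
        then have "isCont ?u z" unfolding gderiv_def by (rule has_derivative_continuous)
        then have "(?u \<longlongrightarrow> 0) (at z)" using out[of z] 2 by (simp add: isCont_def)
        then have "\<forall>\<^sub>F w in at z. ?u w < 1" by (rule order_tendstoD) simp
        moreover have "\<forall>\<^sub>F w in at z. ereal 1 < \<phi> w"
        proof (rule order_tendstoD(1))
          show "(\<phi> \<longlongrightarrow> \<phi> z) (at z)" using cont by (simp add: continuous_on_eq_continuous_at isCont_def)
          show "ereal 1 < \<phi> z" using 2 by (auto simp: edom_def)
        qed
        ultimately have "\<forall>\<^sub>F w in at z. w \<notin> ?S"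
        proof eventually_elim
          case (elim w)
          then show ?case using ereal_fin[of \<phi> w, OF ninf] by auto
        qed
        then obtain d where d: "0 < d" "\<And>w. w \<noteq> z \<Longrightarrow> dist w z < d \<Longrightarrow> w \<notin> ?S"
          unfolding eventually_at by auto
        obtain w where "w \<in> ?S" "dist w z < d" using 2 d(1) closure_approachable by blast
        with d(2)[of w] 2 show False by auto
      qed
      then have "gderiv ?u z = (\<lambda>_. False)" by (simp add: fun_eq_iff)
      then have "grad ?u z = c" by (simp add: grad_def c_def)
      then show ?thesis using 2 by simp
    next
      case 3
      have "((\<lambda>_. 0) has_derivative (\<lambda>h. h \<bullet> 0)) (at z)" by simp
      then have "(?u has_derivative (\<lambda>h. h \<bullet> 0)) (at z)"
        by (rule has_derivative_transform_within_open[where s = "- closure ?S"])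
          (use 3 out closure_subset[of ?S] in auto)
      then have "GDERIV ?u z :> 0" by (simp add: gderiv_def)
      then show ?thesis using 3 closure_subset[of ?S] grad_eqI by (auto simp: indicator_def)
    qed (simp add: closure_subset)
  qed
  have 1: "(\<lambda>z. indicator ?S z *\<^sub>R grad ?u z) \<in> borel_measurable borel"
    using C2 op by (intro borel_measurable_continuous_on_indicator) (auto simp: C2_on_def C1_on_def)
  have 2: "(\<lambda>z. indicator (closure ?S - ?S) z *\<^sub>R c) \<in> borel_measurable borel"
    using op by (intro borel_measurable_scaleR borel_measurable_indicator) auto
  have "(\<lambda>z. indicator ?S z *\<^sub>R grad ?u z + indicator (closure ?S - ?S) z *\<^sub>R c) \<in> borel_measurable borel"
    using 1 2 by (rule borel_measurable_add)
  then show ?thesis by (simp only: eq[symmetric])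
qed

lemma matrix_entry_eq_inner: "(A :: real ^ 'n ^ 'n) $ i $ i = axis i 1 \<bullet> (A *v axis i 1)"
  by (simp add: matrix_vector_mult_basis inner_axis' column_def)

lemma borel_measurable_matrix_entry:
  fixes A :: "'a \<Rightarrow> real ^ 'n ^ 'm"
  assumes "A \<in> borel_measurable M"
  shows "(\<lambda>x. A x $ i $ j) \<in> borel_measurable M"
proof -
  have "continuous_on UNIV (\<lambda>B::real ^ 'n ^ 'm. B $ i $ j)" by (intro continuous_intros)
  from measurable_compose[OF assms borel_measurable_continuous_onI[OF this]] show ?thesis .
qed

lemma psd_trace_nonneg: "A \<in> psd_cone \<Longrightarrow> 0 \<le> trace A"
  and psd_diag_nonneg: "A \<in> psd_cone \<Longrightarrow> 0 \<le> A $ i $ i"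
proof -
  have *: "0 \<le> A $ i $ i" if "A \<in> psd_cone" for A :: "real ^ 'n ^ 'n" and i
    unfolding matrix_entry_eq_inner using that by (auto simp: psd_cone_def)
  show "A \<in> psd_cone \<Longrightarrow> 0 \<le> A $ i $ i" by (rule *)
  show "A \<in> psd_cone \<Longrightarrow> 0 \<le> trace A" unfolding trace_def by (intro sum_nonneg *)
qed

lemma grad_component: "grad (\<lambda>x::real ^ 'n. x $ i) x = axis i 1"
proof (rule grad_eqI)
  have "((\<lambda>x::real ^ 'n. x $ i) has_derivative (\<lambda>h. h $ i)) (at x)"
    by (rule bounded_linear_imp_has_derivative[OF bounded_linear_vec_nth])
  then show "GDERIV (\<lambda>x::real ^ 'n. x $ i) x :> axis i 1" by (simp add: gderiv_def inner_axis)
qed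

section \<open>The lower bound on the Poincare constant\<close>

locale mean_cov_prob = prob_space \<mu> for \<mu> :: "(real ^ 'n) measure" +
  assumes sets_mu [measurable_cong]: "sets \<mu> = sets borel" and mean_cov: "mean_cov_exist \<mu>"
begin

lemma integrable_component: "integrable \<mu> (\<lambda>x. x $ i)"
  and mean_component: "mean \<mu> $ i = (LINT x|\<mu>. x $ i)"
proof -
  have "has_bochner_integral \<mu> (\<lambda>x. x) (mean \<mu>)"
    using mean_cov unfolding mean_def mean_cov_exist_def by (auto intro: has_bochner_integral_integrable)
  from has_bochner_integral_bounded_linear[OF bounded_linear_vec_nth this, of i]
  have "has_bochner_integral \<mu> (\<lambda>x. x $ i) (mean \<mu> $ i)" .
  then show "integrable \<mu> (\<lambda>x. x $ i)" "mean \<mu> $ i = (LINT x|\<mu>. x $ i)"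
    by (auto simp: has_bochner_integral_iff)
qed

lemma has_integral_variance: "has_bochner_integral \<mu> (\<lambda>x. (x $ i - mean \<mu> $ i)\<^sup>2) (Cov \<mu> $ i $ i)"
proof -
  have "has_bochner_integral \<mu> (cov_integrand \<mu>) (Cov \<mu>)"
    using mean_cov unfolding Cov_def mean_cov_exist_def by (auto intro: has_bochner_integral_integrable)
  from has_bochner_integral_bounded_linear[OF bounded_linear_compose[OF bounded_linear_vec_nth bounded_linear_vec_nth] this, of i i]
  show ?thesis by (simp add: cov_integrand_def power2_eq_square)
qed

lemma Cov_diag_nonneg: "0 \<le> Cov \<mu> $ i $ i"
proof -
  have "0 \<le> (LINT x|\<mu>. (x $ i - mean \<mu> $ i)\<^sup>2)" by (rule integral_nonneg_AE) simp
  then show ?thesis using has_integral_variance[of i] by (simp only: has_bochner_integral_integral_eq)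
qed

lemma Var_component: "Var \<mu> (\<lambda>x. x $ i) = Cov \<mu> $ i $ i"
  using has_integral_variance[of i] by (simp add: Var_def mean_component[symmetric] has_bochner_integral_iff)

lemma integrable_component_power2: "integrable \<mu> (\<lambda>x. (x $ i)\<^sup>2)"
proof -
  have "integrable \<mu> (\<lambda>x. (x $ i - mean \<mu> $ i)\<^sup>2 + 2 * mean \<mu> $ i * x $ i - (mean \<mu> $ i)\<^sup>2)"
    using has_integral_variance[of i] integrable_component[of i]
    by (intro Bochner_Integration.integrable_add Bochner_Integration.integrable_diff integrable_mult_right)
      (auto simp: has_bochner_integral_iff)
  moreover have "(x $ i - mean \<mu> $ i)\<^sup>2 + 2 * mean \<mu> $ i * x $ i - (mean \<mu> $ i)\<^sup>2 = (x $ i)\<^sup>2" for x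
    by (simp add: power2_eq_square algebra_simps)
  ultimately show ?thesis by simp
qed

text \<open>The coordinate functions are the competitors: their variances add up to \<open>trace (Cov \<mu>)\<close> and
  their energies to \<open>\<integral> trace W\<close>.\<close>

lemma one_le_poincare_const:
  assumes W: "W \<in> feasible_fields \<mu>" and pos: "0 < trace (Cov \<mu>)"
  shows "1 \<le> poincare_const \<mu> W"
  unfolding poincare_const_def
proof (rule Inf_greatest)
  fix C assume "C \<in> {C. \<forall>f\<in>test_functions \<mu> W. ennreal (Var \<mu> f) \<le> C * energy \<mu> W f}"
  then have C: "\<And>f. f \<in> test_functions \<mu> W \<Longrightarrow> ennreal (Var \<mu> f) \<le> C * energy \<mu> W f" by blast
  have meas [measurable]: "W \<in> borel_measurable \<mu>" and psd: "\<And>x. W x \<in> psd_cone"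
    and tr: "has_bochner_integral \<mu> (\<lambda>x. trace (W x)) (trace (Cov \<mu>))"
    using W by (auto simp: feasible_fields_def)
  have [measurable]: "(\<lambda>x. W x $ i $ i) \<in> borel_measurable \<mu>" for i
    using borel_measurable_matrix_entry[OF meas] .
  have en: "energy \<mu> W (\<lambda>x. x $ i) = (\<integral>\<^sup>+x. ennreal (W x $ i $ i) \<partial>\<mu>)" for i
    unfolding energy_def grad_component matrix_entry_eq_inner[symmetric] ..
  have "(\<Sum>i\<in>UNIV. energy \<mu> W (\<lambda>x. x $ i)) = (\<integral>\<^sup>+x. (\<Sum>i\<in>UNIV. ennreal (W x $ i $ i)) \<partial>\<mu>)"
    unfolding en by (subst nn_integral_sum) auto
  also have "\<dots> = (\<integral>\<^sup>+x. ennreal (trace (W x)) \<partial>\<mu>)"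
    by (intro nn_integral_cong) (simp add: trace_def psd_diag_nonneg psd)
  also have "\<dots> = ennreal (trace (Cov \<mu>))"
    using tr psd_trace_nonneg[OF psd] by (subst nn_integral_eq_integral) (auto simp: has_bochner_integral_iff)
  finally have sum: "(\<Sum>i\<in>UNIV. energy \<mu> W (\<lambda>x. x $ i)) = ennreal (trace (Cov \<mu>))" .
  \<comment> \<open>The energies have a finite sum, so each coordinate function has finite energy
    and is admissible.\<close>
  have "energy \<mu> W (\<lambda>x. x $ i) < \<infinity>" for i
    using member_le_sum[of i UNIV "\<lambda>i. energy \<mu> W (\<lambda>x. x $ i)"] unfolding sum
    by (auto intro: order_le_less_trans)
  moreover have "C1_on UNIV (\<lambda>x::real ^ 'n. x $ i)" for i
  proof -
    have "grad (\<lambda>x::real ^ 'n. x $ i) = (\<lambda>_. axis i 1)" by (rule ext) (rule grad_component)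
    moreover have "(\<lambda>x::real ^ 'n. x $ i) differentiable (at x)" for x
      by (rule linear_imp_differentiable) (simp add: bounded_linear.linear bounded_linear_vec_nth)
    ultimately show ?thesis unfolding C1_on_def by auto
  qed
  ultimately have "(\<lambda>x. x $ i) \<in> test_functions \<mu> W" for i
    using integrable_component_power2[of i] by (simp add: test_functions_def)
  then have le: "ennreal (Cov \<mu> $ i $ i) \<le> C * energy \<mu> W (\<lambda>x. x $ i)" for i
    using C[of "\<lambda>x. x $ i"] by (simp add: Var_component)
  have "ennreal (trace (Cov \<mu>)) = (\<Sum>i\<in>UNIV. ennreal (Cov \<mu> $ i $ i))"
    by (simp add: trace_def Cov_diag_nonneg)
  also have "\<dots> \<le> C * ennreal (trace (Cov \<mu>))"
    unfolding sum[symmetric] sum_distrib_left by (intro sum_mono le)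
  finally have main: "ennreal (trace (Cov \<mu>)) \<le> C * ennreal (trace (Cov \<mu>))" .
  \<comment> \<open>A constant below 1 is finite, and the positive trace cancels.\<close>
  show "1 \<le> C"
  proof (rule ccontr)
    assume "\<not> 1 \<le> C"
    then obtain r where r: "0 \<le> r" "C = ennreal r" "r < 1" by (cases C) auto
    have "trace (Cov \<mu>) \<le> r * trace (Cov \<mu>)" using main r pos by (simp flip: ennreal_mult)
    then show False using r pos by simp
  qed
qed

end

section \<open>The field of a moment measure\<close>

locale moment_measure = mean_cov_prob \<mu> for \<mu> :: "(real ^ 'n) measure" +
  fixes \<phi> :: "real ^ 'n \<Rightarrow> ereal"
  assumes moment: "is_moment_measure \<mu> \<phi>" and strictly_convex: "strictly_convex_fun \<phi>"
    and C2_fin: "C2_on (edom \<phi>) (fin \<phi>)"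
begin

lemma not_MInf: "\<phi> z \<noteq> -\<infinity>"
  and continuous_phi: "continuous_on UNIV \<phi>"
  using moment by (auto simp: is_moment_measure_def convex_fun_def locally_lipschitz_fun_def)

lemmas phi_eq = ereal_fin[of \<phi>, OF not_MInf]

lemma measurable_grad [measurable]: "grad (fin \<phi>) \<in> borel_measurable borel"
  by (rule borel_measurable_grad_fin[OF continuous_phi not_MInf C2_fin])

lemma gibbs_weight_eq: "gibbs_weight \<phi> z = ennreal (indicator (edom \<phi>) z * exp (- fin \<phi> z))"
  by (simp add: gibbs_weight_def)

lemma fin_convex:
  assumes "x \<in> edom \<phi>" "y \<in> edom \<phi>" "0 < t" "t < 1"
  shows "(1 - t) *\<^sub>R x + t *\<^sub>R y \<in> edom \<phi> \<and>
    fin \<phi> ((1 - t) *\<^sub>R x + t *\<^sub>R y) \<le> (1 - t) * fin \<phi> x + t * fin \<phi> y"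
proof -
  have le: "\<phi> ((1 - t) *\<^sub>R x + t *\<^sub>R y) \<le> ereal (1 - t) * \<phi> x + ereal t * \<phi> y"
    using moment assms by (auto simp: is_moment_measure_def convex_fun_def)
  then have *: "\<phi> ((1 - t) *\<^sub>R x + t *\<^sub>R y) \<le> ereal ((1 - t) * fin \<phi> x + t * fin \<phi> y)"
    using phi_eq[OF assms(1)] phi_eq[OF assms(2)] by simp
  then have mem: "(1 - t) *\<^sub>R x + t *\<^sub>R y \<in> edom \<phi>"
    by (auto simp: edom_def intro: order_le_less_trans)
  with * phi_eq[OF mem] show ?thesis by simp
qed

sublocale gibbs "edom \<phi>" "fin \<phi>"
proof
  show "open (edom \<phi>)"
    unfolding edom_def by (intro open_Collect_less continuous_phi continuous_on_const)
  have "convex (edom \<phi>)" unfolding convex_alt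
  proof (intro ballI allI impI)
    fix x y t assume "x \<in> edom \<phi>" "y \<in> edom \<phi>" "0 \<le> t \<and> t \<le> (1::real)"
    then show "(1 - t) *\<^sub>R x + t *\<^sub>R y \<in> edom \<phi>"
      using fin_convex[of x y t] by (cases "t = 0"; cases "t = 1") auto
  qed
  then show "convex_on (edom \<phi>) (fin \<phi>)"
    using fin_convex by (intro convex_onI) auto
  show "C2_on (edom \<phi>) (fin \<phi>)" by (rule C2_fin)
  show "closed {z \<in> edom \<phi>. fin \<phi> z \<le> c}" for c
  proof -
    \<comment> \<open>Continuity of \<open>\<phi>\<close> as an extended-valued function makes the
      sublevel sets closed in the whole space, not merely relative to the domain.\<close>
    have "{z \<in> edom \<phi>. fin \<phi> z \<le> c} = {z. \<phi> z \<le> ereal c}"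
    proof (intro set_eqI iffI; clarsimp)
      fix z assume "z \<in> edom \<phi>" "fin \<phi> z \<le> c"
      then show "\<phi> z \<le> ereal c" using phi_eq by simp
    next
      fix z assume le: "\<phi> z \<le> ereal c"
      then have "z \<in> edom \<phi>" by (auto simp: edom_def)
      then show "z \<in> edom \<phi> \<and> fin \<phi> z \<le> c" using le phi_eq[of z] by simp
    qed
    then show ?thesis by (simp add: closed_Collect_le continuous_phi)
  qed
  have eq: "\<mu> = distr (density lborel (gibbs_weight \<phi>)) borel (grad (fin \<phi>))"
    using moment by (simp add: is_moment_measure_def)
  have [measurable]: "edom \<phi> \<in> sets borel" using \<open>open (edom \<phi>)\<close> by simp
  have "(\<lambda>z. indicator (edom \<phi>) z *\<^sub>R exp (- fin \<phi> z)) \<in> borel_measurable borel"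
  proof (rule borel_measurable_continuous_on_indicator)
    have "continuous_on (edom \<phi>) (fin \<phi>)" using C2_fin
      by (auto simp: C2_on_def C1_on_def intro!: continuous_at_imp_continuous_on differentiable_imp_continuous_within)
    then show "continuous_on (edom \<phi>) (\<lambda>z. exp (- fin \<phi> z))" by (intro continuous_intros)
  qed measurable
  then have m: "gibbs_weight \<phi> \<in> borel_measurable lborel" unfolding gibbs_weight_eq[abs_def] by simp
  have "1 = emeasure \<mu> UNIV" using emeasure_space_1 sets_eq_imp_space_eq[OF sets_mu] by simp
  also have "\<dots> = (\<integral>\<^sup>+z. gibbs_weight \<phi> z \<partial>lborel)"
    unfolding eq using m by (simp add: emeasure_distr emeasure_density)
  finally show "(\<integral>\<^sup>+z. ennreal (indicator (edom \<phi>) z * exp (- fin \<phi> z)) \<partial>lborel) = 1"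
    by (simp add: gibbs_weight_eq)
  show "fin \<phi> ((1/2) *\<^sub>R (x + y)) < (fin \<phi> x + fin \<phi> y) / 2" if "x \<in> edom \<phi>" "y \<in> edom \<phi>" "x \<noteq> y" for x y
  proof -
    have "\<phi> ((1 - 1/2) *\<^sub>R x + (1/2) *\<^sub>R y) < ereal (1 - 1/2) * \<phi> x + ereal (1/2) * \<phi> y"
      using strictly_convex that unfolding strictly_convex_fun_def
      by (metis half_gt_zero_iff less_numeral_extra(1) field_sum_of_halves less_add_same_cancel1)
    moreover have "(1 - 1/2) *\<^sub>R x + (1/2) *\<^sub>R y \<in> edom \<phi>" using fin_convex[OF that(1,2), of "1/2"] by simp
    ultimately show ?thesis
      using phi_eq[OF that(1)] phi_eq[OF that(2)] phi_eq[of "(1 - 1/2) *\<^sub>R x + (1/2) *\<^sub>R y"]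
      by (simp add: scaleR_add_right add_divide_distrib)
  qed
qed

lemma mu_eq: "\<mu> = distr N borel (grad (fin \<phi>))"
  using moment unfolding is_moment_measure_def N_def by (simp add: gibbs_weight_eq[abs_def])

abbreviation "S \<equiv> edom \<phi>"
abbreviation "T \<equiv> grad (fin \<phi>)"
abbreviation "H \<equiv> Hess (fin \<phi>)"
abbreviation "W \<equiv> moment_field \<phi>"

lemma measurable_T_N: "T \<in> measurable N borel"
  by simp

lemma W_T: "z \<in> S \<Longrightarrow> W (T z) = H z"
  by (simp add: moment_field_def inv_into_f_f inj_on_grad)

lemma W_psd: "W x \<in> psd_cone"
proof (cases "x \<in> T ` S")
  case True
  then show ?thesis using W_T Hess_psd by auto
next
  case False
  then show ?thesis by (simp add: moment_field_def psd_cone_def transpose_def vec_eq_iff)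
qed

lemma measurable_W: "W \<in> borel_measurable borel"
proof -
  have "open (T ` S)"
    by (intro invariance_of_domain continuous_on_grad open_dom inj_on_grad)
  moreover have "continuous_on (T ` S) (inv_into S T)"
    by (rule continuous_on_inverse_open[OF open_dom continuous_on_grad]) (auto simp: inj_on_grad)
  then have "continuous_on (T ` S) (\<lambda>x. H (inv_into S T x))"
    by (rule continuous_on_compose2[OF continuous_on_Hess]) (auto simp: inj_on_grad)
  ultimately have "(\<lambda>x. indicator (T ` S) x *\<^sub>R H (inv_into S T x)) \<in> borel_measurable borel"
    by (intro borel_measurable_continuous_on_indicator) auto
  moreover have "W = (\<lambda>x. indicator (T ` S) x *\<^sub>R H (inv_into S T x))"
    by (auto simp: moment_field_def fun_eq_iff)
  ultimately show ?thesis by simp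
qed

lemma nn_integral_mu:
  assumes [measurable]: "F \<in> borel_measurable borel" and "\<And>z. z \<in> S \<Longrightarrow> F (T z) = ennreal (G z)"
  shows "(\<integral>\<^sup>+x. F x \<partial>\<mu>) = (\<integral>\<^sup>+z. ennreal (indicator S z * G z) \<partial>N)"
proof -
  have "(\<integral>\<^sup>+x. F x \<partial>\<mu>) = (\<integral>\<^sup>+z. F (T z) \<partial>N)"
    unfolding mu_eq by (rule nn_integral_distr) (use measurable_T_N assms in auto)
  also have "\<dots> = (\<integral>\<^sup>+z. ennreal (indicator S z * G z) \<partial>N)"
    by (rule nn_integral_cong_AE) (use AE_N_S assms(2) in \<open>auto elim!: eventually_mono\<close>)
  finally show ?thesis .
qed

text \<open>The factor \<open>indicator S\<close> changes nothing almost everywhere and lets the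
  integrand be handled by its continuity on \<open>S\<close> alone.\<close>

lemma integral_mu:
  fixes F :: "real ^ 'n \<Rightarrow> real"
  assumes [measurable]: "F \<in> borel_measurable borel" and "continuous_on S (\<lambda>z. F (T z))"
  shows "(LINT x|\<mu>. F x) = (LINT z|N. indicator S z * F (T z))"
    and "integrable \<mu> F \<longleftrightarrow> integrable N (\<lambda>z. indicator S z * F (T z))"
proof -
  have m: "(\<lambda>z. F (T z)) \<in> borel_measurable N" "(\<lambda>z. indicator S z * F (T z)) \<in> borel_measurable N"
    using measurable_indicator_mult[OF assms(2)] by auto
  have ae: "AE z in N. F (T z) = indicator S z * F (T z)"
    using AE_N_S by (auto elim!: eventually_mono)
  have "(LINT x|\<mu>. F x) = (LINT z|N. F (T z))" unfolding mu_eq by (rule integral_distr) auto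
  also have "\<dots> = (LINT z|N. indicator S z * F (T z))" using m ae by (rule integral_cong_AE)
  finally show "(LINT x|\<mu>. F x) = (LINT z|N. indicator S z * F (T z))" .
  have "integrable \<mu> F \<longleftrightarrow> integrable N (\<lambda>z. F (T z))" unfolding mu_eq by (rule integrable_distr_eq) auto
  also have "\<dots> \<longleftrightarrow> integrable N (\<lambda>z. indicator S z * F (T z))" using m ae by (rule integrable_cong_AE)
  finally show "integrable \<mu> F \<longleftrightarrow> integrable N (\<lambda>z. indicator S z * F (T z))" .
qed

text \<open>Moment measures are automatically centred, since T exp (- \<open>\<phi>\<close>) is
  minus the gradient of the weight. Hence variances are second moments, which is what integration by
  parts produces.\<close>

lemma mean_eq_0: "mean \<mu> = 0"
proof -
  have "mean \<mu> $ i = 0" for i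
  proof -
    have c: "continuous_on S (\<lambda>z. T z $ i)" by (intro continuous_intros continuous_on_grad)
    have e: "T z $ i = axis i 1 \<bullet> T z" for z by (simp add: inner_axis')
    have "integrable N (\<lambda>z. indicator S z * (T z $ i))"
      using integral_mu(2)[of "\<lambda>x. x $ i"] c integrable_component[of i] by simp
    then have "(LINT z|N. indicator S z * (T z $ i)) = 0" unfolding e by (rule integral_grad_eq_0)
    then show ?thesis using integral_mu(1)[of "\<lambda>x. x $ i"] c by (simp add: mean_component)
  qed
  then show ?thesis by (simp add: vec_eq_iff)
qed

text \<open>This is \<open>nn_integral_Hess_eq\<close> in the direction \<open>axis i 1\<close>,
  carried to \<open>\<mu>\<close>: the integral of the diagonal entry equals the second moment of
  the coordinate.\<close>

lemma has_integral_W_diag: "has_bochner_integral \<mu> (\<lambda>x. W x $ i $ i) (Cov \<mu> $ i $ i)"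
proof (rule has_bochner_integral_nn_integral)
  have m: "(\<lambda>x. W x $ i $ i) \<in> borel_measurable borel"
    using borel_measurable_matrix_entry[OF measurable_W] .
  then show "(\<lambda>x. W x $ i $ i) \<in> borel_measurable \<mu>" by (simp add: measurable_cong_sets[OF sets_mu refl])
  show "AE x in \<mu>. 0 \<le> W x $ i $ i" by (intro AE_I2 psd_diag_nonneg W_psd)
  have v: "has_bochner_integral \<mu> (\<lambda>x. (x $ i)\<^sup>2) (Cov \<mu> $ i $ i)"
    using has_integral_variance[of i] by (simp add: mean_eq_0)
  show "0 \<le> Cov \<mu> $ i $ i" by (rule Cov_diag_nonneg)
  have "(\<integral>\<^sup>+x. ennreal (W x $ i $ i) \<partial>\<mu>) = (\<integral>\<^sup>+z. ennreal (indicator S z * (axis i 1 \<bullet> (H z *v axis i 1))) \<partial>N)"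
    using m by (intro nn_integral_mu) (auto simp: W_T matrix_entry_eq_inner)
  also have "\<dots> = (\<integral>\<^sup>+z. ennreal (indicator S z * (axis i 1 \<bullet> T z)\<^sup>2) \<partial>N)" by (rule nn_integral_Hess_eq)
  also have "\<dots> = (\<integral>\<^sup>+x. ennreal ((x $ i)\<^sup>2) \<partial>\<mu>)"
    by (rule nn_integral_mu[symmetric]) (auto simp: inner_axis')
  also have "\<dots> = ennreal (Cov \<mu> $ i $ i)"
    using v by (subst nn_integral_eq_integral) (auto simp: has_bochner_integral_iff)
  finally show "(\<integral>\<^sup>+x. ennreal (W x $ i $ i) \<partial>\<mu>) = ennreal (Cov \<mu> $ i $ i)" .
qed

lemma W_feasible: "W \<in> feasible_fields \<mu>"
proof -
  have "has_bochner_integral \<mu> (\<lambda>x. trace (W x)) (trace (Cov \<mu>))"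
    unfolding trace_def by (intro has_bochner_integral_sum has_integral_W_diag)
  then show ?thesis
    using measurable_W W_psd by (simp add: feasible_fields_def measurable_cong_sets[OF sets_mu refl])
qed

text \<open>Since \<open>T\<close> is injective, \<open>\<mu>\<close> is not a Dirac mass.\<close>

lemma trace_Cov_pos: "0 < trace (Cov \<mu>)"
proof (rule ccontr)
  assume neg: "\<not> ?thesis"
  have v: "has_bochner_integral \<mu> (\<lambda>x. (x $ i)\<^sup>2) (Cov \<mu> $ i $ i)" for i
    using has_integral_variance[of i] by (simp add: mean_eq_0)
  have "trace (Cov \<mu>) = 0"
    using neg sum_nonneg[of UNIV "\<lambda>i. Cov \<mu> $ i $ i"] Cov_diag_nonneg by (simp add: trace_def)
  then have zero: "Cov \<mu> $ i $ i = 0" for i by (simp add: trace_def sum_nonneg_eq_0_iff Cov_diag_nonneg)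
  have "AE x in \<mu>. x $ i = 0" for i
  proof -
    have "AE x in \<mu>. (x $ i)\<^sup>2 = 0"
      using v[of i] zero[of i] integral_nonneg_eq_0_iff_AE[of \<mu> "\<lambda>x. (x $ i)\<^sup>2"] by (auto simp: has_bochner_integral_iff)
    then show ?thesis by simp
  qed
  then have "AE x in \<mu>. \<forall>i. x $ i = 0" by (subst AE_all_countable) auto
  then have "AE x in \<mu>. x = 0" by (simp add: vec_eq_iff)
  then have T0: "AE z in N. T z = 0"
    unfolding mu_eq by (subst (asm) AE_distr_iff) (auto intro: measurable_T_N)
  \<comment> \<open>\<open>N\<close> has a density and hence no atoms, whereas injectivity lets
    \<open>T\<close> vanish at no more than one point of \<open>S\<close>.\<close>
  have "AE z in N. z \<noteq> c" for c
  proof -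
    have m: "(\<lambda>z. ennreal (indicator S z * exp (- fin \<phi> z))) \<in> borel_measurable lborel" using measurable_weight by simp
    show ?thesis unfolding N_def AE_density[OF m]
      using AE_lborel_singleton[of c] by eventually_elim simp
  qed
  moreover have "\<exists>c. \<forall>z\<in>S. T z = 0 \<longrightarrow> z = c"
    using inj_on_grad unfolding inj_on_def by metis
  ultimately have "AE z in N. \<not> (z \<in> S \<and> T z = 0)" by (metis (mono_tags, lifting) eventually_mono)
  with T0 AE_N_S have "AE z in N. False" by eventually_elim simp
  then show False using N.AE_False by simp
qed

text \<open>The number 1 is itself an admissible constant: the change of variables by
  \<open>T\<close> turns the energy of f into the integral of \<open>form f\<close>, and
  \<open>brascamp_lieb\<close> bounds the variance by it.\<close>

lemma poincare_const_W_le: "poincare_const \<mu> W \<le> 1"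
  unfolding poincare_const_def
proof (rule Inf_lower, intro CollectI ballI)
  fix f assume f: "f \<in> test_functions \<mu> W"
  then have C1: "C1_on UNIV f" and int2: "integrable \<mu> (\<lambda>x. (f x)\<^sup>2)" and fin: "energy \<mu> W f < \<infinity>"
    by (auto simp: test_functions_def)
  have fc: "continuous_on UNIV f"
    using C1 by (rule C1_on_imp_continuous_on)
  then have fm [measurable]: "f \<in> borel_measurable borel" by (rule borel_measurable_continuous_onI)
  have gc: "continuous_on S (\<lambda>z. f (T z))" using continuous_on_compose2[OF fc continuous_on_grad] by simp
  have gm: "grad f \<in> borel_measurable borel"
    using C1 by (auto simp: C1_on_def intro: borel_measurable_continuous_onI)
  have "(\<lambda>x. W x *v grad f x) \<in> borel_measurable borel"
    using measurable_W gm
    by (rule borel_measurable_continuous_Pair)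
      (intro bounded_bilinear.continuous_on[OF bounded_bilinear_matrix_vector_mult] continuous_intros)
  then have em: "(\<lambda>x. grad f x \<bullet> (W x *v grad f x)) \<in> borel_measurable borel"
    using gm by (intro borel_measurable_inner)
  have en: "energy \<mu> W f = (\<integral>\<^sup>+z. ennreal (indicator S z * form f z) \<partial>N)"
    unfolding energy_def using em by (intro nn_integral_mu) (auto simp: W_T form_def)
  have form0: "0 \<le> indicator S z * form f z" for z using form_nonneg[of z f] by (simp add: indicator_def)
  have int_form: "integrable N (\<lambda>z. indicator S z * form f z)"
    using measurable_indicator_mult[OF continuous_on_form[OF C1]] fin form0 unfolding en
    by (intro integrableI_nonneg) auto
  have "integrable N (\<lambda>z. indicator S z * (f (T z))\<^sup>2)"
    using integral_mu(2)[of "\<lambda>x. (f x)\<^sup>2"] int2 gc by (simp add: continuous_on_power)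
  from brascamp_lieb[OF C1 this int_form]
  have "(LINT x|\<mu>. (f x)\<^sup>2) - (LINT x|\<mu>. f x)\<^sup>2 \<le> (LINT z|N. indicator S z * form f z)"
    using integral_mu(1)[OF fm gc] integral_mu(1)[of "\<lambda>x. (f x)\<^sup>2"] gc by (simp add: continuous_on_power)
  moreover have "Var \<mu> f = (LINT x|\<mu>. (f x)\<^sup>2) - (LINT x|\<mu>. f x)\<^sup>2"
  proof -
    have "integrable \<mu> f"
      using int2 by (rule square_integrable_imp_integrable[rotated]) (simp add: measurable_cong_sets[OF sets_mu refl])
    then show ?thesis unfolding Var_def using int2 by (rule variance_eq)
  qed
  ultimately have "ennreal (Var \<mu> f) \<le> ennreal (LINT z|N. indicator S z * form f z)" by (simp add: ennreal_leI)
  also have "\<dots> = energy \<mu> W f"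
    unfolding en using int_form form0 by (intro nn_integral_eq_integral[symmetric]) auto
  finally show "ennreal (Var \<mu> f) \<le> 1 * energy \<mu> W f" by simp
qed

end

theorem theorem2p1:
  fixes \<mu> :: "(real ^ 'n) measure" and \<phi> :: "real ^ 'n \<Rightarrow> ereal"
  assumes "prob_space \<mu>" and "sets \<mu> = sets borel"
    and "mean_cov_exist \<mu>"
    and "is_moment_measure \<mu> \<phi>"
    and "strictly_convex_fun \<phi>"
    and "C2_on (edom \<phi>) (fin \<phi>)"
  shows "is_arg_min (poincare_const \<mu>) (\<lambda>W'. W' \<in> feasible_fields \<mu>) (moment_field \<phi>)
    \<and> poincare_const \<mu> (moment_field \<phi>) = 1"
proof -
  interpret prob_space \<mu> by fact
  interpret moment_measure \<mu> \<phi>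
    by standard (fact assms)+
  have ge: "1 \<le> poincare_const \<mu> W'" if "W' \<in> feasible_fields \<mu>" for W'
    using one_le_poincare_const[OF that trace_Cov_pos] .
  have eq: "poincare_const \<mu> (moment_field \<phi>) = 1"
    using poincare_const_W_le ge[OF W_feasible] by (rule antisym)
  then show ?thesis unfolding is_arg_min_def using W_feasible ge by (auto simp: not_less)
qed

end
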